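(* Let $\mathcal P$ be the complete hyperbolic pair of pants with three cusps. There is a one-to-one correspondence between closed geodesics in $\mathcal P$ and non-periodic normal loop words (up to shifting): it sends a non-periodic normal loop word $w'$ to the closed geodesic in the free homotopy class $L[w']\in[S^1,\mathcal P]$.
   Context: $\pi_1(\mathcal P)=\langle\alpha,\beta,\gamma\mid\alpha\beta\gamma=1\rangle$, where $\alpha,\beta,\gamma$ are loops around the three punctures; $[S^1,\mathcal P]$ is the set of conjugacy classes in $\pi_1(\mathcal P)$. Closed geodesics are oriented, taken up to reparametrization, and by convention non-periodic (primitive, i.e. not a proper multiple of another closed geodesic). A loop word of length $3\tau$ ($\tau\ge1$) is $w'=(l'_1,m'_1,n'_1,\dots,l'_\tau,m'_\tau,n'_\tau)\in\mathbb Z^{3\tau}$, indices cyclic in $\mathbb Z/3\tau$. $L[w']$ is the conjugacy class of $\alpha^{l'_1}\beta^{m'_1}\gamma^{n'_1}\cdots\alpha^{l'_\tau}\beta^{m'_\tau}\gamma^{n'_\tau}$. Shifting means cyclically shifting $w'$ by multiples of $3$ entries. $w'$ is periodic if it is the concatenation of $N\ge2$ copies of a shorter loop word. $w'$ is normal if (subwords being cyclically consecutive entries): (i) any subword $(a,1,b)$ satisfies $a,b\le0$; (ii) any subword $(a,0,b)$ satisfies ($a\le-1$, $b\ge1$) or ($a\ge1$, $b\le-1$) or ($a,b\ge1$); (iii) there is no subword $(0,-1,\dots,-1,0)$; (iv) $w'\ne(-1,\dots,-1)$. *)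

theory Defs
  imports "HOL-Analysis.Analysis"
begin

text \<open>
  The pair of pants is realised as the quotient of the hyperbolic plane, in the upper half-plane
  model, by the level 2 principal congruence subgroup. Modulo sign this group acts freely and
  properly discontinuously, and the quotient is a thrice-punctured sphere with cusps at the
  orbits of infinity, 0 and 1. The complete hyperbolic structure with three cusps is unique up
  to isometry.
\<close>

definition upper_half_plane :: "complex set" where
  "upper_half_plane = {z. Im z > 0}"

definition hyp_dist :: "complex \<Rightarrow> complex \<Rightarrow> real" where
  "hyp_dist z w = arcosh (1 + (cmod (z - w))\<^sup>2 / (2 * Im z * Im w))"

text \<open>A quadruple \<open>(a, b, c, d)\<close> stands for the matrix with rows \<open>(a, b)\<close> and \<open>(c, d)\<close>.\<close>

definition Gamma2 :: "(int \<times> int \<times> int \<times> int) set" where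
  "Gamma2 = {(a, b, c, d). a * d - b * c = 1 \<and> odd a \<and> even b \<and> even c \<and> odd d}"

fun moebius_map :: "int \<times> int \<times> int \<times> int \<Rightarrow> complex \<Rightarrow> complex" where
  "moebius_map (a, b, c, d) z = (of_int a * z + of_int b) / (of_int c * z + of_int d)"

definition Gamma2_rel :: "(complex \<times> complex) set" where
  "Gamma2_rel = {(z, w). z \<in> upper_half_plane \<and> w \<in> upper_half_plane \<and> (\<exists>g\<in>Gamma2. w = moebius_map g z)}"

typedef pants = "upper_half_plane // Gamma2_rel"
proof -
  have "\<i> \<in> upper_half_plane" by (simp add: upper_half_plane_def)
  then show ?thesis by (metis quotientI)
qed

definition pants_proj :: "complex \<Rightarrow> pants" where
  "pants_proj z = Abs_pants (Gamma2_rel `` {z})"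

lemma denom_nonzero:
  assumes "Im z > 0" "a * d - b * c = (1::int)"
  shows "of_int c * z + of_int d \<noteq> (0::complex)"
proof
  assume *: "of_int c * z + of_int d = (0::complex)"
  then have "Im (of_int c * z + of_int d) = 0" "Re (of_int c * z + of_int d) = 0" by simp_all
  with assms show False by auto
qed

lemma Im_moebius:
  assumes "a * d - b * c = (1::int)"
  shows "Im (moebius_map (a, b, c, d) z) = Im z / (cmod (of_int c * z + of_int d))\<^sup>2"
proof -
  have r: "real_of_int a * real_of_int d = 1 + real_of_int b * real_of_int c"
    using arg_cong[OF assms, of real_of_int] by simp
  have "Im z * (real_of_int a * real_of_int d) = Im z * (1 + real_of_int b * real_of_int c)"
    by (simp add: r)
  then show ?thesis
    by (simp add: Im_divide cmod_power2 algebra_simps)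
qed

lemma moebius_in_uhp:
  assumes "z \<in> upper_half_plane" "g \<in> Gamma2"
  shows "moebius_map g z \<in> upper_half_plane"
proof -
  obtain a b c d where g: "g = (a, b, c, d)" by (metis prod_cases4)
  with assms have det: "a * d - b * c = 1" and z: "Im z > 0"
    by (auto simp: Gamma2_def upper_half_plane_def)
  show ?thesis unfolding g upper_half_plane_def
    using Im_moebius[OF det, of z] denom_nonzero[OF z det] z by simp
qed

lemma moebius_diff:
  assumes "Im z > 0" "Im w > 0" "a * d - b * c = (1::int)"
  shows "moebius_map (a, b, c, d) z - moebius_map (a, b, c, d) w
    = (z - w) / ((of_int c * z + of_int d) * (of_int c * w + of_int d))"
proof -
  note nz = denom_nonzero[OF assms(1,3)] denom_nonzero[OF assms(2,3)]
  have r: "of_int a * of_int d = (1::complex) + of_int b * of_int c"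
    using arg_cong[OF assms(3), of "of_int :: int \<Rightarrow> complex"] by (simp add: algebra_simps)
  have "(of_int a * z + of_int b) * (of_int c * w + of_int d)
      - (of_int a * w + of_int b) * (of_int c * z + of_int d)
      = (of_int a * of_int d - of_int b * of_int c) * (z - w)"
    by (simp add: algebra_simps)
  also have "\<dots> = z - w" by (simp add: r)
  finally show ?thesis using nz by (simp add: diff_frac_eq)
qed

lemma hyp_dist_moebius:
  assumes "z \<in> upper_half_plane" "w \<in> upper_half_plane" "g \<in> Gamma2"
  shows "hyp_dist (moebius_map g z) (moebius_map g w) = hyp_dist z w"
proof -
  obtain a b c d where g: "g = (a, b, c, d)" by (metis prod_cases4)
  with assms have det: "a * d - b * c = 1" and z: "Im z > 0" and w: "Im w > 0"
    by (auto simp: Gamma2_def upper_half_plane_def)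
  have "cmod (of_int c * z + of_int d) \<noteq> 0" "cmod (of_int c * w + of_int d) \<noteq> 0"
    using denom_nonzero[OF z det] denom_nonzero[OF w det] by simp_all
  then show ?thesis unfolding hyp_dist_def g Im_moebius[OF det] moebius_diff[OF z w det]
    by (simp add: norm_divide norm_mult power_divide power_mult_distrib)
qed

lemma moebius_divide:
  assumes "D \<noteq> 0"
  shows "moebius_map (p, q, r, s) (N / D) = (of_int p * N + of_int q * D) / (of_int r * N + of_int s * D)"
proof -
  have "of_int p * (N / D) + of_int q = (of_int p * N + of_int q * D) / D"
    "of_int r * (N / D) + of_int s = (of_int r * N + of_int s * D) / D"
    using assms by (simp_all add: field_simps)
  then show ?thesis using assms by (simp only: moebius_map.simps) simp
qed

lemma equiv_Gamma2_rel: "equiv upper_half_plane Gamma2_rel"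
proof (rule equivI)
  show "Gamma2_rel \<subseteq> upper_half_plane \<times> upper_half_plane"
    by (auto simp: Gamma2_rel_def)
  show "refl_on upper_half_plane Gamma2_rel"
  proof (rule refl_onI)
    fix z assume "z \<in> upper_half_plane"
    moreover have "(1, 0, 0, 1) \<in> Gamma2" "z = moebius_map (1, 0, 0, 1) z"
      by (simp_all add: Gamma2_def)
    ultimately show "(z, z) \<in> Gamma2_rel" unfolding Gamma2_rel_def by blast
  qed
  show "sym Gamma2_rel"
  proof (rule symI)
    fix z w assume "(z, w) \<in> Gamma2_rel"
    then obtain a b c d where g: "(a, b, c, d) \<in> Gamma2" "w = moebius_map (a, b, c, d) z"
      and zw: "z \<in> upper_half_plane" "w \<in> upper_half_plane"
      by (auto simp: Gamma2_rel_def)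
    then have det: "a * d - b * c = 1" and z: "Im z > 0"
      by (auto simp: Gamma2_def upper_half_plane_def)
    have h: "(d, -b, -c, a) \<in> Gamma2" using g by (auto simp: Gamma2_def algebra_simps)
    have detc: "of_int a * of_int d = (1::complex) + of_int b * of_int c"
      using arg_cong[OF det, of "of_int :: int \<Rightarrow> complex"] by (simp add: algebra_simps)
    have nz: "of_int c * z + of_int d \<noteq> 0" by (rule denom_nonzero[OF z det])
    have *: "of_int d * (of_int a * z + of_int b) + of_int (- b) * (of_int c * z + of_int d) = z"
      "of_int (- c) * (of_int a * z + of_int b) + of_int a * (of_int c * z + of_int d) = (1::complex)"
      using detc by (simp_all, algebra+)
    have "moebius_map (d, -b, -c, a) w = z"
      unfolding g(2) moebius_map.simps(1)[of a] moebius_divide[OF nz] * by simp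
    then have "z = moebius_map (d, -b, -c, a) w" by simp
    with h zw show "(w, z) \<in> Gamma2_rel" unfolding Gamma2_rel_def by blast
  qed
  show "trans Gamma2_rel"
  proof (rule transI)
    fix z w u assume zw: "(z, w) \<in> Gamma2_rel" and wu: "(w, u) \<in> Gamma2_rel"
    then obtain a b c d where g: "(a, b, c, d) \<in> Gamma2" "w = moebius_map (a, b, c, d) z"
      by (auto simp: Gamma2_rel_def)
    from wu obtain a' b' c' d' where g': "(a', b', c', d') \<in> Gamma2" "u = moebius_map (a', b', c', d') w"
      by (auto simp: Gamma2_rel_def)
    have det: "a * d - b * c = 1" and det': "a' * d' - b' * c' = 1" and z: "Im z > 0"
      using g g' zw by (auto simp: Gamma2_def Gamma2_rel_def upper_half_plane_def)
    let ?h = "(a' * a + b' * c, a' * b + b' * d, c' * a + d' * c, c' * b + d' * d)"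
    have "(a' * a + b' * c) * (c' * b + d' * d) - (a' * b + b' * d) * (c' * a + d' * c) = 1"
      using det det' by algebra
    then have h: "?h \<in> Gamma2" using g(1) g'(1) by (auto simp: Gamma2_def)
    have nz: "of_int c * z + of_int d \<noteq> 0" by (rule denom_nonzero[OF z det])
    let ?D = "of_int c * z + of_int d" and ?N = "of_int a * z + of_int b"
    have "u = (of_int a' * ?N + of_int b' * ?D) / (of_int c' * ?N + of_int d' * ?D)"
      unfolding g'(2) g(2) moebius_map.simps(1)[of a] by (rule moebius_divide[OF nz])
    also have "\<dots> = moebius_map ?h z" by (simp add: algebra_simps)
    finally have "\<exists>g\<in>Gamma2. u = moebius_map g z" using h by blast
    with zw wu show "(z, u) \<in> Gamma2_rel" by (simp add: Gamma2_rel_def)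
  qed
qed

lemma hyp_dist_commute: "hyp_dist z w = hyp_dist w z"
  by (simp add: hyp_dist_def norm_minus_commute mult.commute mult.left_commute)

lemma cosh_hyp_dist:
  assumes "z \<in> upper_half_plane" "w \<in> upper_half_plane"
  shows "cosh (hyp_dist z w) = 1 + (cmod (z - w))\<^sup>2 / (2 * Im z * Im w)" "hyp_dist z w \<ge> 0"
  using assms by (simp_all add: hyp_dist_def upper_half_plane_def)

lemma hyp_dist_eq_0:
  assumes "z \<in> upper_half_plane" "w \<in> upper_half_plane"
  shows "hyp_dist z w = 0 \<longleftrightarrow> z = w"
  using cosh_hyp_dist[OF assms] assms
  by (auto simp: hyp_dist_def upper_half_plane_def)

lemma hyp_dist_triangle:
  assumes "z \<in> upper_half_plane" "w \<in> upper_half_plane" "u \<in> upper_half_plane"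
  shows "hyp_dist z u \<le> hyp_dist z w + hyp_dist w u"
proof -
  define A B C where "A = cosh (hyp_dist z u)" and "B = cosh (hyp_dist z w)"
    and "C = cosh (hyp_dist w u)"
  define x y p q r s where "x = Re z" "y = Im z" "p = Re w" "q = Im w" "r = Re u" "s = Im u"
  note v = this
  have pos: "y > 0" "q > 0" "s > 0" using assms by (auto simp: v upper_half_plane_def)
  define a b c where "a = (x - r)\<^sup>2 + y\<^sup>2 + s\<^sup>2" and "b = (x - p)\<^sup>2 + y\<^sup>2 + q\<^sup>2"
    and "c = (p - r)\<^sup>2 + q\<^sup>2 + s\<^sup>2"
  have A: "A = a / (2 * y * s)" and B: "B = b / (2 * y * q)" and C: "C = c / (2 * q * s)"
    using pos unfolding A_def B_def C_def cosh_hyp_dist(1)[OF assms(1,3)] cosh_hyp_dist(1)[OF assms(1,2)]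
       cosh_hyp_dist(1)[OF assms(2,3)] cmod_power2 a_def b_def c_def
    by (simp_all add: v[symmetric] field_simps power2_eq_square)
  define D where "D = (x\<^sup>2 + y\<^sup>2) * (p - r) - (p\<^sup>2 + q\<^sup>2) * (x - r) + (r\<^sup>2 + s\<^sup>2) * (x - p)"
  have id: "4 * y\<^sup>2 * q\<^sup>2 * s\<^sup>2 + a * b * c - q\<^sup>2 * a\<^sup>2 - s\<^sup>2 * b\<^sup>2 - y\<^sup>2 * c\<^sup>2 = D\<^sup>2"
    unfolding a_def b_def c_def D_def by algebra
  have "1 + 2 * A * B * C - A\<^sup>2 - B\<^sup>2 - C\<^sup>2
     = (4 * y\<^sup>2 * q\<^sup>2 * s\<^sup>2 + a * b * c - q\<^sup>2 * a\<^sup>2 - s\<^sup>2 * b\<^sup>2 - y\<^sup>2 * c\<^sup>2) / (4 * y\<^sup>2 * q\<^sup>2 * s\<^sup>2)"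
    using pos unfolding A B C by (simp add: field_simps power2_eq_square)
  also have "\<dots> \<ge> 0" unfolding id using pos by simp
  finally have gram: "(A - B * C)\<^sup>2 \<le> (B\<^sup>2 - 1) * (C\<^sup>2 - 1)"
    by (simp add: power2_eq_square algebra_simps)
  define S where "S = sinh (hyp_dist z w) * sinh (hyp_dist w u)"
  have "S \<ge> 0" using cosh_hyp_dist(2) assms by (simp add: S_def)
  moreover have "S\<^sup>2 = (B\<^sup>2 - 1) * (C\<^sup>2 - 1)"
    by (simp add: S_def power_mult_distrib sinh_square_eq B_def C_def)
  ultimately have "A - B * C \<le> S" using gram by (metis power2_le_imp_le)
  then have "cosh (hyp_dist z u) \<le> cosh (hyp_dist z w + hyp_dist w u)"
    by (simp add: cosh_add S_def A_def B_def C_def)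
  then show ?thesis
    using cosh_hyp_dist(2) assms by (metis add_nonneg_nonneg cosh_real_nonneg_le_iff)
qed

lemma finite_int_abs_le: "finite {n::int. \<bar>real_of_int n\<bar> \<le> K}"
proof (rule finite_subset)
  show "{n::int. \<bar>real_of_int n\<bar> \<le> K} \<subseteq> {-\<lceil>K\<rceil>..\<lceil>K\<rceil>}"
  proof
    fix n assume "n \<in> {n::int. \<bar>real_of_int n\<bar> \<le> K}"
    then have "real_of_int n \<le> K" "real_of_int (- n) \<le> K" by auto
    then have "n \<le> \<lceil>K\<rceil>" "- n \<le> \<lceil>K\<rceil>" by linarith+
    then show "n \<in> {-\<lceil>K\<rceil>..\<lceil>K\<rceil>}" by auto
  qed
qed simp

lemma coeff_bound:
  assumes "Im w > 0" "cmod (of_int c * w + of_int d) \<le> K"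
  shows "\<bar>real_of_int c\<bar> \<le> K / Im w" "\<bar>real_of_int d\<bar> \<le> K + K / Im w * cmod w"
proof -
  have "\<bar>Im (of_int c * w + of_int d)\<bar> \<le> K" using assms(2) abs_Im_le_cmod order_trans by blast
  then have "\<bar>real_of_int c\<bar> * Im w \<le> K" using assms(1) by (simp add: abs_mult)
  then show c: "\<bar>real_of_int c\<bar> \<le> K / Im w" using assms(1) by (simp add: field_simps)
  have "cmod (of_int d) \<le> cmod (of_int c * w + of_int d) + cmod (of_int c * w)"
    by (metis add_diff_cancel_left' norm_triangle_ineq4)
  also have "\<dots> \<le> K + K / Im w * cmod w"
  proof -
    have "cmod (of_int c * w) \<le> K / Im w * cmod w"
      unfolding norm_mult norm_of_int using c by (intro mult_right_mono) auto
    with assms(2) show ?thesis by linarith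
  qed
  finally show "\<bar>real_of_int d\<bar> \<le> K + K / Im w * cmod w" by simp
qed

lemma finite_orbit_ball:
  assumes "z \<in> upper_half_plane" "w \<in> upper_half_plane"
  shows "finite {v. (w, v) \<in> Gamma2_rel \<and> hyp_dist z v \<le> \<rho>}"
proof -
  have z: "Im z > 0" and w: "Im w > 0" using assms by (auto simp: upper_half_plane_def)
  define R where "R = cosh \<rho>"
  have R: "R \<ge> 1" by (simp add: R_def cosh_real_ge_1)
  define M where "M = cmod z + sqrt (4 * R\<^sup>2 * (Im z)\<^sup>2)"
  define K where "K = sqrt (Im w * (2 * R) / Im z)"
  define K' where "K' = M * K"
  define B where "B = {(a, b, c, d). a \<in> {n::int. \<bar>real_of_int n\<bar> \<le> K' / Im w}
     \<and> b \<in> {n::int. \<bar>real_of_int n\<bar> \<le> K' + K' / Im w * cmod w}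
     \<and> c \<in> {n::int. \<bar>real_of_int n\<bar> \<le> K / Im w}
     \<and> d \<in> {n::int. \<bar>real_of_int n\<bar> \<le> K + K / Im w * cmod w}}"
  have "B = {n::int. \<bar>real_of_int n\<bar> \<le> K' / Im w} \<times> {n::int. \<bar>real_of_int n\<bar> \<le> K' + K' / Im w * cmod w}
     \<times> {n::int. \<bar>real_of_int n\<bar> \<le> K / Im w} \<times> {n::int. \<bar>real_of_int n\<bar> \<le> K + K / Im w * cmod w}"
    by (auto simp: B_def)
  then have "finite B" by (simp add: finite_int_abs_le)
  moreover have "{v. (w, v) \<in> Gamma2_rel \<and> hyp_dist z v \<le> \<rho>} \<subseteq> (\<lambda>g. moebius_map g w) ` B"
  proof
    fix v assume "v \<in> {v. (w, v) \<in> Gamma2_rel \<and> hyp_dist z v \<le> \<rho>}"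
    then obtain a b c d where g: "(a, b, c, d) \<in> Gamma2" "v = moebius_map (a, b, c, d) w"
      and v: "v \<in> upper_half_plane" and le: "hyp_dist z v \<le> \<rho>"
      by (auto simp: Gamma2_rel_def)
    have det: "a * d - b * c = 1" using g by (auto simp: Gamma2_def)
    have v0: "Im v > 0" using v by (simp add: upper_half_plane_def)
    have "cosh (hyp_dist z v) \<le> R" unfolding R_def
      using le cosh_hyp_dist(2)[OF assms(1) v] by (simp add: cosh_real_nonneg_le_iff)
    then have "(cmod (z - v))\<^sup>2 / (2 * Im z * Im v) \<le> R - 1"
      unfolding cosh_hyp_dist(1)[OF assms(1) v] by simp
    then have *: "(cmod (z - v))\<^sup>2 \<le> 2 * (R - 1) * Im z * Im v"
      using z v0 by (simp add: pos_divide_le_eq mult_ac)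
    then have "(Im z - Im v)\<^sup>2 \<le> 2 * (R - 1) * Im z * Im v"
      by (smt (verit) cmod_power2 minus_complex.simps(2) zero_le_power2)
    then have sq: "(Im z)\<^sup>2 + (Im v)\<^sup>2 \<le> 2 * R * Im z * Im v"
      by (simp add: power2_eq_square algebra_simps)
    then have "Im v * Im v \<le> (2 * R * Im z) * Im v" "Im z * Im z \<le> (2 * R * Im v) * Im z"
    proof -
      have "(Im v)\<^sup>2 \<le> 2 * R * Im z * Im v" "(Im z)\<^sup>2 \<le> 2 * R * Im z * Im v"
        using sq zero_le_power2[of "Im z"] zero_le_power2[of "Im v"] by linarith+
      then show "Im v * Im v \<le> (2 * R * Im z) * Im v" "Im z * Im z \<le> (2 * R * Im v) * Im z"
        by (simp_all only: power2_eq_square mult_ac)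
    qed
    then have up: "Im v \<le> 2 * R * Im z" and lo: "Im z \<le> 2 * R * Im v"
      using z v0 by (simp_all only: mult_le_cancel_right_pos)
    have "(cmod (z - v))\<^sup>2 \<le> 4 * R\<^sup>2 * (Im z)\<^sup>2"
    proof -
      have "2 * (R - 1) * Im z * Im v \<le> (2 * R * Im z) * (2 * R * Im z)"
        using up z v0 R by (intro mult_mono) auto
      with * show ?thesis by (simp add: power2_eq_square mult_ac)
    qed
    then have "cmod (z - v) \<le> sqrt (4 * R\<^sup>2 * (Im z)\<^sup>2)" by (simp add: real_le_rsqrt)
    then have M: "cmod v \<le> M" unfolding M_def
      by (smt (verit) norm_minus_commute norm_triangle_sub)
    have nz: "cmod (of_int c * w + of_int d) > 0" using denom_nonzero[OF w det] by simp
    have "(cmod (of_int c * w + of_int d))\<^sup>2 * Im v = Im w"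
      using Im_moebius[OF det, of w] nz by (simp add: g(2))
    then have "(cmod (of_int c * w + of_int d))\<^sup>2 = Im w / Im v" using v0 by (simp add: field_simps)
    also have "\<dots> \<le> Im w * (2 * R) / Im z"
      using lo z v0 w by (simp add: field_simps)
    finally have K: "cmod (of_int c * w + of_int d) \<le> K" unfolding K_def by (simp add: real_le_rsqrt)
    have "of_int a * w + of_int b = v * (of_int c * w + of_int d)" using nz by (simp add: g(2))
    then have "cmod (of_int a * w + of_int b) = cmod v * cmod (of_int c * w + of_int d)"
      by (simp add: norm_mult)
    also have "\<dots> \<le> K'" unfolding K'_def using M K nz
      by (intro mult_mono) (auto intro: order_trans[OF norm_ge_zero])
    finally have K': "cmod (of_int a * w + of_int b) \<le> K'" .
    have "(a, b, c, d) \<in> B" using coeff_bound[OF w K] coeff_bound[OF w K'] by (simp add: B_def)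
    with g(2) show "v \<in> (\<lambda>g. moebius_map g w) ` B" by blast
  qed
  ultimately show ?thesis using finite_surj by blast
qed

text \<open>
  The quotient metric, which is also the path metric of the hyperbolic structure on the quotient.
\<close>

instantiation pants :: metric_space
begin

definition dist_pants :: "pants \<Rightarrow> pants \<Rightarrow> real" where
  "dist_pants p q = Inf {hyp_dist z w | z w. z \<in> Rep_pants p \<and> w \<in> Rep_pants q}"

definition uniformity_pants :: "(pants \<times> pants) filter" where
  "uniformity_pants = (INF e\<in>{0<..}. principal {(x, y). dist x y < e})"

definition open_pants :: "pants set \<Rightarrow> bool" where
  "open_pants U \<longleftrightarrow> (\<forall>x\<in>U. eventually (\<lambda>(x', y). x' = x \<longrightarrow> y \<in> U) uniformity)"

lemma Rep_pants_orbit: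
  assumes "z \<in> Rep_pants p"
  shows "z \<in> upper_half_plane" "Rep_pants p = Gamma2_rel `` {z}"
proof -
  obtain z0 where z0: "z0 \<in> upper_half_plane" "Rep_pants p = Gamma2_rel `` {z0}"
    using Rep_pants[of p] by (auto elim: quotientE)
  with assms have "(z0, z) \<in> Gamma2_rel" by auto
  with z0 show "z \<in> upper_half_plane" "Rep_pants p = Gamma2_rel `` {z}"
    using equiv_class_eq[OF equiv_Gamma2_rel] by (auto simp: Gamma2_rel_def)
qed

lemma Rep_pants_nonempty: "\<exists>z. z \<in> Rep_pants p"
  using Rep_pants[of p] equiv_Gamma2_rel by (metis all_not_in_conv in_quotient_imp_non_empty)

lemma dist_pants_le:
  assumes "z \<in> Rep_pants p" "w \<in> Rep_pants q"
  shows "dist p q \<le> hyp_dist z w"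
  unfolding dist_pants_def
proof (rule cInf_lower)
  show "bdd_below {hyp_dist z w |z w. z \<in> Rep_pants p \<and> w \<in> Rep_pants q}"
    by (rule bdd_belowI[of _ 0]) (auto intro!: cosh_hyp_dist(2) dest: Rep_pants_orbit(1))
qed (use assms in auto)

lemma dist_pants_attained:
  assumes "z \<in> Rep_pants p"
  shows "\<exists>w\<in>Rep_pants q. dist p q = hyp_dist z w"
proof -
  obtain w0 where w0: "w0 \<in> Rep_pants q" using Rep_pants_nonempty by blast
  note z = Rep_pants_orbit[OF assms] and q = Rep_pants_orbit[OF w0]
  define F where "F = {v. (w0, v) \<in> Gamma2_rel \<and> hyp_dist z v \<le> hyp_dist z w0}"
  have fin: "finite F" unfolding F_def by (rule finite_orbit_ball[OF z(1) q(1)])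
  have "w0 \<in> F" using w0 q by (auto simp: F_def)
  then obtain w where w: "w \<in> F" "\<And>v. v \<in> F \<Longrightarrow> hyp_dist z w \<le> hyp_dist z v"
    using fin by (metis arg_min_if_finite(1) arg_min_least empty_iff)
  have wq: "w \<in> Rep_pants q" using w(1) by (simp add: F_def q(2))
  have min: "hyp_dist z w \<le> hyp_dist z v" if "v \<in> Rep_pants q" for v
  proof (cases "v \<in> F")
    case False
    then have "hyp_dist z w0 \<le> hyp_dist z v" using that by (auto simp: F_def q(2))
    with w(2)[OF \<open>w0 \<in> F\<close>] show ?thesis by simp
  qed (use w in auto)
  have "hyp_dist z w \<le> dist p q" unfolding dist_pants_def
  proof (rule cInf_greatest)
    fix x assume "x \<in> {hyp_dist z w |z w. z \<in> Rep_pants p \<and> w \<in> Rep_pants q}"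
    then obtain z' w' where x: "x = hyp_dist z' w'" "z' \<in> Rep_pants p" "w' \<in> Rep_pants q" by blast
    have "(z', z) \<in> Gamma2_rel" using Rep_pants_orbit(2)[OF x(2)] assms by auto
    then obtain g where g: "g \<in> Gamma2" "z = moebius_map g z'" by (auto simp: Gamma2_rel_def)
    note w' = Rep_pants_orbit[OF x(3)]
    have "(w', moebius_map g w') \<in> Gamma2_rel"
      using g w'(1) moebius_in_uhp by (auto simp: Gamma2_rel_def)
    then have "moebius_map g w' \<in> Rep_pants q" using w'(2) by auto
    from min[OF this] show "hyp_dist z w \<le> x"
      using hyp_dist_moebius[OF Rep_pants_orbit(1)[OF x(2)] w'(1) g(1)] by (simp add: x(1) g(2))
  qed (use assms w0 in auto)
  with dist_pants_le[OF assms wq] wq show ?thesis by force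
qed

instance
proof
  fix p q r :: pants
  show "uniformity = (INF e\<in>{0<..}. principal {(x::pants, y). dist x y < e})"
    by (rule uniformity_pants_def)
  show "open U \<longleftrightarrow> (\<forall>x\<in>U. \<forall>\<^sub>F (x', y) in uniformity. x' = x \<longrightarrow> y \<in> U)" for U :: "pants set"
    by (rule open_pants_def)
  obtain z where z: "z \<in> Rep_pants p" using Rep_pants_nonempty by blast
  obtain w where w: "w \<in> Rep_pants q" "dist p q = hyp_dist z w" using dist_pants_attained[OF z] by blast
  note uhp = Rep_pants_orbit(1)[OF z] Rep_pants_orbit(1)[OF w(1)]
  show "dist p q = 0 \<longleftrightarrow> p = q"
  proof
    assume "dist p q = 0"
    then have "z = w" using w uhp hyp_dist_eq_0 by simp
    then have "Rep_pants p = Rep_pants q" using Rep_pants_orbit(2) z w(1) by metis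
    then show "p = q" by (simp add: Rep_pants_inject)
  next
    assume "p = q"
    then have "dist p q \<le> hyp_dist z z" using z dist_pants_le by simp
    then show "dist p q = 0"
      using w(2) cosh_hyp_dist(2)[OF uhp] hyp_dist_eq_0[OF uhp(1) uhp(1)] by simp
  qed
  obtain v where v: "v \<in> Rep_pants r" "dist p r = hyp_dist z v" using dist_pants_attained[OF z] by blast
  obtain u where u: "u \<in> Rep_pants q" "dist r q = hyp_dist v u"
    using dist_pants_attained[OF v(1)] by blast
  have "dist p q \<le> hyp_dist z u" by (rule dist_pants_le[OF z u(1)])
  also have "\<dots> \<le> hyp_dist z v + hyp_dist v u"
    by (intro hyp_dist_triangle) (use z v u Rep_pants_orbit(1) in auto)
  also have "hyp_dist v u = dist r q" by (simp add: u)
  also have "dist r q = dist q r"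
    unfolding dist_pants_def by (rule arg_cong[of _ _ Inf]) (use hyp_dist_commute in fastforce)
  finally show "dist p q \<le> dist p r + dist q r" by (simp add: v)
qed

end

text \<open>
  Closed curves are maps from the circle, written as functions on the reals of period 1. Geodesics
  are the curves that locally minimise length at constant nonzero speed.
\<close>

definition geodesic_loop :: "(real \<Rightarrow> pants) \<Rightarrow> bool" where
  "geodesic_loop c \<longleftrightarrow> (\<forall>t. c (t + 1) = c t) \<and>
     (\<exists>v>0. \<forall>t. \<exists>e>0. \<forall>s s'. \<bar>s - t\<bar> < e \<longrightarrow> \<bar>s' - t\<bar> < e \<longrightarrow> dist (c s) (c s') = v * \<bar>s - s'\<bar>)"

definition primitive_geodesic_loop :: "(real \<Rightarrow> pants) \<Rightarrow> bool" where
  "primitive_geodesic_loop c \<longleftrightarrow> geodesic_loop c \<and>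
     \<not> (\<exists>N::nat. \<exists>d. N \<ge> 2 \<and> geodesic_loop d \<and> c = (\<lambda>t. d (real N * t)))"

text \<open>Here \<open>\<phi>\<close> is a lift to the reals of an orientation-preserving homeomorphism of the circle.\<close>

definition reparam_rel :: "((real \<Rightarrow> pants) \<times> (real \<Rightarrow> pants)) set" where
  "reparam_rel = {(c, c'). \<exists>\<phi>::real \<Rightarrow> real. continuous_on UNIV \<phi> \<and> strict_mono \<phi> \<and>
     (\<forall>t. \<phi> (t + 1) = \<phi> t + 1) \<and> c' = c \<circ> \<phi>}"

definition closed_geodesics :: "(real \<Rightarrow> pants) set set" where
  "closed_geodesics = {c. primitive_geodesic_loop c} // reparam_rel"

text \<open>
  Loops based at the orbit of \<open>\<i>\<close>, each the projection of a segment from \<open>\<i>\<close> to its image under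
  an element of \<open>Gamma2\<close>. The three elements used fix infinity, 0 and 1 respectively, generate the
  stabilisers of these cusps modulo sign, and are conjugate in the modular group to
  \<open>z \<mapsto> z + 2\<close>, so the loops go once around the three punctures, in the same direction. Their
  product in this order is the identity matrix, which gives the relation
  \<open>\<alpha>\<beta>\<gamma> = 1\<close>.
\<close>

definition loop_of :: "int \<times> int \<times> int \<times> int \<Rightarrow> real \<Rightarrow> pants" where
  "loop_of g = pants_proj \<circ> linepath \<i> (moebius_map g \<i>)"

definition loop_alpha :: "real \<Rightarrow> pants" where
  "loop_alpha = loop_of (1, 2, 0, 1)"

definition loop_beta :: "real \<Rightarrow> pants" where
  "loop_beta = loop_of (1, 0, -2, 1)"

definition loop_gamma :: "real \<Rightarrow> pants" where
  "loop_gamma = loop_of (1, -2, 2, -3)"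

fun path_pow :: "(real \<Rightarrow> pants) \<Rightarrow> nat \<Rightarrow> real \<Rightarrow> pants" where
  "path_pow p 0 = (\<lambda>_. pathstart p)"
| "path_pow p (Suc n) = p +++ path_pow p n"

definition path_powi :: "(real \<Rightarrow> pants) \<Rightarrow> int \<Rightarrow> real \<Rightarrow> pants" where
  "path_powi p k = (if k \<ge> 0 then path_pow p (nat k) else path_pow (reversepath p) (nat (- k)))"

text \<open>Only lists whose length is a multiple of 3 matter in the following function.\<close>

fun word_loop :: "int list \<Rightarrow> real \<Rightarrow> pants" where
  "word_loop (l # m # n # w) =
     path_powi loop_alpha l +++ path_powi loop_beta m +++ path_powi loop_gamma n +++ word_loop w"
| "word_loop _ = (\<lambda>_. pants_proj \<i>)"

text \<open>
  A conjugacy class in the fundamental group is regarded as a free homotopy class of loops,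
  that is, as an element of \<open>[S^1, P]\<close>.
\<close>

definition homotopy_class :: "int list \<Rightarrow> (real \<Rightarrow> pants) set" where
  "homotopy_class w = {c. homotopic_loops UNIV (word_loop w) c}"

definition loop_word :: "int list \<Rightarrow> bool" where
  "loop_word w \<longleftrightarrow> w \<noteq> [] \<and> 3 dvd length w"

definition shift_rel :: "(int list \<times> int list) set" where
  "shift_rel = {(w, w'). \<exists>k. w' = rotate (3 * k) w}"

definition periodic_word :: "int list \<Rightarrow> bool" where
  "periodic_word w \<longleftrightarrow> (\<exists>v N. loop_word v \<and> N \<ge> 2 \<and> w = concat (replicate N v))"

definition entry :: "int list \<Rightarrow> nat \<Rightarrow> int" where
  "entry w i = w ! (i mod length w)"

text \<open>
  The third condition lets the two zeros be the same entry of the cyclic word. This excludes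
  nothing new: all other entries would be \<open>-1\<close>, contrary to the second condition.
\<close>

definition normal_word :: "int list \<Rightarrow> bool" where
  "normal_word w \<longleftrightarrow> loop_word w
   \<and> (\<forall>i. entry w (i + 1) = 1 \<longrightarrow> entry w i \<le> 0 \<and> entry w (i + 2) \<le> 0)
   \<and> (\<forall>i. entry w (i + 1) = 0 \<longrightarrow>
        (entry w i \<le> -1 \<and> entry w (i + 2) \<ge> 1) \<or>
        (entry w i \<ge> 1 \<and> entry w (i + 2) \<le> -1) \<or>
        (entry w i \<ge> 1 \<and> entry w (i + 2) \<ge> 1))
   \<and> \<not> (\<exists>i k. k \<ge> 1 \<and> entry w i = 0 \<and> (\<forall>j\<in>{1..k}. entry w (i + j) = -1) \<and> entry w (i + k + 1) = 0)
   \<and> w \<noteq> replicate (length w) (-1)"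

definition nonperiodic_normal_words :: "int list set" where
  "nonperiodic_normal_words = {w. normal_word w \<and> \<not> periodic_word w}"

end

theory Submission
  imports Defs
begin

text \<open>
  The matrices act through \<open>PSL(2, \<int>)\<close>. Conjugation by an element \<open>\<rho>\<close> of order 3 permutes
  \<open>\<alpha>\<close>, \<open>\<beta>\<close>, \<open>\<gamma>\<close> cyclically, so that a loop word stands for the product of its
  \<open>\<alpha>\<^sup>k \<rho>\<close>, and \<open>\<sigma> = \<alpha> \<rho>\<close> has order 3 as well. A word that represents a given hyperbolic
  class with least length and then least sum of absolute values is normal, because each violation
  of a normality condition permits a shortening move (the word of entries \<open>-1\<close> only is replaced
  by the one of entries \<open>2\<close>). For uniqueness, a normal word is recoded as an alternating word in
  \<open>\<rho>\<close>, \<open>\<sigma>\<close> and their inverses, which is a positive word in the two standard parabolic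
  generators; conjugate positive words are cyclic rotations of each other since the positive
  monoid is free, and the entries can be read off from the positive word.

  On the geometric side, free homotopy classes of loops are conjugacy classes of monodromies of
  lifts to the half-plane. A local geodesic has the form \<open>e\<^sup>t P + e\<^sup>-\<^sup>t N\<close> in Lorentzian
  coordinates, so a closed geodesic with given monodromy \<open>g\<close> is determined, up to a shift of the
  parameter, by the eigenlines of \<open>g\<close> on the light cone, and exists iff \<open>g\<close> is hyperbolic.
\<close>

section \<open>The modular group\<close>

text \<open>Conjugations are first carried out in \<open>psl_even\<close>, the subgroup of index 2
  in PSL(2,Z) that is the free product of the groups of order 3 generated by rho and sigma. There
  every cyclic rotation of a word is a conjugation, whereas conjugators in Gamma(2), of index 3 in
  it, come from shifts by multiples of 3. The price is paid at the end: two normal words conjugate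
  in Gamma(2) might differ by a rotation by m with m not divisible by 3. Then an element outside
  Gamma(2) commutes with the word, which forces a period not divisible by 3, and this period
  corrects m. For the same reason a word such as (2, 2, 2) is a cube in \<open>psl_even\<close> and
  yet nonperiodic as a loop word. The obstacle to uniqueness is that the positive word does not show
  where entries end: the pair sigma rho^-1 may lie within a positive entry, or join a positive
  entry, a zero and a negative entry. Labels on the pairs record the difference. Conditions (iii)
  and (iv) make the labels recoverable, since they exclude the stretches on which two labellings
  could disagree.\<close>

type_synonym imat = "int \<times> int \<times> int \<times> int"

fun imat_det :: "imat \<Rightarrow> int" where
  "imat_det (a, b, c, d) = a * d - b * c"

fun imat_neg :: "imat \<Rightarrow> imat" where
  "imat_neg (a, b, c, d) = (-a, -b, -c, -d)"

fun imat_mult :: "imat \<Rightarrow> imat \<Rightarrow> imat" where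
  "imat_mult (a, b, c, d) (p, q, r, s) = (a * p + b * r, a * q + b * s, c * p + d * r, c * q + d * s)"

fun imat_adj :: "imat \<Rightarrow> imat" where
  "imat_adj (a, b, c, d) = (d, -b, -c, a)"

definition psl_rel :: "imat \<Rightarrow> imat \<Rightarrow> bool" where
  "psl_rel g h \<longleftrightarrow> imat_det g = 1 \<and> (h = g \<or> h = imat_neg g)"

lemma imat_det_neg [simp]: "imat_det (imat_neg g) = imat_det g"
  by (cases g) simp

lemma imat_det_mult [simp]: "imat_det (imat_mult g h) = imat_det g * imat_det h"
  by (cases g; cases h) (simp add: algebra_simps)

lemma imat_neg_neg [simp]: "imat_neg (imat_neg g) = g"
  by (cases g) simp

lemma imat_mult_neg [simp]:
  "imat_mult (imat_neg g) h = imat_neg (imat_mult g h)"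
  "imat_mult g (imat_neg h) = imat_neg (imat_mult g h)"
  by (cases g; cases h; simp)+

lemma imat_adj_neg [simp]: "imat_adj (imat_neg g) = imat_neg (imat_adj g)"
  by (cases g) simp

\<comment> \<open>\<open>psl_rel\<close> relates only matrices of determinant 1, so the determinant
  condition is built into the type and the quotient is PSL(2,Z).\<close>
quotient_type psl2z = imat / partial: psl_rel
proof (rule part_equivpI)
  show "\<exists>x. psl_rel x x" by (rule exI[of _ "(1, 0, 0, 1)"]) (simp add: psl_rel_def)
  show "symp psl_rel" by (auto simp: psl_rel_def intro!: sympI)
  show "transp psl_rel" by (auto simp: psl_rel_def intro!: transpI)
qed

instantiation psl2z :: "{monoid_mult, inverse}"
begin

lift_definition one_psl2z :: psl2z is "(1, 0, 0, 1)" by (simp add: psl_rel_def)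

lift_definition times_psl2z :: "psl2z \<Rightarrow> psl2z \<Rightarrow> psl2z" is imat_mult
  by (auto simp: psl_rel_def)

lift_definition inverse_psl2z :: "psl2z \<Rightarrow> psl2z" is imat_adj
  by (auto simp: psl_rel_def mult.commute)

definition divide_psl2z :: "psl2z \<Rightarrow> psl2z \<Rightarrow> psl2z" where
  "divide_psl2z g h = g * inverse h"

instance
proof
  fix a b c :: psl2z
  show "a * b * c = a * (b * c)"
    by transfer (auto simp: psl_rel_def algebra_simps)
  show "1 * a = a" "a * 1 = a"
    by (transfer, auto simp: psl_rel_def)+
qed

end

definition psl_of :: "imat \<Rightarrow> psl2z" where
  "psl_of = abs_psl2z"

lemma psl_cases:
  obtains a b c d where "g = psl_of (a, b, c, d)" "a * d - b * c = 1"
proof -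
  obtain a b c d where r: "rep_psl2z g = (a, b, c, d)" by (metis prod_cases4)
  have "psl_rel (rep_psl2z g) (rep_psl2z g)" "abs_psl2z (rep_psl2z g) = g"
    using Quotient_rep_reflp[OF Quotient_psl2z] Quotient_abs_rep[OF Quotient_psl2z] by auto
  with r that show ?thesis by (auto simp: psl_of_def psl_rel_def)
qed

lemma psl_of_eq_iff:
  assumes "imat_det g = 1" "imat_det h = 1"
  shows "psl_of g = psl_of h \<longleftrightarrow> h = g \<or> h = imat_neg g"
  using Quotient_rel[OF Quotient_psl2z, of g h] assms by (auto simp: psl_rel_def psl_of_def)

lemma psl_of_neg: "imat_det g = 1 \<Longrightarrow> psl_of (imat_neg g) = psl_of g"
  by (subst psl_of_eq_iff) auto

lemma psl_of_mult:
  assumes "imat_det g = 1" "imat_det h = 1"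
  shows "psl_of g * psl_of h = psl_of (imat_mult g h)"
  using assms by (simp add: psl_of_def times_psl2z.abs_eq psl_rel_def)

lemma psl_of_inverse: "imat_det g = 1 \<Longrightarrow> inverse (psl_of g) = psl_of (imat_adj g)"
  by (simp add: psl_of_def inverse_psl2z.abs_eq psl_rel_def)

lemma psl_one: "1 = psl_of (1, 0, 0, 1)"
  by (simp add: psl_of_def one_psl2z_def)

lemma psl_inverse [simp]:
  fixes g h :: psl2z
  shows "inverse g * g = 1" "g * inverse g = 1"
    "inverse g * (g * h) = h" "g * (inverse g * h) = h"
proof -
  show *: "inverse g * g = 1" "g * inverse g = 1"
    by (cases g rule: psl_cases; simp add: psl_of_inverse psl_of_mult psl_one algebra_simps)+
  show "inverse g * (g * h) = h" "g * (inverse g * h) = h"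
    by (simp_all add: mult.assoc[symmetric] *)
qed

lemma psl_mult_cancel [simp]:
  fixes g h k :: psl2z
  shows "g * h = g * k \<longleftrightarrow> h = k" "h * g = k * g \<longleftrightarrow> h = k"
proof -
  show "g * h = g * k \<longleftrightarrow> h = k" by (metis psl_inverse(3))
  show "h * g = k * g \<longleftrightarrow> h = k" by (metis mult.assoc mult.right_neutral psl_inverse(2))
qed

lemma psl_inverse_unique: "(g::psl2z) * h = 1 \<Longrightarrow> inverse g = h"
  by (metis mult.right_neutral psl_inverse(3))

lemma psl_inverse_mult [simp]: "inverse (g * h) = inverse h * inverse (g::psl2z)"
  by (rule psl_inverse_unique) (simp add: mult.assoc)

lemma psl_inverse_inverse [simp]: "inverse (inverse g) = (g::psl2z)"
  by (rule psl_inverse_unique) simp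

lemma psl_inverse_one [simp]: "inverse 1 = (1::psl2z)"
  by (rule psl_inverse_unique) simp

lemma psl_inverse_power: "inverse (g ^ n) = inverse (g::psl2z) ^ n"
  by (induction n) (simp_all add: power_commutes)

lemma psl_conj_power: "(k * g * inverse k) ^ n = k * g ^ n * inverse (k::psl2z)"
  by (induction n) (simp_all add: mult.assoc)

section \<open>Congruence subgroups and hyperbolic elements\<close>

lift_definition psl_Gamma2 :: "psl2z \<Rightarrow> bool" is "\<lambda>g. g \<in> Gamma2"
  by (auto simp: psl_rel_def Gamma2_def)

text \<open>Modulo 2 the matrices of determinant 1 form the symmetric group on three letters, and
  the condition selects the identity and the two 3-cycles. The resulting subgroup is normal of index
  2, contains Gamma(2) with index 3, and is generated by \<open>psl_rho\<close> and
  \<open>psl_sigma\<close>.\<close>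

lift_definition psl_even :: "psl2z \<Rightarrow> bool" is
  "\<lambda>(a, b, c, d). even (b + c) \<and> (odd a \<or> odd d)"
  by (auto simp: psl_rel_def)

lift_definition psl_hyperbolic :: "psl2z \<Rightarrow> bool" is "\<lambda>(a, b, c, d). \<bar>a + d\<bar> > 2"
  by (auto simp: psl_rel_def)

lemma psl_Gamma2_of: "a * d - b * c = 1 \<Longrightarrow>
    psl_Gamma2 (psl_of (a, b, c, d)) \<longleftrightarrow> odd a \<and> even b \<and> even c \<and> odd d"
  by (simp add: psl_of_def psl_Gamma2.abs_eq psl_rel_def Gamma2_def)

lemma psl_even_of: "a * d - b * c = 1 \<Longrightarrow>
    psl_even (psl_of (a, b, c, d)) \<longleftrightarrow> even (b + c) \<and> (odd a \<or> odd d)"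
  by (simp add: psl_of_def psl_even.abs_eq psl_rel_def)

lemma psl_hyperbolic_of: "a * d - b * c = 1 \<Longrightarrow>
    psl_hyperbolic (psl_of (a, b, c, d)) \<longleftrightarrow> \<bar>a + d\<bar> > 2"
  by (simp add: psl_of_def psl_hyperbolic.abs_eq psl_rel_def)

lemma det_odd:
  assumes "a * d - b * c = (1::int)"
  shows "odd (a * d) \<noteq> odd (b * c)"
  using arg_cong[OF assms, of even] by auto

lemma psl_even_mult_iff: "psl_even (g * h) \<longleftrightarrow> (psl_even g \<longleftrightarrow> psl_even h)"
proof -
  obtain a b c d p q r s where gh: "g = psl_of (a, b, c, d)" "a * d - b * c = 1"
     "h = psl_of (p, q, r, s)" "p * s - q * r = 1"
    by (metis psl_cases)
  have det: "(a * p + b * r) * (c * q + d * s) - (a * q + b * s) * (c * p + d * r) = 1"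
    using gh(2,4) by algebra
  show ?thesis using det_odd[OF gh(2)] det_odd[OF gh(4)]
    by (simp add: gh psl_of_mult psl_even_of det) blast
qed

lemma psl_even_one [simp]: "psl_even 1"
  by (simp add: psl_one psl_even_of)

lemma psl_even_inverse [simp]: "psl_even (inverse g) = psl_even g"
  by (metis psl_even_mult_iff psl_even_one psl_inverse(1))

lemma psl_Gamma2_mult: "psl_Gamma2 g \<Longrightarrow> psl_Gamma2 h \<Longrightarrow> psl_Gamma2 (g * h)"
proof -
  assume gh: "psl_Gamma2 g" "psl_Gamma2 h"
  obtain a b c d p q r s where *: "g = psl_of (a, b, c, d)" "a * d - b * c = 1"
     "h = psl_of (p, q, r, s)" "p * s - q * r = 1"
    by (metis psl_cases)
  have det: "(a * p + b * r) * (c * q + d * s) - (a * q + b * s) * (c * p + d * r) = 1"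
    using *(2,4) by algebra
  show ?thesis using gh by (auto simp: * psl_of_mult psl_Gamma2_of det)
qed

lemma psl_Gamma2_one [simp]: "psl_Gamma2 1"
  by (simp add: psl_one psl_Gamma2_of)

lemma psl_Gamma2_inverse [simp]: "psl_Gamma2 (inverse g) = psl_Gamma2 g"
  by transfer (auto simp: Gamma2_def mult.commute)

lemma psl_Gamma2_mult_iff:
  "psl_Gamma2 g \<Longrightarrow> psl_Gamma2 (g * h) \<longleftrightarrow> psl_Gamma2 h"
  "psl_Gamma2 g \<Longrightarrow> psl_Gamma2 (h * g) \<longleftrightarrow> psl_Gamma2 h"
proof -
  assume g: "psl_Gamma2 g"
  show "psl_Gamma2 (g * h) \<longleftrightarrow> psl_Gamma2 h"
    using g psl_Gamma2_mult[of g h] psl_Gamma2_mult[of "inverse g" "g * h"] by (simp, blast)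
  have "h * g * inverse g = h" by (simp add: mult.assoc)
  then show "psl_Gamma2 (h * g) \<longleftrightarrow> psl_Gamma2 h"
    using g psl_Gamma2_mult[of h g] psl_Gamma2_mult[of "h * g" "inverse g"] by (simp, blast)
qed

text \<open>Gamma(2) is the kernel of reduction modulo 2, hence normal in the whole modular group
  and not only in the even subgroup.\<close>

lemma psl_Gamma2_conj: "psl_Gamma2 g \<Longrightarrow> psl_Gamma2 (h * g * inverse h)"
proof (cases g rule: psl_cases; cases h rule: psl_cases)
  fix a b c d p q r s
  assume g: "psl_Gamma2 g" "g = psl_of (a, b, c, d)" "a * d - b * c = 1"
    and h: "h = psl_of (p, q, r, s)" "p * s - q * r = 1"
  let ?h = "(p, q, r, s)" and ?g = "(a, b, c, d)"
  have "h * g * inverse h = psl_of (imat_mult (imat_mult ?h ?g) (imat_adj ?h))"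
    using g h by (simp only: psl_of_inverse psl_of_mult imat_det.simps imat_det_mult imat_adj.simps) 
       (simp add: psl_of_mult psl_of_inverse algebra_simps)
  moreover have "imat_det (imat_mult (imat_mult ?h ?g) (imat_adj ?h)) = 1"
    using g h by (simp only: imat_det_mult) (simp add: algebra_simps)
  ultimately show ?thesis using g det_odd[OF h(2)]
    by (cases "even p"; cases "even q"; cases "even r"; cases "even s"; simp add: psl_Gamma2_of)
qed

lemma psl_Gamma2_even: "psl_Gamma2 g \<Longrightarrow> psl_even g"
  by transfer (auto simp: Gamma2_def)

lemma psl_Gamma2_power: "psl_Gamma2 g \<Longrightarrow> psl_Gamma2 (g ^ n)"
  by (induction n) (auto intro: psl_Gamma2_mult)

lemma psl_hyperbolic_commute: "psl_hyperbolic (g * h) = psl_hyperbolic (h * g)"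
  by transfer (auto simp: algebra_simps)

lemma psl_hyperbolic_conj [simp]: "psl_hyperbolic (h * g * inverse h) = psl_hyperbolic g"
  using psl_hyperbolic_commute[of "h * g" "inverse h"] by simp

text \<open>Conjugators range over the even subgroup rather than Gamma(2), because rotating a word
  by one entry conjugates by a \<open>block\<close>, which is even but lies outside
  Gamma(2).\<close>

definition psl_conj :: "psl2z \<Rightarrow> psl2z \<Rightarrow> bool" where
  "psl_conj g g' \<longleftrightarrow> (\<exists>h. psl_even h \<and> g' = h * g * inverse h)"

lemma psl_conj_refl [simp]: "psl_conj g g"
  unfolding psl_conj_def by (rule exI[of _ 1]) simp

lemma psl_conj_sym: "psl_conj g g' \<Longrightarrow> psl_conj g' g"
proof -
  assume "psl_conj g g'"
  then obtain h where h: "psl_even h" "g' = h * g * inverse h" by (auto simp: psl_conj_def)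
  then have "g = inverse h * g' * inverse (inverse h)" by (simp add: mult.assoc)
  with h(1) show ?thesis unfolding psl_conj_def by (metis psl_even_inverse)
qed

lemma psl_conj_trans: "psl_conj g g' \<Longrightarrow> psl_conj g' g'' \<Longrightarrow> psl_conj g g''"
proof -
  assume "psl_conj g g'" "psl_conj g' g''"
  then obtain h k where h: "psl_even h" "g' = h * g * inverse h" "psl_even k" "g'' = k * g' * inverse k"
    by (auto simp: psl_conj_def)
  then have "g'' = (k * h) * g * inverse (k * h)" by (simp add: mult.assoc)
  with h show ?thesis unfolding psl_conj_def by (metis psl_even_mult_iff)
qed

lemma psl_conj_commute: "psl_even g \<Longrightarrow> psl_conj (g * h) (h * g)"
  unfolding psl_conj_def by (rule exI[of _ "inverse g"]) (simp add: mult.assoc)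

lemma psl_conj_hyperbolic: "psl_conj g g' \<Longrightarrow> psl_hyperbolic g = psl_hyperbolic g'"
  unfolding psl_conj_def by auto

section \<open>Generators of order 3 and the elements represented by words\<close>

definition psl_rho :: psl2z where "psl_rho = psl_of (0, -1, 1, -1)"

definition alphap :: "int \<Rightarrow> psl2z" where "alphap k = psl_of (1, 2 * k, 0, 1)"

definition psl_sigma :: psl2z where "psl_sigma = psl_of (2, -3, 1, -1)"

text \<open>\<open>psl_rho\<close> maps the cusps infinity, 0, 1 to 0, 1, infinity, so beta = rho
  alpha rho^-1 and gamma = rho^-1 alpha rho. In alpha^l beta^m gamma^n the conjugators combine,
  because rho^-1 rho^-1 = rho, and alpha^l rho alpha^m rho alpha^n rho remains: all entries of a
  word play the same role.\<close>

definition block :: "int \<Rightarrow> psl2z" where "block k = alphap k * psl_rho"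

definition word_elt :: "int list \<Rightarrow> psl2z" where "word_elt w = prod_list (map block w)"

lemmas psl_compute = psl_rho_def alphap_def psl_sigma_def block_def psl_of_mult psl_of_inverse psl_one psl_of_eq_iff

lemma alphap_add: "alphap (j + k) = alphap j * alphap k"
  by (simp add: psl_compute)

lemma alphap_0 [simp]: "alphap 0 = 1"
  by (simp add: psl_compute)

lemma alphap_inverse: "inverse (alphap k) = alphap (- k)"
  by (simp add: psl_compute)

lemma rho_sigma_rels:
  "psl_rho * psl_rho = inverse psl_rho" "psl_rho * (psl_rho * x) = inverse psl_rho * x"
  "psl_sigma * psl_sigma = inverse psl_sigma" "psl_sigma * (psl_sigma * x) = inverse psl_sigma * x"
  "inverse psl_rho * inverse psl_rho = psl_rho" "inverse psl_rho * (inverse psl_rho * x) = psl_rho * x"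
  "inverse psl_sigma * inverse psl_sigma = psl_sigma" "inverse psl_sigma * (inverse psl_sigma * x) = psl_sigma * x"
proof -
  show *: "psl_rho * psl_rho = inverse psl_rho" "psl_sigma * psl_sigma = inverse psl_sigma"
    "inverse psl_rho * inverse psl_rho = psl_rho" "inverse psl_sigma * inverse psl_sigma = psl_sigma"
    by (simp_all add: psl_compute)
  show "psl_rho * (psl_rho * x) = inverse psl_rho * x" "psl_sigma * (psl_sigma * x) = inverse psl_sigma * x"
   "inverse psl_rho * (inverse psl_rho * x) = psl_rho * x" "inverse psl_sigma * (inverse psl_sigma * x) = psl_sigma * x"
    by (simp_all only: mult.assoc[symmetric] *)
qed

lemma psl_even_rho [simp]: "psl_even psl_rho"
  by (simp add: psl_compute psl_even_of)

lemma psl_even_sigma [simp]: "psl_even psl_sigma"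
  by (simp add: psl_compute psl_even_of)

lemma psl_even_alphap [simp]: "psl_even (alphap k)"
  by (simp add: psl_compute psl_even_of)

lemma psl_Gamma2_alphap [simp]: "psl_Gamma2 (alphap k)"
  by (simp add: psl_compute psl_Gamma2_of)

lemma psl_even_block [simp]: "psl_even (block k)"
  by (simp add: block_def psl_even_mult_iff)

lemma word_elt_simps [simp]:
  "word_elt [] = 1" "word_elt (k # w) = block k * word_elt w"
  "word_elt (w @ w') = word_elt w * word_elt w'"
  by (simp_all add: word_elt_def)

lemma psl_even_word [simp]: "psl_even (word_elt w)"
  by (induction w) (auto simp: psl_even_mult_iff)

lemma word_elt_rotate: "psl_conj (word_elt w) (word_elt (rotate k w))"
proof -
  define m where "m = k mod length w"
  have "word_elt w = word_elt (take m w) * word_elt (drop m w)"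
    by (metis append_take_drop_id word_elt_simps(3))
  moreover have "word_elt (rotate k w) = word_elt (drop m w) * word_elt (take m w)"
    by (simp add: rotate_drop_take m_def)
  ultimately show ?thesis by (simp add: psl_conj_commute)
qed

lemma word_elt_concat_replicate: "word_elt (concat (replicate n w)) = word_elt w ^ n"
  by (induction n) auto

section \<open>Positive words\<close>

text \<open>The translation by 1 and its transpose. Both are odd, so a product of letters is even
  exactly when their number is.\<close>

definition lr_letter :: "bool \<Rightarrow> psl2z" where
  "lr_letter x = psl_of (if x then (1, 1, 0, 1) else (1, 0, 1, 1))"

definition lr_word :: "bool list \<Rightarrow> psl2z" where
  "lr_word l = prod_list (map lr_letter l)"

lemma lr_word_simps [simp]:
  "lr_word [] = 1" "lr_word (x # l) = lr_letter x * lr_word l"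
  "lr_word (l @ l') = lr_word l * lr_word l'"
  by (simp_all add: lr_word_def)

lemma even_lr_letter [simp]: "\<not> psl_even (lr_letter x)"
  by (simp add: lr_letter_def psl_even_of)

lemma even_lr_word [simp]: "psl_even (lr_word l) \<longleftrightarrow> even (length l)"
  by (induction l) (auto simp: psl_even_mult_iff)

definition psl_nonneg :: "psl2z \<Rightarrow> bool" where
  "psl_nonneg g \<longleftrightarrow> (\<exists>a b c d. g = psl_of (a, b, c, d) \<and> a * d - b * c = 1 \<and>
     a \<ge> 0 \<and> b \<ge> 0 \<and> c \<ge> 0 \<and> d \<ge> 0)"

text \<open>The Euclidean algorithm on rows: if one row dominates the other entrywise, subtracting
  the smaller one splits off a letter. If neither dominates, determinant 1 leaves only the
  identity.\<close>

lemma psl_nonneg_imp_lr_word: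
  assumes "psl_nonneg g"
  shows "\<exists>l. g = lr_word l"
proof -
  have "\<exists>l. psl_of (a, b, c, d) = lr_word l"
    if "a * d - b * c = 1" "a \<ge> 0" "b \<ge> 0" "c \<ge> 0" "d \<ge> 0" for a b c d
    using that
  proof (induction "nat (a + b + c + d)" arbitrary: a b c d rule: less_induct)
    case less
    consider "a \<ge> c" "b \<ge> d" | "c \<ge> a" "d \<ge> b" | "a > c" "d > b" | "a < c" "b > d" by linarith
    then show ?case
    proof cases
      case 1
      \<comment> \<open>The subtracted row is nonzero, as the determinant is 1; hence the sum of the
        entries strictly decreases.\<close>
      have nz: "c + d > 0"
        using less.prems by (metis add_nonneg_eq_0_iff diff_self eq_iff less_le mult_zero_right zero_neq_one add_nonneg_nonneg)
      have det: "(a - c) * d - (b - d) * c = 1" using less.prems(1) by (simp add: algebra_simps)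
      have "\<exists>l. psl_of (a - c, b - d, c, d) = lr_word l"
        by (rule less.hyps) (use 1 less.prems nz det in auto)
      then obtain l where l: "psl_of (a - c, b - d, c, d) = lr_word l" by blast
      have "psl_of (a, b, c, d) = lr_letter True * psl_of (a - c, b - d, c, d)"
        using det by (simp add: lr_letter_def psl_of_mult)
      then have "psl_of (a, b, c, d) = lr_word (True # l)" by (simp add: l)
      then show ?thesis by blast
    next
      case 2
      have nz: "a + b > 0"
        using less.prems by (metis add_nonneg_eq_0_iff diff_self eq_iff less_le mult_zero_left zero_neq_one add_nonneg_nonneg)
      have det: "a * (d - b) - b * (c - a) = 1" using less.prems(1) by (simp add: algebra_simps)
      have "\<exists>l. psl_of (a, b, c - a, d - b) = lr_word l"
        by (rule less.hyps) (use 2 less.prems nz det in auto)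
      then obtain l where l: "psl_of (a, b, c - a, d - b) = lr_word l" by blast
      have "psl_of (a, b, c, d) = lr_letter False * psl_of (a, b, c - a, d - b)"
        using det by (simp add: lr_letter_def psl_of_mult)
      then have "psl_of (a, b, c, d) = lr_word (False # l)" by (simp add: l)
      then show ?thesis by blast
    next
      case 3
      have "(c + 1) * (b + 1) \<le> a * d" by (rule mult_mono) (use 3 less.prems in auto)
      then have "b + c + (c * b - b * c) \<le> 0" using less.prems by (simp add: algebra_simps)
      then have bc: "b = 0" "c = 0" using less.prems by (auto simp: mult.commute)
      then have "a = 1" "d = 1" using less.prems zmult_eq_1_iff[of a d] by auto
      then have "psl_of (a, b, c, d) = lr_word []" using bc by (simp add: psl_one)
      then show ?thesis by blast
    next
      case 4
      have "a * d \<le> c * b" by (rule mult_mono) (use 4 less.prems in auto)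
      then show ?thesis using less.prems(1) by (simp add: mult.commute)
    qed
  qed
  with assms show ?thesis by (auto simp: psl_nonneg_def)
qed

section \<open>Reduction of hyperbolic elements to nonnegative matrices\<close>

definition psl_reducible :: "psl2z \<Rightarrow> bool" where
  "psl_reducible g \<longleftrightarrow> (\<exists>h g'. psl_nonneg g' \<and> g = h * g' * inverse h)"

lemma psl_reducible_conj: "psl_reducible (h * g * inverse h) \<longleftrightarrow> psl_reducible g"
proof -
  have *: "psl_reducible (h * g * inverse h)" if g: "psl_reducible g" for h g
  proof -
    obtain k g' where "psl_nonneg g'" "g = k * g' * inverse k"
      using g unfolding psl_reducible_def by blast
    then have "psl_nonneg g'" "h * g * inverse h = (h * k) * g' * inverse (h * k)" by (auto simp: mult.assoc)
    then show ?thesis unfolding psl_reducible_def by blast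
  qed
  show ?thesis using *[of g h] *[of "h * g * inverse h" "inverse h"] by (auto simp: mult.assoc)
qed

lemma psl_reducible_swap:
  assumes "a * d - b * c = 1"
  shows "psl_reducible (psl_of (d, -c, -b, a)) \<longleftrightarrow> psl_reducible (psl_of (a, b, c, d))"
proof -
  have "psl_of (d, -c, -b, a) = psl_of (0, -1, 1, 0) * psl_of (a, b, c, d) * inverse (psl_of (0, -1, 1, 0))"
    using assms by (simp add: psl_of_mult psl_of_inverse algebra_simps)
  then show ?thesis by (simp add: psl_reducible_conj)
qed

lemma psl_reducible_shear:
  assumes "a * d - b * c = 1"
  shows "psl_reducible (psl_of (a + e * c, b + e * (d - a) - e * e * c, c, d - e * c)) \<longleftrightarrow>
    psl_reducible (psl_of (a, b, c, d))"
proof -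
  have "psl_of (a + e * c, b + e * (d - a) - e * e * c, c, d - e * c)
     = psl_of (1, e, 0, 1) * psl_of (a, b, c, d) * inverse (psl_of (1, e, 0, 1))"
    using assms by (simp add: psl_of_mult psl_of_inverse algebra_simps)
  then show ?thesis by (simp add: psl_reducible_conj)
qed

text \<open>Since ad = 1 + bc > 0, the entries a and d have the same sign, as do b and c. If the two
  signs agree, the matrix is nonnegative up to sign; otherwise conjugation by z -> -1/z makes them
  agree.\<close>

lemma psl_reducible_pos:
  assumes det: "a * d - b * c = 1" and bc: "b * c > 0"
  shows "psl_reducible (psl_of (a, b, c, d))"
proof -
  have *: "psl_reducible (psl_of (a, b, c, d))" if "a * d - b * c = 1" "b > 0" "c > 0" for a b c d :: int
  proof -
    have "a * d > 0" using that by (smt (verit) mult_pos_pos)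
    then consider "a > 0" "d > 0" | "a < 0" "d < 0" by (auto simp: zero_less_mult_iff)
    then show ?thesis
    proof cases
      case 1
      then have "psl_nonneg (psl_of (a, b, c, d))" using that unfolding psl_nonneg_def
        by (intro exI[of _ a] exI[of _ b] exI[of _ c] exI[of _ d]) auto
      then show ?thesis unfolding psl_reducible_def
        by (intro exI[of _ 1] exI[of _ "psl_of (a, b, c, d)"]) auto
    next
      case 2
      have d': "(- d) * (- a) - c * b = 1" using that by (simp add: mult.commute)
      then have "psl_nonneg (psl_of (- d, c, b, - a))" using that 2 unfolding psl_nonneg_def
        by (intro exI[of _ "-d"] exI[of _ c] exI[of _ b] exI[of _ "-a"]) auto
      then have "psl_reducible (psl_of (- d, c, b, - a))" unfolding psl_reducible_def
        by (intro exI[of _ 1] exI[of _ "psl_of (- d, c, b, - a)"]) auto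
      moreover have "psl_of (- d, c, b, - a) = psl_of (d, - c, - b, a)"
        using psl_of_neg[of "(d, - c, - b, a)"] that by (simp add: mult.commute)
      ultimately show ?thesis using psl_reducible_swap[OF that(1)] by simp
    qed
  qed
  show ?thesis
  proof (cases "b > 0")
    case True
    then show ?thesis using * det bc by (simp add: zero_less_mult_iff)
  next
    case False
    then have "- b > 0" "- c > 0" using bc by (auto simp: zero_less_mult_iff)
    then have "psl_reducible (psl_of (- a, - b, - c, - d))" using *[of "-a" "-d" "-b" "-c"] det by simp
    then show ?thesis using psl_of_neg[of "(a, b, c, d)"] det by simp
  qed
qed

text \<open>The discriminant (d - a)^2 + 4bc = (a + d)^2 - 4 is positive, so (d - a)^2 exceeds
  4|bc|, which is at least 4c^2. The bound makes the shear in the reduction a strict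
  descent.\<close>

lemma discriminant_bound:
  fixes a b c d :: int
  assumes det: "a * d - b * c = 1" and tr: "\<bar>a + d\<bar> > 2" and bc: "b * c < 0" "\<bar>c\<bar> \<le> \<bar>b\<bar>"
  shows "\<bar>d - a\<bar> > \<bar>c\<bar>"
proof -
  have "(a + d)\<^sup>2 > 4"
  proof -
    have "(a + d)\<^sup>2 = \<bar>a + d\<bar>\<^sup>2" by simp
    also have "\<dots> \<ge> 3\<^sup>2" using tr by (intro power_mono) auto
    finally show ?thesis by simp
  qed
  moreover have "(d - a)\<^sup>2 = (a + d)\<^sup>2 - 4 * (a * d)" by (simp add: power2_eq_square algebra_simps)
  ultimately have "(d - a)\<^sup>2 > - 4 * (b * c)" using det by simp
  moreover have "- (b * c) = \<bar>b\<bar> * \<bar>c\<bar>" using bc by (simp add: abs_mult[symmetric])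
  moreover have "\<bar>b\<bar> * \<bar>c\<bar> \<ge> \<bar>c\<bar> * \<bar>c\<bar>" using bc by (intro mult_right_mono) auto
  moreover have "\<bar>c\<bar> * \<bar>c\<bar> = c\<^sup>2" "c\<^sup>2 \<ge> 0" by (simp_all add: power2_eq_square)
  ultimately have "(d - a)\<^sup>2 > c\<^sup>2" by linarith
  then show ?thesis using abs_le_square_iff[of "d - a" c] by linarith
qed

text \<open>Gauss reduction of the indefinite form c x^2 + (d - a) x - b, whose roots are the fixed
  points. The condition bc > 0 says that one fixed point is positive and the other negative. While
  bc < 0, a shear by a unit either makes bc positive or shortens the longer of b and c; bc = 0 would
  give trace 2 or -2.\<close>

lemma psl_hyperbolic_reducible:
  assumes "psl_hyperbolic g"
  shows "psl_reducible g"
proof -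
  have "psl_reducible (psl_of (a, b, c, d))" if "a * d - b * c = 1" "\<bar>a + d\<bar> > 2" for a b c d
    using that
  proof (induction "nat (\<bar>b\<bar> + \<bar>c\<bar>)" arbitrary: a b c d rule: less_induct)
    case less
    have main: "psl_reducible (psl_of (a, b, c, d))"
      if det: "a * d - b * c = 1" and tr: "\<bar>a + d\<bar> > 2" and bc: "b * c < 0" "\<bar>c\<bar> \<le> \<bar>b\<bar>"
        and IH: "\<And>a' b' c' d'. nat (\<bar>b'\<bar> + \<bar>c'\<bar>) < nat (\<bar>b\<bar> + \<bar>c\<bar>) \<Longrightarrow>
          a' * d' - b' * c' = 1 \<Longrightarrow> \<bar>a' + d'\<bar> > 2 \<Longrightarrow> psl_reducible (psl_of (a', b', c', d'))" for a b c d
    proof -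
      have s: "\<bar>d - a\<bar> > \<bar>c\<bar>" by (rule discriminant_bound[OF det tr bc])
      \<comment> \<open>With this sign e (d - a) is opposite to b, so the new entry has the sign of
        b times |b| - |d - a| + |c|.\<close>
      define e where "e = - sgn b * sgn (d - a)"
      have b0: "b \<noteq> 0" "c \<noteq> 0" using bc by auto
      have da: "d - a \<noteq> 0" using s by auto
      have e1: "e * e = 1" using b0 da by (auto simp: e_def sgn_if)
      define b' where "b' = b + e * (d - a) - e * e * c"
      have det': "(a + e * c) * (d - e * c) - b' * c = 1"
        using det unfolding b'_def by algebra
      have sb: "b' = sgn b * (\<bar>b\<bar> - \<bar>d - a\<bar> + \<bar>c\<bar>)"
        using bc b0 da unfolding b'_def e1 unfolding e_def by (auto simp: sgn_if mult_less_0_iff)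
      have "psl_reducible (psl_of (a + e * c, b', c, d - e * c))"
      proof (cases "\<bar>b\<bar> - \<bar>d - a\<bar> + \<bar>c\<bar> < 0")
        case True
        then have "b' * c > 0" using bc b0 unfolding sb by (auto simp: sgn_if mult_less_0_iff zero_less_mult_iff)
        then show ?thesis by (rule psl_reducible_pos[OF det'])
      next
        case False
        then have "\<bar>b'\<bar> = \<bar>b\<bar> - \<bar>d - a\<bar> + \<bar>c\<bar>" using b0 unfolding sb by (auto simp: sgn_if abs_mult)
        then show ?thesis using s tr det' by (intro IH) auto
      qed
      then show ?thesis using psl_reducible_shear[OF det, of e] by (simp add: b'_def)
    qed
    consider "b * c > 0" | "b * c = 0" | "b * c < 0" by linarith
    then show ?case
    proof cases
      case 1
      then show ?thesis using psl_reducible_pos less.prems by blast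
    next
      case 2
      then have "a * d = 1" using less.prems(1) by linarith
      then have "\<bar>a + d\<bar> = 2" using zmult_eq_1_iff[of a d] by auto
      then show ?thesis using less.prems by simp
    next
      case 3
      show ?thesis
      proof (cases "\<bar>c\<bar> \<le> \<bar>b\<bar>")
        case True
        show ?thesis by (rule main) (use 3 less True in auto)
      next
        case False
        have "psl_reducible (psl_of (d, - c, - b, a))"
        proof (rule main)
          show "psl_reducible (psl_of (a', b', c', d'))" if "nat (\<bar>b'\<bar> + \<bar>c'\<bar>) < nat (\<bar>- c\<bar> + \<bar>- b\<bar>)"
            "a' * d' - b' * c' = 1" "\<bar>a' + d'\<bar> > 2" for a' b' c' d'
            by (rule less.hyps) (use that in auto)
        qed (use 3 less.prems False in \<open>auto simp: mult.commute add.commute\<close>)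
        then show ?thesis using psl_reducible_swap less.prems by blast
      qed
    qed
  qed
  with assms show ?thesis by (cases g rule: psl_cases) (auto simp: psl_hyperbolic_of)
qed

section \<open>Positive words of even length as alternating words in rho and sigma\<close>

fun pair_word :: "(bool \<times> bool) list \<Rightarrow> bool list" where
  "pair_word [] = []"
| "pair_word ((x, y) # u) = x # y # pair_word u"

lemma pair_word_append [simp]: "pair_word (u @ v) = pair_word u @ pair_word v"
  by (induction u rule: pair_word.induct) auto

lemma pair_word_surj: "even (length l) \<Longrightarrow> \<exists>u. l = pair_word u"
proof (induction l rule: induct_list012)
  case (3 x y zs)
  then obtain u where "zs = pair_word u" by auto
  then have "x # y # zs = pair_word ((x, y) # u)" by simp
  then show ?case by blast
qed (auto intro: exI[of _ "[]"])

lemma pair_word_inj: "pair_word u = pair_word v \<longleftrightarrow> u = v"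
  by (induction u arbitrary: v rule: pair_word.induct; case_tac v; force)

lemma length_pair_word [simp]: "length (pair_word u) = 2 * length u"
  by (induction u rule: pair_word.induct) auto

text \<open>\<open>True\<close> stands for \<open>psl_sigma\<close> in first place but for
  \<open>inverse psl_rho\<close> in second place: these two correspond under the involution that
  exchanges the two factors of the free product.\<close>

definition pair_elt :: "bool \<times> bool \<Rightarrow> psl2z" where
  "pair_elt p = (if fst p then psl_sigma else inverse psl_sigma) * (if snd p then inverse psl_rho else psl_rho)"

text \<open>With \<open>J\<close> the involution that conjugates \<open>psl_sigma\<close> to \<open>inverse psl_rho\<close>, the products of
  \<open>psl_sigma\<close>, \<open>inverse psl_sigma\<close> with \<open>J\<close> are the two letters conjugated by \<open>frame\<close>.\<close>

definition frame :: psl2z where "frame = psl_of (1, 1, 0, 1)"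

lemma pair_elt_lr: "pair_elt (x, y) = frame * (lr_letter x * lr_letter y) * inverse frame"
  by (cases x; cases y; simp add: pair_elt_def frame_def lr_letter_def psl_compute)

lemma prod_pair_elt: "prod_list (map pair_elt u) = frame * lr_word (pair_word u) * inverse frame"
  by (induction u rule: pair_word.induct) (auto simp: pair_elt_lr mult.assoc)

lemma block_0_1: "block 0 = psl_rho" "block 1 = psl_sigma"
  by (simp_all add: psl_compute)

lemma pair_elt_word: "\<exists>w. pair_elt p = word_elt w"
proof -
  obtain x y where p: "p = (x, y)" by force
  have "pair_elt p = word_elt ((if x then [1] else [1, 1]) @ (if y then [0, 0] else [0]))"
    by (simp add: pair_elt_def p block_0_1 rho_sigma_rels)
  then show ?thesis by blast
qed

lemma prod_pair_elt_word: "\<exists>w. prod_list (map pair_elt u) = word_elt w"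
proof (induction u)
  case Nil
  show ?case by (rule exI[of _ "[]"]) simp
next
  case (Cons p u)
  then obtain w where "prod_list (map pair_elt u) = word_elt w" by blast
  moreover obtain v where "pair_elt p = word_elt v" using pair_elt_word by blast
  ultimately have "prod_list (map pair_elt (p # u)) = word_elt (v @ w)" by simp
  then show ?case by blast
qed

text \<open>The conjugation by \<open>frame\<close>, which turns pairs of letters into products of
  rho and sigma, is odd. To obtain an even conjugator in total, the positive word has to be reached
  by an odd one.\<close>

lemma hyperbolic_conj_word:
  assumes "psl_hyperbolic g" "psl_even g"
  shows "\<exists>w. psl_conj (word_elt w) g"
proof -
  obtain h g' where h: "psl_nonneg g'" "g = h * g' * inverse h"
    using psl_hyperbolic_reducible[OF assms(1)] by (auto simp: psl_reducible_def)
  obtain l where l: "g' = lr_word l" using psl_nonneg_imp_lr_word[OF h(1)] by blast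
  have even_l: "even (length l)" using assms(2) by (auto simp: h l psl_even_mult_iff)
  have "l \<noteq> []" using assms(1) by (auto simp: h l psl_one psl_hyperbolic_of)
  then obtain x l' where l': "l = x # l'" by (cases l) auto
  have "\<exists>k u. \<not> psl_even k \<and> g = k * lr_word (pair_word u) * inverse k"
  proof (cases "psl_even h")
    case False
    then show ?thesis using h l pair_word_surj[OF even_l] by blast
  next
    case True
    \<comment> \<open>Moving the first letter to the end conjugates by a letter, which is odd, and
      so changes the parity of the conjugator.\<close>
    obtain u where "l' @ [x] = pair_word u" using even_l l' pair_word_surj[of "l' @ [x]"] by auto
    moreover have "g = (h * lr_letter x) * lr_word (l' @ [x]) * inverse (h * lr_letter x)"
      by (simp add: h l l' mult.assoc)
    ultimately show ?thesis using True by (metis even_lr_letter psl_even_mult_iff)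
  qed
  then obtain k u where k: "\<not> psl_even k" "g = k * lr_word (pair_word u) * inverse k" by blast
  obtain w where w: "prod_list (map pair_elt u) = word_elt w" using prod_pair_elt_word by blast
  have "g = (k * inverse frame) * word_elt w * inverse (k * inverse frame)"
    by (simp add: k(2) w[symmetric] prod_pair_elt mult.assoc)
  moreover have "psl_even (k * inverse frame)"
    using k(1) by (simp add: psl_even_mult_iff frame_def psl_even_of)
  ultimately show ?thesis unfolding psl_conj_def by blast
qed

section \<open>Existence of normal words\<close>

text \<open>Normality for words of any positive length. It is invariant under rotation by single
  entries and makes sense for roots of words, whose length may fail to be divisible by 3.\<close>

definition cyc_normal :: "int list \<Rightarrow> bool" where
  "cyc_normal w \<longleftrightarrow> w \<noteq> []
   \<and> (\<forall>i. entry w (i + 1) = 1 \<longrightarrow> entry w i \<le> 0 \<and> entry w (i + 2) \<le> 0)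
   \<and> (\<forall>i. entry w (i + 1) = 0 \<longrightarrow>
        (entry w i \<le> -1 \<and> entry w (i + 2) \<ge> 1) \<or>
        (entry w i \<ge> 1 \<and> entry w (i + 2) \<le> -1) \<or>
        (entry w i \<ge> 1 \<and> entry w (i + 2) \<ge> 1))
   \<and> \<not> (\<exists>i k. k \<ge> 1 \<and> entry w i = 0 \<and> (\<forall>j\<in>{1..k}. entry w (i + j) = -1) \<and> entry w (i + k + 1) = 0)
   \<and> w \<noteq> replicate (length w) (-1)"

lemma normal_word_iff: "normal_word w \<longleftrightarrow> cyc_normal w \<and> 3 dvd length w"
  unfolding normal_word_def cyc_normal_def loop_word_def by blast

lemma entry_rotate: "w \<noteq> [] \<Longrightarrow> entry (rotate k w) i = entry w (k + i)"
  by (simp add: entry_def nth_rotate mod_add_right_eq)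

lemma entry_add_length: "entry w (i + length w) = entry w i"
  by (simp add: entry_def)

lemma entry_less: "i < length w \<Longrightarrow> entry w i = w ! i"
  by (simp add: entry_def)

lemma rotate_mult_length: "rotate (n * length w) w = w"
  by (simp add: rotate_drop_take)

lemma rotate_inverse: "rotate (k * length w - k) (rotate k w) = w"
proof (cases "w = []")
  case False
  then have "k * length w - k + k = k * length w" by (simp add: Suc_leI)
  then show ?thesis by (simp add: rotate_rotate rotate_mult_length)
qed simp

lemma cyc_normal_rotate_imp:
  assumes "cyc_normal w"
  shows "cyc_normal (rotate k w)"
proof -
  have w: "w \<noteq> []" using assms by (simp add: cyc_normal_def)
  have "rotate k w \<noteq> replicate (length w) (-1)"
  proof
    assume *: "rotate k w = replicate (length w) (-1)"
    have "set w \<subseteq> {-1}" using arg_cong[OF *, of set] by (simp add: set_replicate_conv_if split: if_splits)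
    then have "w = replicate (length w) (-1)" by (intro replicate_length_same[symmetric]) auto
    then show False using assms unfolding cyc_normal_def by blast
  qed
  moreover have "\<forall>i. entry w (k + (i + 1)) = 1 \<longrightarrow> entry w (k + i) \<le> 0 \<and> entry w (k + (i + 2)) \<le> 0"
  proof
    fix i
    show "entry w (k + (i + 1)) = 1 \<longrightarrow> entry w (k + i) \<le> 0 \<and> entry w (k + (i + 2)) \<le> 0"
      using assms[unfolded cyc_normal_def, THEN conjunct2, THEN conjunct1, THEN spec, of "k + i"]
      by (simp only: add.assoc)
  qed
  moreover have "\<forall>i. entry w (k + (i + 1)) = 0 \<longrightarrow>
        (entry w (k + i) \<le> -1 \<and> entry w (k + (i + 2)) \<ge> 1) \<or>
        (entry w (k + i) \<ge> 1 \<and> entry w (k + (i + 2)) \<le> -1) \<or>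
        (entry w (k + i) \<ge> 1 \<and> entry w (k + (i + 2)) \<ge> 1)"
  proof
    fix i
    show "entry w (k + (i + 1)) = 0 \<longrightarrow>
        (entry w (k + i) \<le> -1 \<and> entry w (k + (i + 2)) \<ge> 1) \<or>
        (entry w (k + i) \<ge> 1 \<and> entry w (k + (i + 2)) \<le> -1) \<or>
        (entry w (k + i) \<ge> 1 \<and> entry w (k + (i + 2)) \<ge> 1)"
      using assms[unfolded cyc_normal_def, THEN conjunct2, THEN conjunct2, THEN conjunct1, THEN spec, of "k + i"]
      by (simp only: add.assoc)
  qed
  moreover have "\<not> (\<exists>i m. m \<ge> 1 \<and> entry w (k + i) = 0 \<and> (\<forall>j\<in>{1..m}. entry w (k + (i + j)) = -1) \<and>
      entry w (k + (i + m + 1)) = 0)"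
  proof
    assume "\<exists>i m. m \<ge> 1 \<and> entry w (k + i) = 0 \<and> (\<forall>j\<in>{1..m}. entry w (k + (i + j)) = -1) \<and>
      entry w (k + (i + m + 1)) = 0"
    then obtain i m where "m \<ge> 1" "entry w (k + i) = 0" "\<forall>j\<in>{1..m}. entry w (k + i + j) = -1"
      "entry w (k + i + m + 1) = 0" by (auto simp only: add.assoc)
    then show False using assms unfolding cyc_normal_def by blast
  qed
  ultimately show ?thesis using w
    unfolding cyc_normal_def entry_rotate[OF w] length_rotate rotate_is_Nil_conv by blast
qed

lemma cyc_normal_rotate [simp]: "cyc_normal (rotate k w) = cyc_normal w"
  using cyc_normal_rotate_imp[of w k] cyc_normal_rotate_imp[of "rotate k w" "k * length w - k"]
  by (simp only: rotate_inverse) blast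

section \<open>Shortening moves\<close>

definition abs_sum :: "int list \<Rightarrow> int" where
  "abs_sum w = sum_list (map abs w)"

lemma abs_sum_simps [simp]:
  "abs_sum [] = 0" "abs_sum (k # w) = \<bar>k\<bar> + abs_sum w" "abs_sum (w @ w') = abs_sum w + abs_sum w'"
  by (simp_all add: abs_sum_def)

lemma abs_sum_nonneg: "abs_sum w \<ge> 0"
  by (induction w) auto

lemma abs_sum_rotate [simp]: "abs_sum (rotate k w) = abs_sum w"
  by (metis abs_sum_simps(3) add.commute append_take_drop_id rotate_drop_take)

definition shorter :: "int list \<Rightarrow> int list \<Rightarrow> bool" where
  "shorter w' w \<longleftrightarrow> length w' < length w \<or> length w' = length w \<and> abs_sum w' < abs_sum w"

lemma shorter_rotate [simp]: "shorter w' (rotate k w) = shorter w' w"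
  by (simp add: shorter_def)

lemma alphap_block: "alphap j * block k = block (k + j)" "alphap j * (block k * x) = block (k + j) * x"
  by (simp_all add: block_def alphap_add[symmetric] mult.assoc[symmetric] add.commute)

text \<open>The relation alpha beta gamma = 1 in the form sigma^3 = 1, that is, rho alpha rho =
  alpha^-1 rho rho alpha^-1. The trailing power of alpha is absorbed by the next entry, so (a, 1, b)
  becomes (a - 1, 0, b - 1); \<open>block_0_move\<close> is the same move read backwards.\<close>

lemma block_1_move: "block a * block 1 = block (a - 1) * block 0 * alphap (-1)"
  by (simp add: psl_compute)

lemma block_0_move: "block a * block 0 = block (a + 1) * block 1 * alphap 1"
  by (simp add: psl_compute)

lemma block_0_0: "block a * block 0 * block 0 = alphap a"
  by (simp add: psl_compute)

text \<open>The origin of the third and fourth conditions: a run of entries -1 is a conjugate of a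
  run of entries 2. For the cyclic word of entries -1 only this gives a second representative of the
  same length.\<close>

lemma block_minus_1: "block (-1) = psl_rho * psl_sigma * block 2 * inverse (psl_rho * psl_sigma)"
  by (simp add: psl_compute)

text \<open>The zeros at both ends of a run of entries -1 cancel the conjugators of
  \<open>block_minus_1\<close>. In all, (a, 0, -1, ..., -1, 0, b) becomes (a + 1, 2, ..., 2, b + 1),
  which is shorter by three entries.\<close>

lemma block_0_minus_1s:
  assumes "k \<ge> 1"
  shows "block a * block 0 * block (-1) ^ k * block 0 = block (a + 1) * block 2 ^ (k - 1) * alphap 1"
proof -
  have 1: "block a * block 0 * (psl_rho * psl_sigma) = block (a + 1)"
    by (simp add: psl_compute)
  have 2: "block 2 * inverse (psl_rho * psl_sigma) * block 0 = alphap 1"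
    by (simp add: psl_compute)
  obtain j where k: "k = Suc j" using assms by (cases k) auto
  define x where "x = psl_rho * psl_sigma"
  have "block a * block 0 * block (-1) ^ k * block 0
      = block a * block 0 * x * block 2 ^ j * (block 2 * inverse x * block 0)"
    unfolding block_minus_1[folded x_def] psl_conj_power k power_Suc2 by (simp only: mult.assoc psl_inverse)
  also have "\<dots> = block (a + 1) * block 2 ^ j * alphap 1"
    unfolding x_def by (simp only: 1 2)
  finally show ?thesis by (simp add: k)
qed

lemma word_elt_replicate: "word_elt (replicate k a) = block a ^ k"
  by (induction k) auto

lemma psl_conj_word_append: "psl_conj (word_elt (v @ w)) (word_elt (w @ v))"
  by (simp add: psl_conj_commute)

lemma not_hyperbolic_alphap: "\<not> psl_hyperbolic (alphap k)"
  by (simp add: alphap_def psl_hyperbolic_of)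

text \<open>The move to (a - 1, 0, b - 1) gains 1 from the middle entry and 1 from a neighbour that
  is at least 1, and loses at most 1 at the other. In a word of length 2 both neighbours are the
  same entry, which is then changed by 2.\<close>

lemma shorten_1:
  assumes "a \<ge> 1 \<or> (\<exists>b r. rest = b # r \<and> b \<ge> 1)"
  shows "\<exists>w'. psl_conj (word_elt (a # 1 # rest)) (word_elt w') \<and> shorter w' (a # 1 # rest)"
proof (cases rest)
  case Nil
  have "psl_conj (word_elt [a, 1]) (word_elt [a - 2, 0])"
  proof -
    have "word_elt [a, 1] = word_elt [a - 1, 0] * alphap (-1)" by (simp add: block_1_move mult.assoc)
    also have "psl_conj \<dots> (alphap (-1) * word_elt [a - 1, 0])"
      by (rule psl_conj_commute) (simp add: psl_even_mult_iff)
    finally show ?thesis by (simp add: alphap_block)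
  qed
  moreover have "shorter [a - 2, 0] [a, 1]" using assms Nil by (auto simp: shorter_def)
  ultimately show ?thesis using Nil by blast
next
  case (Cons b r)
  have "word_elt (a # 1 # rest) = word_elt ((a - 1) # 0 # (b - 1) # r)"
    by (simp add: Cons mult.assoc[symmetric] block_1_move)
      (simp add: mult.assoc alphap_block)
  moreover have "shorter ((a - 1) # 0 # (b - 1) # r) (a # 1 # rest)"
    using assms Cons by (auto simp: shorter_def)
  ultimately show ?thesis by (metis psl_conj_refl)
qed

text \<open>As rho^3 = 1, the word (x, 0, 0, y) contracts to (x + y). Words too short to have both
  outer entries represent elliptic or parabolic elements.\<close>

lemma shorten_0_0:
  assumes "psl_hyperbolic (word_elt (0 # 0 # rest))"
  shows "\<exists>w'. psl_conj (word_elt (0 # 0 # rest)) (word_elt w') \<and> shorter w' (0 # 0 # rest)"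
proof (cases rest rule: rev_cases)
  case Nil
  then show ?thesis using assms by (simp add: psl_compute psl_hyperbolic_of)
next
  case (snoc r' x)
  have c: "psl_conj (word_elt (0 # 0 # rest)) (word_elt ([x, 0, 0] @ r'))"
    using psl_conj_word_append[of "0 # 0 # r'" "[x]"]
      psl_conj_trans[OF _ psl_conj_refl] by (simp add: snoc)
  have e: "word_elt ([x, 0, 0] @ r') = alphap x * word_elt r'"
    using block_0_0[of x] by (simp add: mult.assoc[symmetric])
  have "r' \<noteq> []"
  proof
    assume "r' = []"
    then have "psl_hyperbolic (alphap x)" using psl_conj_hyperbolic[OF c] assms e by simp
    then show False by (simp add: not_hyperbolic_alphap)
  qed
  then obtain y r where r: "r' = y # r" by (cases r') auto
  have "psl_conj (word_elt (0 # 0 # rest)) (word_elt ((y + x) # r))"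
    using c e by (simp add: r alphap_block)
  moreover have "shorter ((y + x) # r) (0 # 0 # rest)" by (simp add: shorter_def snoc r)
  ultimately show ?thesis by blast
qed

lemma shorten_0:
  assumes "psl_hyperbolic (word_elt (a # 0 # rest))" "a \<le> -1" "\<And>b r. rest = b # r \<Longrightarrow> b \<le> -1"
  shows "\<exists>w'. psl_conj (word_elt (a # 0 # rest)) (word_elt w') \<and> shorter w' (a # 0 # rest)"
proof (cases rest)
  case Nil
  have "a \<noteq> -1"
  proof
    assume "a = -1"
    then show False using assms(1) Nil by (simp add: psl_compute psl_hyperbolic_of)
  qed
  have "psl_conj (word_elt [a, 0]) (word_elt [a + 2, 1])"
  proof -
    have "word_elt [a, 0] = word_elt [a + 1, 1] * alphap 1" by (simp add: block_0_move mult.assoc)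
    also have "psl_conj \<dots> (alphap 1 * word_elt [a + 1, 1])"
      by (rule psl_conj_commute) (simp add: psl_even_mult_iff)
    finally show ?thesis by (simp add: alphap_block add.commute)
  qed
  moreover have "shorter [a + 2, 1] [a, 0]" using assms(2) \<open>a \<noteq> -1\<close> by (auto simp: shorter_def)
  ultimately show ?thesis using Nil by blast
next
  case (Cons b r)
  have "word_elt (a # 0 # rest) = word_elt ((a + 1) # 1 # (b + 1) # r)"
    by (simp add: Cons mult.assoc[symmetric] block_0_move)
      (simp add: mult.assoc alphap_block)
  moreover have "shorter ((a + 1) # 1 # (b + 1) # r) (a # 0 # rest)"
    using assms(2,3) Cons by (auto simp: shorter_def)
  ultimately show ?thesis by (metis psl_conj_refl)
qed

lemma shorten_minus_1s:
  assumes "k \<ge> 1"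
  shows "\<exists>w'. psl_conj (word_elt (a # 0 # replicate k (-1) @ 0 # rest)) (word_elt w') \<and>
    shorter w' (a # 0 # replicate k (-1) @ 0 # rest)"
proof -
  let ?w = "a # 0 # replicate k (-1) @ 0 # rest"
  have e: "word_elt ?w = block (a + 1) * block 2 ^ (k - 1) * alphap 1 * word_elt rest"
    using block_0_minus_1s[OF assms, of a] by (simp add: word_elt_replicate mult.assoc[symmetric])
  show ?thesis
  proof (cases rest)
    case Nil
    have "word_elt ?w = word_elt ((a + 1) # replicate (k - 1) 2) * alphap 1"
      using e by (simp add: Nil word_elt_replicate)
    also have "psl_conj \<dots> (alphap 1 * word_elt ((a + 1) # replicate (k - 1) 2))"
      by (rule psl_conj_commute) (simp del: word_elt_simps)
    also have "alphap 1 * word_elt ((a + 1) # replicate (k - 1) 2) = word_elt ((a + 2) # replicate (k - 1) 2)"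
      by (simp add: alphap_block add.commute)
    finally have "psl_conj (word_elt ?w) (word_elt ((a + 2) # replicate (k - 1) 2))" .
    moreover have "shorter ((a + 2) # replicate (k - 1) 2) ?w" unfolding shorter_def by (intro disjI1) simp
    ultimately show ?thesis by blast
  next
    case (Cons b r)
    have "word_elt ?w = word_elt ((a + 1) # replicate (k - 1) 2 @ (b + 1) # r)"
      using e by (simp add: Cons word_elt_replicate mult.assoc alphap_block)
    then have "psl_conj (word_elt ?w) (word_elt ((a + 1) # replicate (k - 1) 2 @ (b + 1) # r))"
      by (simp only: psl_conj_refl)
    moreover have "shorter ((a + 1) # replicate (k - 1) 2 @ (b + 1) # r) ?w"
      unfolding shorter_def by (intro disjI1) (simp add: Cons)
    ultimately show ?thesis by blast
  qed
qed

lemma rotate_split: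
  assumes "m \<le> length w" "w \<noteq> []"
  shows "\<exists>rest. rotate i w = map (\<lambda>j. entry w (i + j)) [0..<m] @ rest \<and> length rest = length w - m"
proof -
  have "take m (rotate i w) = map (\<lambda>j. entry w (i + j)) [0..<m]"
    using assms by (intro nth_equalityI) (auto simp: entry_def nth_rotate)
  then show ?thesis using append_take_drop_id[of m "rotate i w"]
    by (intro exI[of _ "drop m (rotate i w)"]) auto
qed

lemma rotate_split2:
  assumes "length w \<ge> 2"
  obtains rest where "rotate i w = entry w i # entry w (i + 1) # rest"
    "\<And>b r. rest = b # r \<Longrightarrow> b = entry w (i + 2)" "rest = [] \<Longrightarrow> length w = 2"
proof -
  have w: "w \<noteq> []" using assms by auto
  obtain rest where r: "rotate i w = map (\<lambda>j. entry w (i + j)) [0..<2] @ rest" "length rest = length w - 2"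
    using rotate_split[OF assms w] by blast
  have r2: "rotate i w = entry w i # entry w (i + 1) # rest"
    using r(1) by (simp add: upt_rec)
  show ?thesis
  proof (rule that[OF r2])
    fix b r' assume "rest = b # r'"
    then have "rotate i w ! 2 = b" "length w > 2" using r2 r(2) assms by auto
    then show "b = entry w (i + 2)" by (simp add: nth_rotate entry_def)
  qed (use r(2) assms in auto)
qed

text \<open>The cyclic word of entries -1 only is set apart because it violates normality without
  being shortened by any of the moves.\<close>

lemma shorten:
  assumes w: "w \<noteq> []" and hyp: "psl_hyperbolic (word_elt w)" and nn: "\<not> cyc_normal w"
    and m1: "w \<noteq> replicate (length w) (-1)"
  shows "\<exists>w'. psl_conj (word_elt w) (word_elt w') \<and> shorter w' w"
proof -
  have rot: "\<exists>w'. psl_conj (word_elt w) (word_elt w') \<and> shorter w' w"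
    if "\<exists>w'. psl_conj (word_elt (rotate i w)) (word_elt w') \<and> shorter w' (rotate i w)" for i
    using that word_elt_rotate[of w i] psl_conj_trans by (metis shorter_rotate)
  have hypr: "psl_hyperbolic (word_elt (rotate i w))" for i
    using hyp psl_conj_hyperbolic[OF word_elt_rotate] by blast
  show ?thesis
  proof (cases "length w = 1")
    case True
    then obtain k where k: "w = [k]" by (cases w) auto
    have "k \<noteq> 0" "k \<noteq> 1" "k \<noteq> -1"
      using hyp m1 by (auto simp: k psl_compute psl_hyperbolic_of)
    then have "cyc_normal w" by (simp add: cyc_normal_def k entry_def)
    with nn show ?thesis by blast
  next
    case False
    then have len: "length w \<ge> 2" using w by (cases w; cases "tl w") auto
    consider (i) i where "entry w (i + 1) = 1" "entry w i \<ge> 1 \<or> entry w (i + 2) \<ge> 1"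
      | (ii) i where "entry w (i + 1) = 0" "entry w i = 0 \<or> entry w (i + 2) = 0 \<or> entry w i \<le> -1 \<and> entry w (i + 2) \<le> -1"
      | (iii) i k where "k \<ge> 1" "entry w i = 0" "\<forall>j\<in>{1..k}. entry w (i + j) = -1" "entry w (i + k + 1) = 0"
          "\<forall>i. entry w (i + 1) = 0 \<longrightarrow> \<not> (entry w i = 0 \<or> entry w (i + 2) = 0 \<or> entry w i \<le> -1 \<and> entry w (i + 2) \<le> -1)"
    proof -
      have "\<exists>i. entry w (i + 1) = 1 \<and> (entry w i \<ge> 1 \<or> entry w (i + 2) \<ge> 1)"
        if "\<not> (\<forall>i. entry w (i + 1) = 1 \<longrightarrow> entry w i \<le> 0 \<and> entry w (i + 2) \<le> 0)"
        using that by force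
      moreover have "\<exists>i. entry w (i + 1) = 0 \<and> (entry w i = 0 \<or> entry w (i + 2) = 0 \<or> entry w i \<le> -1 \<and> entry w (i + 2) \<le> -1)"
        if "\<not> (\<forall>i. entry w (i + 1) = 0 \<longrightarrow>
        (entry w i \<le> -1 \<and> entry w (i + 2) \<ge> 1) \<or>
        (entry w i \<ge> 1 \<and> entry w (i + 2) \<le> -1) \<or>
        (entry w i \<ge> 1 \<and> entry w (i + 2) \<ge> 1))"
      proof -
        from that obtain i where "entry w (i + 1) = 0" "\<not> ((entry w i \<le> -1 \<and> entry w (i + 2) \<ge> 1) \<or>
        (entry w i \<ge> 1 \<and> entry w (i + 2) \<le> -1) \<or>
        (entry w i \<ge> 1 \<and> entry w (i + 2) \<ge> 1))" by blast
        then show ?thesis by (intro exI[of _ i]) (simp, linarith)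
      qed
      ultimately show thesis using nn w m1 that unfolding cyc_normal_def by blast
    qed
    then show ?thesis
    proof cases
      case i
      obtain rest where r: "rotate i w = entry w i # entry w (i + 1) # rest"
        "\<And>b r. rest = b # r \<Longrightarrow> b = entry w (i + 2)" "rest = [] \<Longrightarrow> length w = 2"
        using rotate_split2[OF len] by metis
      have "entry w i \<ge> 1 \<or> (\<exists>b r. rest = b # r \<and> b \<ge> 1)"
      proof (cases rest)
        case Nil
        then have "entry w (i + 2) = entry w i" using r(3) entry_add_length[of w i] by simp
        with i show ?thesis by auto
      next
        case (Cons b r')
        with i r(2) show ?thesis by auto
      qed
      from shorten_1[OF this] show ?thesis by (intro rot[of i]) (simp only: r(1) i(1))
    next
      case ii
      obtain rest where r: "rotate i w = entry w i # entry w (i + 1) # rest"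
        "\<And>b r. rest = b # r \<Longrightarrow> b = entry w (i + 2)"
        using rotate_split2[OF len] by metis
      obtain rest' where r': "rotate (i + 1) w = entry w (i + 1) # entry w (i + 2) # rest'"
        using rotate_split2[OF len, of "i + 1"] by (metis add.assoc one_add_one)
      consider "entry w i = 0" | "entry w (i + 2) = 0" | "entry w i \<le> -1" "entry w (i + 2) \<le> -1" using ii by blast
      then show ?thesis
      proof cases
        case 1
        show ?thesis using shorten_0_0[of rest] hypr[of i] by (intro rot[of i]) (simp only: r(1) ii(1) 1)
      next
        case 2
        show ?thesis using shorten_0_0[of rest'] hypr[of "i + 1"]
          by (intro rot[of "i + 1"]) (simp only: r' ii(1) 2)
      next
        case 3
        have "\<exists>w'. psl_conj (word_elt (entry w i # 0 # rest)) (word_elt w') \<and> shorter w' (entry w i # 0 # rest)"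
          by (rule shorten_0) (use hypr[of i] 3 r ii(1) in auto)
        then show ?thesis by (intro rot[of i]) (simp only: r(1) ii(1))
      qed
    next
      case iii
      define n where "n = length w"
      have ent_n: "entry w (j + n) = entry w j" for j unfolding n_def by (rule entry_add_length)
      \<comment> \<open>The move uses the entry before the first zero, so the pattern must occupy k
        + 3 distinct positions. In a shorter cycle the two zeros would coincide or be adjacent,
        which contradicts the last clause of case \<open>iii\<close>.\<close>
      have n: "n \<ge> k + 3"
      proof -
        have "n > k"
        proof (rule ccontr)
          assume "\<not> n > k"
          then have "n \<in> {1..k}" using w by (cases w) (auto simp: n_def)
          then have "entry w (i + n) = -1" using iii(3) by blast
          then show False using ent_n iii(2) by simp
        qed
        moreover have "n \<noteq> k + 1"
        proof
          assume n: "n = k + 1"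
          have "entry w (i + k + 2) = entry w (i + 1)" using ent_n[of "i + 1"] by (simp add: n add_ac)
          then have "entry w (i + k) = -1" "entry w (i + k + 2) = -1"
            using iii(1) iii(3)[rule_format, of 1] iii(3)[rule_format, of k] by auto
          then show False using iii(4) iii(5)[rule_format, of "i + k"] by (auto simp: add_ac)
        qed
        moreover have "n \<noteq> k + 2"
        proof
          assume n: "n = k + 2"
          have "entry w (i + k + 2) = entry w i" using ent_n[of "i"] by (simp add: n add_ac)
          then show False using iii(2,4) iii(5)[rule_format, of "i + k"] by (auto simp: add_ac)
        qed
        ultimately show ?thesis by linarith
      qed
      \<comment> \<open>Cyclically this is i - 1; the summand n avoids a truncated subtraction at i
        = 0.\<close>
      define p where "p = i + n - 1"
      have p: "p + 1 = i + n" using n by (simp add: p_def)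
      obtain rest where r: "rotate p w = map (\<lambda>j. entry w (p + j)) [0..<k + 3] @ rest"
        using rotate_split[OF n[unfolded n_def] w] by blast
      have "map (\<lambda>j. entry w (p + j)) [0..<k + 3] = entry w p # 0 # replicate k (-1) @ [0]"
      proof (rule nth_equalityI)
        fix j assume "j < length (map (\<lambda>j. entry w (p + j)) [0..<k + 3])"
        then have j: "j < k + 3" by simp
        have e: "entry w (p + Suc m) = entry w (i + m)" for m
        proof -
          have "p + Suc m = i + m + n" using p by simp
          then show ?thesis using ent_n[of "i + m"] by (simp only:)
        qed
        consider "j = 0" | "j = 1" | m where "j = m + 2" "m < k" | "j = k + 2" using j
          by (metis One_nat_def Suc_1 add_2_eq_Suc' add_Suc_right less_2_cases less_SucE not_less_eq numeral_3_eq_3 old.nat.exhaust plus_nat.add_0)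
        then show "map (\<lambda>j. entry w (p + j)) [0..<k + 3] ! j = (entry w p # 0 # replicate k (-1) @ [0]) ! j"
        proof cases
          case 3
          have "entry w (i + (m + 1)) = -1" using iii(3)[rule_format, of "m + 1"] 3 by simp
          then show ?thesis using j 3 e[of "m + 1"] by (simp add: nth_append del: upt_Suc)
        next
          case 4
          then show ?thesis using j e[of "k + 1"] iii(4) by (simp add: nth_append add_ac del: upt_Suc)
        qed (use j e[of 0] iii(2) in \<open>simp_all del: upt_Suc\<close>)
      qed simp
      then have "rotate p w = entry w p # 0 # replicate k (-1) @ 0 # rest" using r by simp
      then show ?thesis using shorten_minus_1s[OF iii(1), of "entry w p" rest] by (intro rot[of p]) simp
    qed
  qed
qed

lemma entry_replicate: "n > 0 \<Longrightarrow> entry (replicate n k) i = k"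
  by (simp add: entry_def)

lemma cyc_normal_replicate_2: "n > 0 \<Longrightarrow> cyc_normal (replicate n 2)"
  unfolding cyc_normal_def by (auto simp: entry_replicate dest: arg_cong[of _ _ hd])

theorem normal_word_exists:
  assumes "psl_hyperbolic g" "psl_even g"
  shows "\<exists>w. cyc_normal w \<and> psl_conj (word_elt w) g"
proof -
  have "\<exists>v. cyc_normal v \<and> psl_conj (word_elt v) g" if "psl_conj (word_elt w) g" for w
    using that
  proof (induction w rule: wf_induct[OF wf_measures[of "[length, \<lambda>w. nat (abs_sum w)]"]])
    case (1 w)
    have hyp: "psl_hyperbolic (word_elt w)" using psl_conj_hyperbolic[OF 1(2)] assms by simp
    then have w: "w \<noteq> []" by (auto simp: psl_one psl_hyperbolic_of)
    consider "cyc_normal w" | "w = replicate (length w) (-1)" | "\<not> cyc_normal w" "w \<noteq> replicate (length w) (-1)"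
      by blast
    then show ?case
    proof cases
      case 2
      let ?x = "psl_rho * psl_sigma"
      have "word_elt w = block (-1) ^ length w" by (subst 2) (simp only: word_elt_replicate)
      also have "\<dots> = ?x * word_elt (replicate (length w) 2) * inverse ?x"
        by (simp only: block_minus_1 psl_conj_power word_elt_replicate)
      finally have "psl_conj (word_elt (replicate (length w) 2)) (word_elt w)"
        unfolding psl_conj_def by (intro exI[of _ ?x]) (simp add: psl_even_mult_iff)
      then show ?thesis using cyc_normal_replicate_2[of "length w"] w 1(2) psl_conj_trans by blast
    next
      case 3
      obtain w' where w': "psl_conj (word_elt w) (word_elt w')" "shorter w' w"
        using shorten[OF w hyp 3] by blast
      have "(w', w) \<in> measures [length, \<lambda>w. nat (abs_sum w)]"
        using w'(2) abs_sum_nonneg[of w'] by (auto simp: shorter_def)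
      moreover have "psl_conj (word_elt w') g" using w'(1) 1(2) psl_conj_sym psl_conj_trans by blast
      ultimately show ?thesis using 1(1) by blast
    qed (use 1(2) in blast)
  qed
  then show ?thesis using hyperbolic_conj_word[OF assms] by blast
qed

section \<open>Conjugate positive words\<close>

lift_definition rows_same_sign :: "psl2z \<Rightarrow> bool" is "\<lambda>(a, b, c, d). a * b \<ge> 0 \<and> c * d \<ge> 0"
  by (auto simp: psl_rel_def)

lift_definition cols_same_sign :: "psl2z \<Rightarrow> bool" is "\<lambda>(a, b, c, d). a * c \<ge> 0 \<and> b * d \<ge> 0"
  by (auto simp: psl_rel_def)

lemma rows_same_sign_of: "a * d - b * c = 1 \<Longrightarrow>
    rows_same_sign (psl_of (a, b, c, d)) \<longleftrightarrow> a * b \<ge> 0 \<and> c * d \<ge> 0"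
  by (simp add: psl_of_def rows_same_sign.abs_eq psl_rel_def)

lemma cols_same_sign_of: "a * d - b * c = 1 \<Longrightarrow>
    cols_same_sign (psl_of (a, b, c, d)) \<longleftrightarrow> a * c \<ge> 0 \<and> b * d \<ge> 0"
  by (simp add: psl_of_def cols_same_sign.abs_eq psl_rel_def)

text \<open>After a change of sign to a > 0, the conditions give b, c >= 0, and then ad = 1 + bc
  gives d >= 0. If a = 0, then b and c are 1 and -1 in some order and d must vanish: this is the
  excluded involution.\<close>

lemma same_sign_imp_nonneg:
  assumes "rows_same_sign g" "cols_same_sign g" "g \<noteq> psl_of (0, 1, -1, 0)"
  shows "psl_nonneg g"
proof -
  obtain a b c d where g: "g = psl_of (a, b, c, d)" and det: "a * d - b * c = 1" by (rule psl_cases)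
  have ss: "a * b \<ge> 0" "c * d \<ge> 0" "a * c \<ge> 0" "b * d \<ge> 0"
    using assms(1,2) by (auto simp: g rows_same_sign_of[OF det] cols_same_sign_of[OF det])
  have pos: "psl_nonneg (psl_of (a, b, c, d))"
    if "a * d - b * c = 1" "a > 0" "a * b \<ge> 0" "c * d \<ge> 0" "a * c \<ge> 0" "b * d \<ge> 0" for a b c d :: int
  proof -
    have bc: "b \<ge> 0" "c \<ge> 0" using that by (auto simp: zero_le_mult_iff)
    have "d \<ge> 0"
    proof (rule ccontr)
      assume "\<not> d \<ge> 0"
      then have "a * d < 0" using that by (simp add: mult_less_0_iff)
      moreover have "b * c \<ge> 0" using bc by simp
      ultimately show False using that(1) by linarith
    qed
    then show ?thesis unfolding psl_nonneg_def using bc that by (intro exI[of _ a] exI[of _ b] exI[of _ c] exI[of _ d]) auto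
  qed
  consider "a > 0" | "a < 0" | "a = 0" by linarith
  then show ?thesis
  proof cases
    case 1
    then show ?thesis using pos det ss by (simp add: g)
  next
    case 2
    then have "psl_nonneg (psl_of (-a, -b, -c, -d))" using det ss by (intro pos) auto
    then show ?thesis using psl_of_neg[of "(a, b, c, d)"] det by (simp add: g)
  next
    case 3
    then have "b * (- c) = 1" using det by simp
    then have bc: "b = 1 \<and> c = -1 \<or> b = -1 \<and> c = 1" using zmult_eq_1_iff[of b "-c"] by auto
    then have "d = 0" using ss by auto
    then have "g = psl_of (0, 1, -1, 0)" using bc 3 by (auto simp: g psl_of_eq_iff)
    with assms(3) show ?thesis by blast
  qed
qed

text \<open>Multiplying a row with entries of opposite signs by a letter decreases the sum of the
  absolute values of its entries.\<close>

lemma row_descent: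
  fixes a b :: int
  assumes "a * b < 0"
  shows "a * (a + b) \<ge> 0 \<or> \<bar>a\<bar> + \<bar>a + b\<bar> < \<bar>a\<bar> + \<bar>b\<bar>"
    "(a + b) * b \<ge> 0 \<or> \<bar>a + b\<bar> + \<bar>b\<bar> < \<bar>a\<bar> + \<bar>b\<bar>"
  using assms by (auto simp: mult_less_0_iff zero_le_mult_iff abs_if)

text \<open>The effect of right multiplication by a letter on a single row of a matrix.\<close>

fun row_act :: "int \<times> int \<Rightarrow> bool \<Rightarrow> int \<times> int" where
  "row_act (a, b) x = (if x then (a, a + b) else (a + b, b))"

lemma row_act_same_sign:
  assumes "a * b \<ge> 0" "foldl row_act (a, b) l = (a', b')"
  shows "a' * b' \<ge> 0"
  using assms
proof (induction l arbitrary: a b)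
  case (Cons x l)
  have "a * (a + b) \<ge> 0" "(a + b) * b \<ge> 0" using Cons.prems(1) by (auto simp: algebra_simps)
  then show ?case using Cons.IH[of a "a + b"] Cons.IH[of "a + b" b] Cons.prems(2) by (auto split: if_splits)
qed auto

lemma row_act_eventually_same_sign:
  assumes "int (length l) \<ge> \<bar>a\<bar> + \<bar>b\<bar>" "foldl row_act (a, b) l = (a', b')"
  shows "a' * b' \<ge> 0"
  using assms
proof (induction l arbitrary: a b)
  case (Cons x l)
  show ?case
  proof (cases "a * b \<ge> 0")
    case True
    then show ?thesis using row_act_same_sign Cons.prems(2) by blast
  next
    case False
    then have neg: "a * b < 0" by simp
    have len: "int (length l) + 1 \<ge> \<bar>a\<bar> + \<bar>b\<bar>" using Cons.prems(1) by simp
    show ?thesis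
    proof (cases x)
      case True
      then have f: "foldl row_act (a, a + b) l = (a', b')" using Cons.prems(2) by simp
      from row_descent(1)[OF neg] show ?thesis
      proof
        assume "a * (a + b) \<ge> 0"
        then show ?thesis by (rule row_act_same_sign[OF _ f])
      next
        assume "\<bar>a\<bar> + \<bar>a + b\<bar> < \<bar>a\<bar> + \<bar>b\<bar>"
        with len have "int (length l) \<ge> \<bar>a\<bar> + \<bar>a + b\<bar>" by linarith
        then show ?thesis by (rule Cons.IH[OF _ f])
      qed
    next
      case x: False
      then have f: "foldl row_act (a + b, b) l = (a', b')" using Cons.prems(2) by simp
      from row_descent(2)[OF neg] show ?thesis
      proof
        assume "(a + b) * b \<ge> 0"
        then show ?thesis by (rule row_act_same_sign[OF _ f])
      next
        assume "\<bar>a + b\<bar> + \<bar>b\<bar> < \<bar>a\<bar> + \<bar>b\<bar>"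
        with len have "int (length l) \<ge> \<bar>a + b\<bar> + \<bar>b\<bar>" by linarith
        then show ?thesis by (rule Cons.IH[OF _ f])
      qed
    qed
  qed
qed auto

lemma psl_of_mult_lr_word:
  assumes "a * d - b * c = 1"
  shows "\<exists>a' b' c' d'. psl_of (a, b, c, d) * lr_word l = psl_of (a', b', c', d') \<and> a' * d' - b' * c' = 1 \<and>
    foldl row_act (a, b) l = (a', b') \<and> foldl row_act (c, d) l = (c', d')"
  using assms
proof (induction l arbitrary: a b c d)
  case (Cons x l)
  show ?case
  proof (cases x)
    case True
    have "psl_of (a, b, c, d) * lr_letter x = psl_of (a, a + b, c, c + d)"
      using True Cons.prems by (simp add: lr_letter_def psl_of_mult)
    then show ?thesis using Cons.IH[of a "c + d" "a + b" c] Cons.prems True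
      by (simp add: mult.assoc[symmetric] algebra_simps)
  next
    case False
    have "psl_of (a, b, c, d) * lr_letter x = psl_of (a + b, b, c + d, d)"
      using False Cons.prems by (simp add: lr_letter_def psl_of_mult)
    then show ?thesis using Cons.IH[of "a + b" d b "c + d"] Cons.prems False
      by (simp add: mult.assoc[symmetric] algebra_simps)
  qed
qed auto

lemma eventually_rows_same_sign:
  "\<exists>N. \<forall>l. length l \<ge> N \<longrightarrow> rows_same_sign (g * lr_word l)"
proof -
  obtain a b c d where g: "g = psl_of (a, b, c, d)" and det: "a * d - b * c = 1" by (rule psl_cases)
  have "rows_same_sign (g * lr_word l)" if "length l \<ge> nat (\<bar>a\<bar> + \<bar>b\<bar> + \<bar>c\<bar> + \<bar>d\<bar>)" for l
  proof -
    obtain a' b' c' d' where 1: "psl_of (a, b, c, d) * lr_word l = psl_of (a', b', c', d')" "a' * d' - b' * c' = 1"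
      "foldl row_act (a, b) l = (a', b')" "foldl row_act (c, d) l = (c', d')"
      using psl_of_mult_lr_word[OF det] by blast
    show ?thesis unfolding g 1(1) rows_same_sign_of[OF 1(2)]
      using row_act_eventually_same_sign[OF _ 1(3)] row_act_eventually_same_sign[OF _ 1(4)] that by linarith
  qed
  then show ?thesis by blast
qed

text \<open>Transposition exchanges the two letters and reverses products, which turns the statement on
  rows into one on columns.\<close>

lift_definition psl_transpose :: "psl2z \<Rightarrow> psl2z" is "\<lambda>(a, b, c, d). (a, c, b, d)"
  by (auto simp: psl_rel_def mult.commute)

lemma psl_transpose_mult: "psl_transpose (g * h) = psl_transpose h * psl_transpose g"
  by transfer (auto simp: psl_rel_def algebra_simps)

lemma psl_transpose_one: "psl_transpose 1 = 1"
  by transfer (auto simp: psl_rel_def)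

lemma psl_transpose_of: "a * d - b * c = 1 \<Longrightarrow> psl_transpose (psl_of (a, b, c, d)) = psl_of (a, c, b, d)"
  by (simp add: psl_of_def psl_transpose.abs_eq psl_rel_def)

lemma psl_transpose_letter: "psl_transpose (lr_letter x) = lr_letter (\<not> x)"
  by (simp add: lr_letter_def psl_transpose_of)

lemma psl_transpose_word: "psl_transpose (lr_word l) = lr_word (rev (map Not l))"
  by (induction l) (auto simp: psl_transpose_mult psl_transpose_one psl_transpose_letter)

lemma cols_same_sign_transpose: "cols_same_sign g = rows_same_sign (psl_transpose g)"
  by transfer auto

lemma eventually_cols_same_sign:
  "\<exists>N. \<forall>l. length l \<ge> N \<longrightarrow> cols_same_sign (lr_word l * g)"
proof -
  obtain N where N: "\<And>l. length l \<ge> N \<Longrightarrow> rows_same_sign (psl_transpose g * lr_word l)"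
    using eventually_rows_same_sign by blast
  have "cols_same_sign (lr_word l * g)" if "length l \<ge> N" for l
    using N[of "rev (map Not l)"] that by (simp add: cols_same_sign_transpose psl_transpose_mult psl_transpose_word)
  then show ?thesis by blast
qed

lemma lr_word_nonneg: "psl_nonneg (lr_word l)"
proof (induction l)
  case Nil
  show ?case unfolding psl_nonneg_def
    by (rule exI[of _ 1], rule exI[of _ 0], rule exI[of _ 0], rule exI[of _ 1]) (simp add: psl_one)
next
  case (Cons x l)
  then obtain a b c d where n: "lr_word l = psl_of (a, b, c, d)" "a * d - b * c = 1" "a \<ge> 0" "b \<ge> 0" "c \<ge> 0" "d \<ge> 0"
    by (auto simp: psl_nonneg_def)
  have "lr_word (x # l) = (if x then psl_of (a + c, b + d, c, d) else psl_of (a, b, a + c, b + d))"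
    using n by (simp add: lr_letter_def psl_of_mult)
  moreover have "(a + c) * d - (b + d) * c = 1" "a * (b + d) - b * (a + c) = 1"
    using n(2) by (simp_all add: algebra_simps)
  ultimately show ?case using n(3-6) unfolding psl_nonneg_def
    by (cases x) (simp_all, (metis add_nonneg_nonneg)+)
qed

lemma psl_of_nonneg_inject:
  assumes "psl_of (a, b, c, d) = psl_of (p, q, r, s)" "a * d - b * c = 1" "p * s - q * r = 1"
    "a \<ge> 0" "b \<ge> 0" "c \<ge> 0" "d \<ge> 0" "p \<ge> 0" "q \<ge> 0" "r \<ge> 0" "s \<ge> 0"
  shows "a = p \<and> b = q \<and> c = r \<and> d = s"
  using assms psl_of_eq_iff[of "(a, b, c, d)" "(p, q, r, s)"] by auto

lemma lr_word_Cons_cases: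
  obtains a b c d where "lr_word (x # l) = psl_of (a, b, c, d)" "a * d - b * c = 1" "a \<ge> 0" "b \<ge> 0" "c \<ge> 0" "d \<ge> 0"
    "if x then a \<ge> c \<and> b \<ge> d else c \<ge> a \<and> d \<ge> b"
proof -
  obtain a b c d where n: "lr_word l = psl_of (a, b, c, d)" "a * d - b * c = 1" "a \<ge> 0" "b \<ge> 0" "c \<ge> 0" "d \<ge> 0"
    using lr_word_nonneg[of l] by (auto simp: psl_nonneg_def)
  have det: "(a + c) * d - (b + d) * c = 1" "a * (b + d) - b * (a + c) = 1"
    using n(2) by (simp_all add: algebra_simps)
  show ?thesis
  proof (cases x)
    case True
    then have "lr_word (x # l) = psl_of (a + c, b + d, c, d)"
      using n by (simp add: lr_letter_def psl_of_mult)
    then show ?thesis by (rule that) (use det n True in auto)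
  next
    case False
    then have "lr_word (x # l) = psl_of (a, b, a + c, b + d)"
      using n by (simp add: lr_letter_def psl_of_mult)
    then show ?thesis by (rule that) (use det n False in auto)
  qed
qed

lemma lr_word_ne_one: "l \<noteq> [] \<Longrightarrow> lr_word l \<noteq> 1"
proof
  assume "l \<noteq> []" "lr_word l = 1"
  then obtain x l' where l: "l = x # l'" by (cases l) auto
  obtain a b c d where *: "lr_word (x # l') = psl_of (a, b, c, d)" "a * d - b * c = 1" "a \<ge> 0" "b \<ge> 0" "c \<ge> 0" "d \<ge> 0"
    "if x then a \<ge> c \<and> b \<ge> d else c \<ge> a \<and> d \<ge> b" by (rule lr_word_Cons_cases)
  have "psl_of (a, b, c, d) = psl_of (1, 0, 0, 1)" using * \<open>lr_word l = 1\<close> l psl_one by metis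
  from psl_of_nonneg_inject[OF this] * show False by (auto split: if_splits)
qed

text \<open>The first letter shows in the matrix: it tells which row dominates the other. If both
  letters were possible, the rows would be equal and the determinant 0.\<close>

lemma lr_word_inject: "lr_word l = lr_word l' \<Longrightarrow> l = l'"
proof (induction l arbitrary: l')
  case Nil
  then show ?case using lr_word_ne_one by (metis lr_word_simps(1))
next
  case (Cons x l)
  obtain y l2 where l': "l' = y # l2" using Cons.prems lr_word_ne_one
    by (metis list.exhaust lr_word_simps(1) list.discI)
  have "x = y"
  proof (rule ccontr)
    assume "x \<noteq> y"
    obtain a b c d where 1: "lr_word (x # l) = psl_of (a, b, c, d)" "a * d - b * c = 1" "a \<ge> 0" "b \<ge> 0" "c \<ge> 0" "d \<ge> 0"
      "if x then a \<ge> c \<and> b \<ge> d else c \<ge> a \<and> d \<ge> b" by (rule lr_word_Cons_cases)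
    obtain p q r s where 2: "lr_word (y # l2) = psl_of (p, q, r, s)" "p * s - q * r = 1" "p \<ge> 0" "q \<ge> 0" "r \<ge> 0" "s \<ge> 0"
      "if y then p \<ge> r \<and> q \<ge> s else r \<ge> p \<and> s \<ge> q" by (rule lr_word_Cons_cases)
    have "psl_of (a, b, c, d) = psl_of (p, q, r, s)" using 1 2 Cons.prems l' by simp
    from psl_of_nonneg_inject[OF this 1(2) 2(2) 1(3-6) 2(3-6)] have "a = c" "b = d"
      using 1(7) 2(7) \<open>x \<noteq> y\<close> by (auto split: if_splits)
    then show False using 1(2) by (simp add: mult.commute)
  qed
  then show ?case using Cons l' by simp
qed

lemma lr_word_concat_replicate: "lr_word (concat (replicate n l)) = lr_word l ^ n"
  by (induction n) auto

lemma length_concat_replicate: "length (concat (replicate n l)) = n * length l"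
  by (induction n) auto

lemma conj_intertwines_power:
  fixes h x y :: psl2z
  assumes "h * x = y * h"
  shows "h * x ^ n = y ^ n * h"
  by (induction n) (simp_all add: mult.assoc[symmetric] assms, simp add: mult.assoc assms)

text \<open>The element h u^n = u'^n h ends in a long positive word and begins with one. The former
  aligns the signs in its rows, the latter those in its columns, so for large n it is a positive
  word q. The relation h u = u' h becomes q u = u' q in a free monoid.\<close>

theorem conjugate_lr_words:
  assumes "u \<noteq> []" "u' \<noteq> []" "h * lr_word u = lr_word u' * h"
  shows "\<exists>q n. h * lr_word u ^ n = lr_word q \<and> q @ u = u' @ q"
proof -
  obtain N where N: "\<And>l. length l \<ge> N \<Longrightarrow> rows_same_sign (h * lr_word l)"
    using eventually_rows_same_sign by blast
  obtain M where M: "\<And>l. length l \<ge> M \<Longrightarrow> cols_same_sign (lr_word l * h)"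
    using eventually_cols_same_sign by blast
  have *: "h * lr_word u ^ n = lr_word u' ^ n * h" for n
    by (rule conj_intertwines_power[OF assms(3)])
  have ss: "rows_same_sign (h * lr_word u ^ n) \<and> cols_same_sign (h * lr_word u ^ n)" if n: "n \<ge> N + M" for n
  proof -
    have "length u \<ge> 1" "length u' \<ge> 1" using assms by (cases u; cases u'; simp)+
    then have "n * length u \<ge> n * 1" "n * length u' \<ge> n * 1" by (intro mult_le_mono2; simp)+
    then have "length (concat (replicate n u)) \<ge> N" "length (concat (replicate n u')) \<ge> M"
      using n unfolding length_concat_replicate by linarith+
    then show ?thesis using N M * by (metis lr_word_concat_replicate)
  qed
  have "\<exists>n. psl_nonneg (h * lr_word u ^ n)"
  proof (rule ccontr)
    assume "\<not> ?thesis"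
    then have "h * lr_word u ^ n = psl_of (0, 1, -1, 0)" if "n \<ge> N + M" for n
      using same_sign_imp_nonneg ss[OF that] by blast
    \<comment> \<open>If all large n were exceptional, two consecutive ones would give the same
      element, and cancellation would yield \<open>lr_word u = 1\<close>.\<close>
    from this[of "N + M"] this[of "Suc (N + M)"] have "h * lr_word u ^ (N + M) * lr_word u = h * lr_word u ^ (N + M) * 1"
      by (simp del: power_Suc add: power_Suc2 mult.assoc[symmetric])
    then show False using lr_word_ne_one[OF assms(1)] by (simp only: psl_mult_cancel)
  qed
  then obtain n q where q: "h * lr_word u ^ n = lr_word q" using psl_nonneg_imp_lr_word by blast
  have "lr_word (q @ u) = h * lr_word u * lr_word u ^ n" by (simp add: q[symmetric] mult.assoc power_commutes)
  also have "\<dots> = lr_word (u' @ q)" by (simp add: assms(3) q[symmetric] mult.assoc)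
  finally show ?thesis using q lr_word_inject by blast
qed

text \<open>A word q longer than u' starts with u', which can be stripped off while preserving the
  equation. Once q is no longer than u', it is a prefix of u', and the remainder exhibits the
  rotation.\<close>

lemma append_commute_rotate:
  assumes "q @ u = u' @ q" "u' \<noteq> []"
  shows "\<exists>m. u' = rotate m u"
  using assms
proof (induction q rule: length_induct)
  case (1 q)
  have len: "length u = length u'" using arg_cong[OF 1(2), of length] by simp
  show ?case
  proof (cases "length q \<le> length u'")
    case True
    define r where "r = drop (length q) u'"
    have "take (length q) (q @ u) = q" by simp
    then have "take (length q) u' = q" using True by (simp add: 1(2))
    then have r: "u' = q @ r" unfolding r_def by (metis append_take_drop_id)
    then have r: "u' = q @ r" "u = r @ q" using 1(2) by auto
    have "rotate (length r) u = u'" by (simp add: r rotate_append)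
    then show ?thesis by metis
  next
    case False
    define q2 where "q2 = drop (length u') q"
    have "take (length u') (q @ u) = u'" by (simp add: 1(2))
    then have "take (length u') q = u'" using False by simp
    then have q2: "q = u' @ q2" unfolding q2_def by (metis append_take_drop_id)
    then have "q2 @ u = u' @ q2" "length q2 < length q" using 1(2) 1(3) by auto
    then show ?thesis using 1 by blast
  qed
qed

section \<open>Coding normal words by positive words\<close>

text \<open>The closed word of a normal word is cut into pairs \<open>(x, y)\<close>, standing for
  \<open>pair_elt (x, y)\<close>, with a label that tells whether the pair belongs to a positive
  entry.\<close>

type_synonym labelled = "(bool \<times> bool) \<times> bool"

definition contrib :: "int \<Rightarrow> int \<Rightarrow> int \<Rightarrow> labelled list" where
  "contrib a k c = (
    if k \<ge> 1 then
      if a \<ge> 1 then ((False, True), True) # replicate (nat (k - 2)) ((True, True), True)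
      else replicate (nat (k - 1)) ((True, True), True)
    else
      (if a \<ge> 1 then [((True, c < 1 \<and> k = 0), False)] else []) @
      (if c \<ge> 1 \<or> k = 0 then replicate (nat (- k)) ((False, False), False)
       else replicate (nat (- k - 1)) ((False, False), False) @ [((False, True), False)]))"

text \<open>The letter \<open>inverse psl_sigma\<close> arises where two blocks of positive entries meet, as
  \<open>psl_sigma * psl_sigma\<close>, and \<open>inverse psl_rho\<close> where two blocks of nonpositive entries meet. Such a
  letter is assigned to the second block, and \<open>offset\<close> is the resulting displacement of the cut.\<close>

definition offset :: "int \<Rightarrow> int \<Rightarrow> psl2z" where
  "offset a b = (if a \<ge> 1 then psl_sigma else if b \<ge> 1 then 1 else inverse psl_rho)"

text \<open>The first two clauses are the local normality conditions at \<open>k\<close>. The last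
  two are what those conditions at the preceding entry \<open>a\<close> imply for the pair (a,
  k).\<close>

definition window_ok :: "int \<Rightarrow> int \<Rightarrow> int \<Rightarrow> bool" where
  "window_ok a k c \<longleftrightarrow> (k = 1 \<longrightarrow> a \<le> 0 \<and> c \<le> 0) \<and>
     (k = 0 \<longrightarrow> (a \<le> -1 \<and> c \<ge> 1) \<or> (a \<ge> 1 \<and> c \<le> -1) \<or> (a \<ge> 1 \<and> c \<ge> 1)) \<and> (a = 1 \<longrightarrow> k \<le> 0) \<and> (a = 0 \<longrightarrow> k \<noteq> 0)"

definition prod_pairs :: "labelled list \<Rightarrow> psl2z" where
  "prod_pairs l = prod_list (map (pair_elt \<circ> fst) l)"

lemma prod_pairs_simps [simp]:
  "prod_pairs [] = 1" "prod_pairs (q # l) = pair_elt (fst q) * prod_pairs l"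
  "prod_pairs (l @ l') = prod_pairs l * prod_pairs l'"
  "prod_pairs (replicate n q) = pair_elt (fst q) ^ n"
  by (simp_all add: prod_pairs_def)

text \<open>Substituting alpha = sigma rho^-1 makes the power of alpha alternate in rho and sigma. A
  positive entry begins and ends with sigma, a nonpositive one with rho, so letters merge only where
  entries of the same kind meet.\<close>

lemma block_pos: "block (int n + 1) = (psl_sigma * inverse psl_rho) ^ n * psl_sigma"
proof (induction n)
  case (Suc n)
  have "block (int (Suc n) + 1) = alphap 1 * block (int n + 1)" by (simp add: alphap_block)
  also have "alphap 1 = psl_sigma * inverse psl_rho" by (simp add: psl_compute)
  finally show ?case by (simp add: Suc mult.assoc)
qed (simp add: block_0_1)

lemma block_neg: "block (- int n) = psl_rho * (inverse psl_sigma * psl_rho) ^ n"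
proof (induction n)
  case (Suc n)
  have "block (- int (Suc n)) = alphap (-1) * block (- int n)" by (simp add: alphap_block algebra_simps)
  also have "alphap (-1) = psl_rho * inverse psl_sigma" by (simp add: psl_compute)
  finally show ?case by (simp add: Suc mult.assoc)
qed (simp add: block_0_1)

lemma prod_contrib:
  assumes "window_ok a k c"
  shows "prod_pairs (contrib a k c) = offset a k * block k * inverse (offset k c)"
proof (cases "k \<ge> 1")
  case True
  then obtain n where k: "k = int n + 1" by (metis zero_le_imp_eq_int diff_add_cancel diff_ge_0_iff_ge)
  show ?thesis
  proof (cases "a \<ge> 1")
    case a: True
    with assms True have "n \<noteq> 0" by (auto simp: window_ok_def k)
    then obtain m where n: "n = Suc m" by (cases n) auto
    show ?thesis unfolding k block_pos using a
      by (simp add: contrib_def offset_def n nat_add_distrib pair_elt_def mult.assoc rho_sigma_rels)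
  next
    case False
    then show ?thesis unfolding k block_pos
      by (simp add: contrib_def offset_def pair_elt_def mult.assoc)
  qed
next
  case False
  define n where "n = nat (- k)"
  have k: "k = - int n" using False by (simp add: n_def)
  show ?thesis
  proof (cases n)
    case 0
    then show ?thesis using assms
      by (auto simp: k contrib_def offset_def window_ok_def block_0_1 pair_elt_def mult.assoc rho_sigma_rels)
  next
    case (Suc m)
    have "psl_rho * (inverse psl_sigma * psl_rho) ^ n * psl_rho
       = psl_rho * (inverse psl_sigma * psl_rho) ^ m * (inverse psl_sigma * inverse psl_rho)"
      unfolding Suc power_Suc2 by (simp add: mult.assoc rho_sigma_rels)
    then show ?thesis unfolding k block_neg
      by (simp add: contrib_def offset_def Suc nat_add_distrib pair_elt_def mult.assoc rho_sigma_rels)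
  qed
qed

text \<open>The window at i describes the entry i + 1, so the list starts with the contribution of
  entry 1 and its product belongs to \<open>rotate 1 w\<close>.\<close>

definition enc :: "int list \<Rightarrow> labelled list" where
  "enc w = concat (map (\<lambda>i. contrib (entry w i) (entry w (i + 1)) (entry w (i + 2))) [0..<length w])"

lemma cyc_normal_window:
  assumes "cyc_normal w"
  shows "window_ok (entry w i) (entry w (i + 1)) (entry w (i + 2))"
proof -
  have w: "w \<noteq> []" using assms by (simp add: cyc_normal_def)
  define j where "j = i + length w - 1"
  have j: "entry w (j + 1) = entry w i" "entry w (j + 2) = entry w (i + 1)"
    using w entry_add_length[of w i] entry_add_length[of w "i + 1"] by (auto simp: j_def Suc_leI)
  have 1: "entry w (i + 1) = 1 \<longrightarrow> entry w i \<le> 0 \<and> entry w (i + 2) \<le> 0" for i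
    using assms unfolding cyc_normal_def by blast
  have 0: "entry w (i + 1) = 0 \<longrightarrow>
        (entry w i \<le> -1 \<and> entry w (i + 2) \<ge> 1) \<or>
        (entry w i \<ge> 1 \<and> entry w (i + 2) \<le> -1) \<or>
        (entry w i \<ge> 1 \<and> entry w (i + 2) \<ge> 1)" for i
    using assms unfolding cyc_normal_def by blast
  show ?thesis using 1[of i] 0[of i] 1[of j] 0[of j] j unfolding window_ok_def by auto
qed

lemma telescope:
  assumes "\<And>i. i < n \<Longrightarrow> f i = Y i * B i * inverse (Y (i + 1))"
  shows "prod_list (map f [0..<n]) = Y 0 * prod_list (map B [0..<n]) * inverse (Y n :: psl2z)"
  using assms by (induction n) (auto simp: mult.assoc)

lemma prod_pairs_concat: "prod_pairs (concat ls) = prod_list (map prod_pairs ls)"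
  by (induction ls) auto

lemma prod_enc:
  assumes "cyc_normal w"
  shows "psl_conj (word_elt w) (prod_pairs (enc w))"
proof -
  let ?n = "length w"
  have w: "w \<noteq> []" using assms by (simp add: cyc_normal_def)
  define Y where "Y i = offset (entry w i) (entry w (i + 1))" for i
  have "prod_pairs (enc w) = prod_list (map (\<lambda>i. prod_pairs (contrib (entry w i) (entry w (i + 1)) (entry w (i + 2)))) [0..<?n])"
    by (simp add: enc_def prod_pairs_concat o_def)
  also have "\<dots> = Y 0 * prod_list (map (\<lambda>i. block (entry w (i + 1))) [0..<?n]) * inverse (Y ?n)"
    by (rule telescope) (simp add: Y_def prod_contrib[OF cyc_normal_window[OF assms], simplified])
  also have "Y ?n = Y 0" using entry_add_length[of w 0] entry_add_length[of w 1] by (simp add: Y_def add.commute)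
  also have "prod_list (map (\<lambda>i. block (entry w (i + 1))) [0..<?n]) = word_elt (rotate 1 w)"
  proof -
    have "map (\<lambda>i. entry w (i + 1)) [0..<?n] = rotate 1 w"
      by (rule nth_equalityI) (auto simp: entry_def nth_rotate nth_rotate1)
    then have "map (\<lambda>i. block (entry w (i + 1))) [0..<?n] = map block (rotate 1 w)"
      by (metis (no_types, lifting) map_eq_conv map_map comp_apply)
    then show ?thesis by (simp add: word_elt_def)
  qed
  finally have "psl_conj (word_elt (rotate 1 w)) (prod_pairs (enc w))"
    unfolding psl_conj_def by (intro exI[of _ "Y 0"]) (simp add: Y_def offset_def)
  then show ?thesis using word_elt_rotate psl_conj_trans by blast
qed

section \<open>Token strings of cyclic words\<close>

datatype token = CutP | CutN | Plus | Minus

definition is_cut :: "token \<Rightarrow> bool" where "is_cut x \<longleftrightarrow> x = CutP \<or> x = CutN"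

lemma is_cut_simps [simp]: "is_cut CutP" "is_cut CutN" "\<not> is_cut Plus" "\<not> is_cut Minus"
  by (simp_all add: is_cut_def)

text \<open>A code between words and labelled pairs: each entry is a cut showing its kind, followed
  by one token per unit. A positive entry counts from 1 and a nonpositive one from 0, matching sigma
  = \<open>block 1\<close> and rho = \<open>block 0\<close>.\<close>

definition blk :: "int \<Rightarrow> token list" where
  "blk k = (if k \<ge> 1 then CutP # replicate (nat (k - 1)) Plus else CutN # replicate (nat (- k)) Minus)"

definition blks :: "int list \<Rightarrow> token list" where "blks w = concat (map blk w)"

lemma blks_simps [simp]: "blks [] = []" "blks (k # w) = blk k @ blks w" "blks (v @ w) = blks v @ blks w"
  by (simp_all add: blks_def)

lemma blk_ne [simp]: "blk k \<noteq> []"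
  by (simp add: blk_def)

lemma hd_blks: "w \<noteq> [] \<Longrightarrow> is_cut (hd (blks w))"
  by (cases w) (auto simp: blk_def)

lemma blks_eq_Nil [simp]: "blks w = [] \<longleftrightarrow> w = []"
  by (cases w) auto

definition uncut :: "token list \<Rightarrow> token list" where "uncut l = takeWhile (\<lambda>x. \<not> is_cut x) l"

lemma uncut_blk_tail:
  assumes "Y = [] \<or> is_cut (hd Y)"
  shows "uncut (tl (blk k) @ Y) = tl (blk k)"
proof -
  have "uncut Y = []" using assms by (cases Y) (auto simp: uncut_def)
  moreover have "\<forall>x\<in>set (tl (blk k)). \<not> is_cut x" by (auto simp: blk_def)
  ultimately show ?thesis by (simp add: uncut_def takeWhile_append2)
qed

text \<open>The only cut of a block is its head, so the next cut shows where the block ends.\<close>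

lemma blk_append_inject:
  assumes "blk k @ X = blk j @ Y" "X = [] \<or> is_cut (hd X)" "Y = [] \<or> is_cut (hd Y)"
  shows "k = j \<and> X = Y"
proof -
  have "tl (blk k) @ X = tl (blk j) @ Y" using arg_cong[OF assms(1), of tl] by simp
  then have t: "tl (blk k) = tl (blk j)" using uncut_blk_tail assms(2,3) by metis
  have h: "hd (blk k) = hd (blk j)" using arg_cong[OF assms(1), of hd] by simp
  have "blk k = blk j" using t h by (metis blk_ne list.collapse)
  moreover from this have "k = j"
    by (auto simp: blk_def dest: arg_cong[of _ _ length] split: if_splits)
  ultimately show ?thesis using assms(1) by simp
qed

lemma blks_Cons_inject:
  assumes "blks w = blk k @ Y" "Y = [] \<or> is_cut (hd Y)"
  shows "\<exists>w'. w = k # w' \<and> blks w' = Y"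
proof (cases w)
  case Nil
  then show ?thesis using assms by simp
next
  case (Cons j w')
  then show ?thesis using blk_append_inject[of j "blks w'" k Y] assms hd_blks[of w'] by auto
qed

lemma blks_append_inject:
  assumes "blks w = blks v @ Y" "Y = [] \<or> is_cut (hd Y)"
  shows "\<exists>w'. w = v @ w' \<and> blks w' = Y"
  using assms
proof (induction v arbitrary: w)
  case (Cons k v)
  have "blks v @ Y = [] \<or> is_cut (hd (blks v @ Y))"
    using Cons.prems(2) hd_blks[of v] by (cases "v = []") auto
  then obtain w1 where "w = k # w1" "blks w1 = blks v @ Y"
    using blks_Cons_inject[of w k "blks v @ Y"] Cons.prems(1) by auto
  then show ?case using Cons.IH Cons.prems(2) by auto
qed auto

lemma blks_inject: "blks v = blks w \<longleftrightarrow> v = w"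
  using blks_append_inject[of w v "[]"] by auto

lemma blks_split:
  assumes "blks w = x @ y" "y \<noteq> []" "is_cut (hd y)"
  shows "\<exists>w1 w2. w = w1 @ w2 \<and> blks w1 = x \<and> blks w2 = y"
  using assms
proof (induction w arbitrary: x)
  case (Cons k w)
  show ?case
  proof (cases "x = []")
    case True
    then show ?thesis using Cons.prems by (intro exI[of _ "[]"] exI[of _ "k # w"]) simp
  next
    case False
    have "length (blk k) \<le> length x"
    proof (rule ccontr)
      assume less: "\<not> ?thesis"
      then have "hd y = blk k ! length x" using Cons.prems
        by (metis blks_simps(2) hd_conv_nth linorder_not_le nth_append nth_append_length_plus add.right_neutral)
      moreover obtain m where "length x = Suc m" using False by (cases x) auto
      ultimately have "\<not> is_cut (hd y)" using less by (auto simp: blk_def split: if_splits)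
      then show False using Cons.prems by simp
    qed
    then obtain x' where x': "x = blk k @ x'" using Cons.prems(1)
      by (metis append_eq_append_conv_if append_take_drop_id blks_simps(2))
    then have "blks w = x' @ y" using Cons.prems by simp
    then obtain w1 w2 where "w = w1 @ w2" "blks w1 = x'" "blks w2 = y" using Cons by blast
    then show ?thesis using x' by (intro exI[of _ "k # w1"] exI[of _ w2]) simp
  qed
qed auto

lemma rotate_blks:
  assumes "l = rotate m (blks w)" "l \<noteq> []" "is_cut (hd l)"
  shows "\<exists>j. l = blks (rotate j w)"
proof -
  define r where "r = m mod length (blks w)"
  have w: "blks w \<noteq> []" using assms by auto
  then have "r < length (blks w)" by (simp add: r_def)
  define x y where "x = take r (blks w)" and "y = drop r (blks w)"
  have l: "l = y @ x" by (simp add: assms(1) rotate_drop_take x_def y_def r_def)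
  have "blks w = x @ y" "y \<noteq> []" using \<open>r < length (blks w)\<close> by (simp_all add: x_def y_def)
  moreover have "is_cut (hd y)" using assms(3) \<open>y \<noteq> []\<close> by (simp add: l)
  ultimately obtain w1 w2 where "w = w1 @ w2" "blks w1 = x" "blks w2 = y" using blks_split by metis
  then have "l = blks (rotate (length w1) w)" by (simp add: l rotate_append)
  then show ?thesis by blast
qed

text \<open>The output of a transducer that reads the pair \<open>q\<close> after \<open>p\<close>.
  A nonpositive \<open>p\<close> with second letter rho^-1 = rho rho hides the start of another
  nonpositive entry. A sigma after a nonpositive pair, or a sigma^-1 = sigma sigma with positive
  label, starts a positive entry. A sigma with nonpositive label completes a positive entry and
  leaves the rho that starts the next one.\<close>

definition em :: "labelled \<Rightarrow> labelled \<Rightarrow> token list" where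
  "em p q = (if \<not> snd p \<and> snd (fst p) then [CutN] else []) @
     (if fst (fst q) then (if snd p then [] else [CutP]) else if snd q then [CutP] else []) @
     (if snd q then [Plus] else if fst (fst q) then [CutN] else [Minus])"

fun ems :: "labelled \<Rightarrow> labelled list \<Rightarrow> token list" where
  "ems p [] = []"
| "ems p (q # l) = em p q @ ems q l"

text \<open>A label can change only at a sigma: sigma^-1 either joins two positive entries or lies
  within nonpositive ones. A pair with positive label has rho^-1 in second place, since alpha =
  sigma rho^-1.\<close>

fun chain :: "labelled \<Rightarrow> labelled list \<Rightarrow> bool" where
  "chain p [] = True"
| "chain p (q # l) = ((\<not> fst (fst q) \<longrightarrow> snd q = snd p) \<and> (snd q \<longrightarrow> snd (fst q)) \<and> chain q l)"

lemma ems_append: "ems p (l @ l') = ems p l @ ems (last (p # l)) l'"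
  by (induction l arbitrary: p) auto

lemma chain_append: "chain p (l @ l') \<longleftrightarrow> chain p l \<and> chain (last (p # l)) l'"
  by (induction l arbitrary: p) auto

text \<open>The state between two contributions, with \<open>a\<close> the entry just read,
  \<open>b\<close> the next one and \<open>p\<close> the last pair. An entry 1 after a nonpositive
  entry contributes no pair, so a = 1 is compatible with either second letter of a nonpositive
  \<open>p\<close>.\<close>

definition linked :: "labelled \<Rightarrow> int \<Rightarrow> int \<Rightarrow> bool" where
  "linked p a b \<longleftrightarrow> (if snd p then a \<ge> 2
     else if snd (fst p) then a = 1 \<or> (a \<le> 0 \<and> b \<le> 0) \<or> (a = 0 \<and> b \<ge> 1)
     else a = 1 \<or> (a \<le> 0 \<and> b \<ge> 1))"

text \<open>The tokens of the blocks read so far that are emitted only by the next pair.\<close>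

definition pending :: "labelled \<Rightarrow> int \<Rightarrow> int \<Rightarrow> token list" where
  "pending p a b = (if snd p then []
     else (if snd (fst p) \<and> (a \<ge> 1 \<or> b \<ge> 1) then [CutN] else []) @ (if a = 1 then [CutP] else []))"

lemma ems_replicate_TTP:
  "ems ((x, True), True) (replicate n ((True, True), True)) = replicate n Plus"
  by (induction n arbitrary: x) (auto simp: em_def)

lemma ems_replicate_VVN:
  "ems ((x, False), False) (replicate n ((False, False), False)) = replicate n Minus"
  by (induction n arbitrary: x) (auto simp: em_def)

lemma chain_replicate_TTP:
  "chain p (replicate n ((True, True), True))"
  by (induction n arbitrary: p) auto

lemma chain_replicate_VVN:
  "\<not> snd p \<Longrightarrow> chain p (replicate n ((False, False), False))"
  by (induction n arbitrary: p) auto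

lemma last_replicate_Cons: "last (x # replicate n y) = (if n = 0 then x else y)"
  by auto

lemma replicate_Minus_snoc: "replicate n Minus @ [Minus] = Minus # replicate n Minus"
  by (simp add: replicate_append_same)

text \<open>The output lags behind the entries read by the \<open>pending\<close> tokens. With this
  correction the claim is local, and the cases run through the signs of three consecutive
  entries.\<close>

lemma contrib_step:
  assumes w: "window_ok a k c" and p: "linked p a k"
  defines "l \<equiv> contrib a k c"
  shows "pending p a k @ blk k = ems p l @ pending (last (p # l)) k c \<and> linked (last (p # l)) k c \<and> chain p l"
proof -
  obtain s t m where p': "p = ((s, t), m)" by (metis prod.exhaust)
  consider "k \<ge> 1" "a \<ge> 1" | "k = 1" "a \<le> 0" | "k \<ge> 2" "a \<le> 0" | "k \<le> 0" "a \<ge> 1" "c \<ge> 1 \<or> k = 0"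
    | "k \<le> 0" "a \<ge> 1" "c \<le> 0" "k \<noteq> 0" | "k = 0" "a \<le> 0" | "k < 0" "a \<le> 0" "c \<ge> 1" | "k < 0" "a \<le> 0" "c \<le> 0"
    by linarith
  then show ?thesis
  proof cases
    case 1
    then have "k \<ge> 2" "a \<ge> 2" "m" using w p by (auto simp: window_ok_def linked_def p' split: if_splits)
    moreover have "nat (k - 1) = Suc (nat (k - 2))" using \<open>k \<ge> 2\<close> by simp
    ultimately show ?thesis
      by (simp add: l_def contrib_def em_def blk_def p' pending_def linked_def ems_replicate_TTP chain_replicate_TTP last_replicate_Cons)
  next
    case 2
    then show ?thesis using w p
      by (auto simp: l_def contrib_def em_def blk_def p' pending_def linked_def window_ok_def split: if_splits)
  next
    case 3
    then have n: "nat (k - 1) = Suc (nat (k - 2))" by simp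
    have m: "\<not> m" "t \<longrightarrow> a = 0" using p 3 by (auto simp: linked_def p' split: if_splits)
    show ?thesis using 3 m
      by (simp add: l_def contrib_def n em_def blk_def p' pending_def linked_def ems_replicate_TTP chain_replicate_TTP last_replicate_Cons)
  next
    case 4
    then have "m \<longrightarrow> a \<ge> 2" "\<not> m \<longrightarrow> a = 1" using p by (auto simp: linked_def p' split: if_splits)
    then show ?thesis using 4 w
      by (cases "k = 0") (auto simp: l_def contrib_def em_def blk_def p' pending_def linked_def window_ok_def
        ems_replicate_VVN chain_replicate_VVN last_replicate_Cons split: if_splits)
  next
    case 5
    then have m: "m \<longrightarrow> a \<ge> 2" "\<not> m \<longrightarrow> a = 1" using p by (auto simp: linked_def p' split: if_splits)
    have n: "nat (- k) = Suc (nat (- k - 1))" using 5 by simp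
    show ?thesis using 5 m
      by (auto simp: l_def contrib_def em_def blk_def p' pending_def linked_def n ems_append chain_append
        ems_replicate_VVN chain_replicate_VVN last_replicate_Cons replicate_Minus_snoc)
  next
    case 6
    then show ?thesis using w p
      by (auto simp: l_def contrib_def em_def blk_def p' pending_def linked_def window_ok_def split: if_splits)
  next
    case 7
    then have m: "\<not> m" "t" using p by (auto simp: linked_def p' split: if_splits)
    have n: "nat (- k) = Suc (nat (- k - 1))" using 7 by simp
    show ?thesis using 7 m
      by (auto simp: l_def contrib_def em_def blk_def p' pending_def linked_def n
        ems_replicate_VVN chain_replicate_VVN last_replicate_Cons)
  next
    case 8
    then have m: "\<not> m" "t" using p by (auto simp: linked_def p' split: if_splits)
    have n: "nat (- k) = Suc (nat (- k - 1))" using 8 by simp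
    show ?thesis
    proof (cases "nat (- k - 1)")
      case 0
      then show ?thesis using 8 m
        by (simp add: l_def contrib_def em_def blk_def p' pending_def linked_def n)
    next
      case (Suc j)
      then show ?thesis using 8 m
        by (simp add: l_def contrib_def em_def blk_def p' pending_def linked_def n ems_append chain_append
          ems_replicate_VVN chain_replicate_VVN last_replicate_Cons replicate_Minus_snoc)
    qed
  qed
qed

lemma linked_exists: "\<exists>p. linked p a b"
proof -
  consider "a \<ge> 2" | "a = 1" | "a \<le> 0" "b \<ge> 1" | "a \<le> 0" "b \<le> 0" by linarith
  then show ?thesis
  proof cases
    case 1
    then show ?thesis by (intro exI[of _ "((True, True), True)"]) (simp add: linked_def)
  next
    case 2
    then show ?thesis by (intro exI[of _ "((True, False), False)"]) (simp add: linked_def)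
  next
    case 3
    then show ?thesis by (intro exI[of _ "((True, False), False)"]) (simp add: linked_def)
  next
    case 4
    then show ?thesis by (intro exI[of _ "((True, True), False)"]) (simp add: linked_def)
  qed
qed

lemma enc_steps:
  assumes "cyc_normal w" "linked p (entry w 0) (entry w 1)"
  defines "l \<equiv> \<lambda>n. concat (map (\<lambda>i. contrib (entry w i) (entry w (i + 1)) (entry w (i + 2))) [0..<n])"
  shows "pending p (entry w 0) (entry w 1) @ blks (map (\<lambda>i. entry w (i + 1)) [0..<n])
      = ems p (l n) @ pending (last (p # l n)) (entry w n) (entry w (n + 1)) \<and>
    linked (last (p # l n)) (entry w n) (entry w (n + 1)) \<and> chain p (l n)"
proof (induction n)
  case 0
  then show ?case using assms(2) by (simp add: l_def)
next
  case (Suc n)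
  let ?c = "contrib (entry w n) (entry w (n + 1)) (entry w (n + 2))"
  define q where "q = last (p # l n)"
  have l: "l (Suc n) = l n @ ?c" by (simp add: l_def)
  have q: "last (p # l (Suc n)) = last (q # ?c)" by (simp add: l q_def)
  have IH: "pending p (entry w 0) (entry w 1) @ blks (map (\<lambda>i. entry w (i + 1)) [0..<n])
      = ems p (l n) @ pending q (entry w n) (entry w (n + 1))"
     "linked q (entry w n) (entry w (n + 1))" "chain p (l n)" using Suc by (simp_all add: q_def)
  note step = contrib_step[OF cyc_normal_window[OF assms(1), of n] IH(2)]
  have "pending p (entry w 0) (entry w 1) @ blks (map (\<lambda>i. entry w (i + 1)) [0..<Suc n])
    = (pending p (entry w 0) (entry w 1) @ blks (map (\<lambda>i. entry w (i + 1)) [0..<n])) @ blk (entry w (n + 1))"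
    by simp
  also have "\<dots> = ems p (l n) @ pending q (entry w n) (entry w (n + 1)) @ blk (entry w (n + 1))"
    unfolding IH(1) by simp
  also have "\<dots> = (ems p (l n) @ ems q ?c) @ pending (last (q # ?c)) (entry w (n + 1)) (entry w (n + 2))"
    using step by simp
  also have "ems p (l n) @ ems q ?c = ems p (l (Suc n))" by (simp only: l ems_append q_def)
  finally have 1: "pending p (entry w 0) (entry w 1) @ blks (map (\<lambda>i. entry w (i + 1)) [0..<Suc n])
    = ems p (l (Suc n)) @ pending (last (p # l (Suc n))) (entry w (Suc n)) (entry w (Suc n + 1))"
    unfolding q using l by (simp add: ems_append q_def)
  have 2: "chain p (l (Suc n))" using IH(3) step by (simp only: l chain_append q_def)
  show ?case using 1 2 step unfolding q by simp
qed

definition cyc_ems :: "labelled list \<Rightarrow> token list" where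
  "cyc_ems l = ems (last l) l"

definition cyc_chain :: "labelled list \<Rightarrow> bool" where
  "cyc_chain l \<longleftrightarrow> chain (last l) l"

lemma map_entry_rotate: "map (\<lambda>i. entry w (i + 1)) [0..<length w] = rotate 1 w"
  by (rule nth_equalityI) (auto simp: entry_def nth_rotate nth_rotate1)

text \<open>The transducer has to be started in the state in which it ends in order to produce a
  cyclic string.\<close>

theorem enc_correct:
  assumes "cyc_normal w"
  shows "enc w \<noteq> []" "cyc_chain (enc w)" "\<exists>m. cyc_ems (enc w) = rotate m (blks w)"
proof -
  have w: "w \<noteq> []" using assms by (simp add: cyc_normal_def)
  let ?n = "length w"
  have n: "entry w ?n = entry w 0" "entry w (?n + 1) = entry w 1"
    using entry_add_length[of w 0] entry_add_length[of w 1] by (simp_all add: add.commute)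
  obtain p where p: "linked p (entry w 0) (entry w 1)" using linked_exists by blast
  note 1 = enc_steps[OF assms p, of ?n, folded enc_def, unfolded n map_entry_rotate]
  show ne: "enc w \<noteq> []"
  proof
    assume "enc w = []"
    then have "blks (rotate 1 w) = []" using 1 by simp
    then show False using w by simp
  qed
  \<comment> \<open>The run from an arbitrary linked pair shows that the last pair is itself linked
    to the first entries, so it can serve as starting pair of a second run.\<close>
  define q where "q = last (enc w)"
  have q: "linked q (entry w 0) (entry w 1)" using 1 ne by (simp add: q_def)
  note 2 = enc_steps[OF assms q, of ?n, folded enc_def, unfolded n map_entry_rotate]
  show "cyc_chain (enc w)" using 2 by (simp add: cyc_chain_def q_def)
  \<comment> \<open>The pending tokens at both ends agree. The equation has the form x y = z x, so
    the two token strings are rotations of each other.\<close>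
  have e: "pending q (entry w 0) (entry w 1) @ blks (rotate 1 w) = cyc_ems (enc w) @ pending q (entry w 0) (entry w 1)"
    using 2 ne by (simp add: cyc_ems_def q_def)
  have "cyc_ems (enc w) \<noteq> []" using ne by (cases "enc w") (auto simp: cyc_ems_def em_def)
  then obtain m where m: "cyc_ems (enc w) = rotate m (blks (rotate 1 w))"
    using append_commute_rotate[OF e] by blast
  have "\<exists>j. blks (rotate 1 w) = rotate j (blks w)"
  proof -
    obtain k w' where w': "w = k # w'" using w by (cases w) auto
    then have "blks (rotate 1 w) = rotate (length (blk k)) (blks w)" by (simp add: rotate_append)
    then show ?thesis by blast
  qed
  then show "\<exists>m. cyc_ems (enc w) = rotate m (blks w)" using m by (metis rotate_rotate)
qed

lemma cyc_ems_rotate: "\<exists>m. cyc_ems (rotate k l) = rotate m (cyc_ems l)"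
proof (cases "k mod length l = 0 \<or> l = []")
  case True
  then have "rotate k l = l" by (auto simp: rotate_id)
  then show ?thesis by (metis rotate0 id_apply)
next
  case False
  define r where "r = k mod length l"
  define x y where "x = take r l" and "y = drop r l"
  have "r < length l" "r \<noteq> 0" using False by (auto simp: r_def)
  then have xy: "x \<noteq> []" "y \<noteq> []" by (auto simp: x_def y_def)
  have l: "l = x @ y" "rotate k l = y @ x" by (simp_all add: x_def y_def rotate_drop_take r_def)
  have "cyc_ems l = ems (last y) x @ ems (last x) y" "cyc_ems (y @ x) = ems (last x) y @ ems (last y) x"
    using xy by (simp_all add: l(1) cyc_ems_def ems_append)
  then show ?thesis unfolding l(2) by (metis rotate_append)
qed

lemma cyc_chain_rotate: "cyc_chain l \<Longrightarrow> cyc_chain (rotate k l)"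
proof (cases "k mod length l = 0 \<or> l = []")
  case True
  then have "rotate k l = l" by (auto simp: rotate_id)
  then show "cyc_chain l \<Longrightarrow> ?thesis" by simp
next
  case False
  assume c: "cyc_chain l"
  define r where "r = k mod length l"
  define x y where "x = take r l" and "y = drop r l"
  have "r < length l" "r \<noteq> 0" using False by (auto simp: r_def)
  then have xy: "x \<noteq> []" "y \<noteq> []" by (auto simp: x_def y_def)
  have l: "l = x @ y" "rotate k l = y @ x" by (simp_all add: x_def y_def rotate_drop_take r_def)
  show ?thesis using c xy unfolding l(2) by (simp add: l(1) cyc_chain_def chain_append)
qed

section \<open>Uniqueness of normal words\<close>

definition cyc_nth :: "'a list \<Rightarrow> nat \<Rightarrow> 'a" where
  "cyc_nth l i = l ! (i mod length l)"

lemma cyc_nth_add_length: "cyc_nth l (i + length l) = cyc_nth l i"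
  by (simp add: cyc_nth_def)

lemma cyc_nth_rotate: "l \<noteq> [] \<Longrightarrow> cyc_nth (rotate k l) i = cyc_nth l (k + i)"
  by (simp add: cyc_nth_def nth_rotate mod_add_right_eq)

lemma chain_nth:
  "chain p l \<Longrightarrow> i < length l \<Longrightarrow>
    (\<not> fst (fst (l ! i)) \<longrightarrow> snd (l ! i) = snd ((p # l) ! i)) \<and> (snd (l ! i) \<longrightarrow> snd (fst (l ! i)))"
proof (induction l arbitrary: p i)
  case (Cons q l)
  show ?case
  proof (cases i)
    case (Suc j)
    then show ?thesis using Cons.IH[of q j] Cons.prems by simp
  qed (use Cons.prems in simp)
qed simp

lemma cyc_chain_nth:
  assumes "cyc_chain l" "l \<noteq> []"
  shows "\<not> fst (fst (cyc_nth l (i + 1))) \<Longrightarrow> snd (cyc_nth l (i + 1)) = snd (cyc_nth l i)"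
    "snd (cyc_nth l i) \<Longrightarrow> snd (fst (cyc_nth l i))"
proof -
  let ?n = "length l"
  have n: "?n > 0" using assms by simp
  have c: "chain (last l) l" using assms by (simp add: cyc_chain_def)
  show "snd (cyc_nth l i) \<Longrightarrow> snd (fst (cyc_nth l i))"
    using chain_nth[OF c, of "i mod ?n"] n by (simp add: cyc_nth_def)
  have "(last l # l) ! ((i + 1) mod ?n) = cyc_nth l i"
  proof (cases "(i + 1) mod ?n")
    case 0
    then have "i mod ?n = ?n - 1" using n by (metis Suc_eq_plus1 add_diff_cancel_left' mod_Suc old.nat.distinct(1) plus_1_eq_Suc)
    then show ?thesis using 0 assms(2) by (simp add: cyc_nth_def last_conv_nth)
  next
    case (Suc m)
    then have "i mod ?n = m" by (metis Suc_eq_plus1 Zero_not_Suc mod_Suc nat.inject)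
    then show ?thesis using Suc by (simp add: cyc_nth_def)
  qed
  then show "\<not> fst (fst (cyc_nth l (i + 1))) \<Longrightarrow> snd (cyc_nth l (i + 1)) = snd (cyc_nth l i)"
    using chain_nth[OF c, of "(i + 1) mod ?n"] n by (simp add: cyc_nth_def)
qed

text \<open>This is what the third and fourth conditions on normal words become after recoding.\<close>

definition no_bad :: "labelled list \<Rightarrow> bool" where
  "no_bad l \<longleftrightarrow> \<not> (\<exists>i k. cyc_nth l i = ((True, True), False) \<and>
      (\<forall>j\<in>{1..k}. cyc_nth l (i + j) = ((False, True), False)) \<and> fst (fst (cyc_nth l (i + k + 1)))) \<and>
    \<not> (\<forall>i. cyc_nth l i = ((False, True), False))"

text \<open>Labels are constant on maximal stretches \<open>(True, _), (False, _), \<dots>, (False, _)\<close>; where two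
  labellings differ, the one with negative label would have only pairs \<open>(_, True)\<close>.\<close>

lemma labels_differ_False:
  assumes l: "cyc_chain l" "l \<noteq> []" and l': "cyc_chain l'" "no_bad l'" and eq: "map fst l = map fst l'"
    and i: "snd (cyc_nth l i)" "\<not> snd (cyc_nth l' i)"
  shows False
proof -
  let ?n = "length l"
  have len: "length l' = ?n" using arg_cong[OF eq, of length] by simp
  then have ne': "l' \<noteq> []" using l by auto
  have n: "?n > 0" using l by simp
  have f: "fst (cyc_nth l' j) = fst (cyc_nth l j)" for j
    using arg_cong[OF eq, of "\<lambda>x. x ! (j mod ?n)"] n by (simp add: cyc_nth_def len)
  define s where "s j = fst (fst (cyc_nth l j))" for j
  have per: "s (j + ?n) = s j" for j by (simp add: s_def cyc_nth_add_length)
  have const: "snd (cyc_nth l j) = snd (cyc_nth l a) \<and> snd (cyc_nth l' j) = snd (cyc_nth l' a)"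
    if "a \<le> j" "\<And>m. a < m \<Longrightarrow> m \<le> j \<Longrightarrow> \<not> s m" for a j
    using that
  proof (induction j rule: dec_induct)
    case (step j)
    have "\<not> s (j + 1)" using step.prems[of "j + 1"] step.hyps by simp
    then have "snd (cyc_nth l (j + 1)) = snd (cyc_nth l j)" "snd (cyc_nth l' (j + 1)) = snd (cyc_nth l' j)"
      using cyc_chain_nth(1)[OF l] cyc_chain_nth(1)[OF l'(1) ne'] by (simp_all add: s_def f)
    then show ?case using step.IH step.prems by simp
  qed simp
  \<comment> \<open>One period to the right of i, so that some position with \<open>s\<close> lies
    at or before i'.\<close>
  define i' where "i' = i + ?n"
  have i': "snd (cyc_nth l i')" "\<not> snd (cyc_nth l' i')"
    using i cyc_nth_add_length[of l' i] by (simp_all add: i'_def cyc_nth_add_length len)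
  have val: "cyc_nth l' j = ((s j, True), False)" if "snd (cyc_nth l j)" "\<not> snd (cyc_nth l' j)" for j
    using that cyc_chain_nth(2)[OF l that(1)] f[of j] by (auto simp: s_def prod_eq_iff)
  show False
  proof (cases "\<exists>j. s j")
    case False
    have "cyc_nth l' j = ((False, True), False)" for j
    proof -
      have "snd (cyc_nth l (j + i)) = snd (cyc_nth l i) \<and> snd (cyc_nth l' (j + i)) = snd (cyc_nth l' i)" for j
        by (rule const) (use False in auto)
      then have *: "cyc_nth l' (j + i) = ((False, True), False)" for j using val[of "j + i"] i False by auto
      \<comment> \<open>Adding whole periods moves the index to the right of i, where
        \<open>*\<close> applies.\<close>
      have "cyc_nth l' j = cyc_nth l' (j + i * ?n)" by (simp add: cyc_nth_def len)
      also have "j + i * ?n = (j + i * (?n - 1)) + i" using n by (cases ?n) auto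
      finally show ?thesis using * by metis
    qed
    then show False using l'(2) by (simp add: no_bad_def)
  next
    case True
    then obtain j0 where j0: "s j0" by blast
    have j0': "s (j0 mod ?n + a * ?n)" for a
    proof -
      have "s (j0 mod ?n + a * ?n) = s j0" by (simp add: s_def cyc_nth_def)
      then show ?thesis using j0 by simp
    qed
    define A where "A = {j. j \<le> i' \<and> s j}"
    have "finite A" by (simp add: A_def)
    moreover have "j0 mod ?n \<in> A"
      using j0'[of 0] mod_less_divisor[OF n, of j0] unfolding A_def i'_def by simp
    ultimately have A: "Max A \<in> A" "\<And>j. j \<in> A \<Longrightarrow> j \<le> Max A" by (auto intro: Max_in)
    define i0 where "i0 = Max A"
    have "\<exists>j>i'. s j"
    proof -
      have "j0 mod ?n + (i' + 1) * ?n > i'" using n by (cases ?n) auto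
      then show ?thesis using j0' by blast
    qed
    then have "(LEAST j. j > i' \<and> s j) > i' \<and> s (LEAST j. j > i' \<and> s j)" by (metis (mono_tags, lifting) LeastI_ex)
    then obtain i1 where i1: "i1 > i'" "s i1" "\<And>j. i' < j \<Longrightarrow> j < i1 \<Longrightarrow> \<not> s j"
      using not_less_Least[of _ "\<lambda>j. j > i' \<and> s j"] by metis
    have i0: "i0 \<le> i'" "s i0" using A(1) by (auto simp: A_def i0_def)
    have gap: "\<not> s j" if "i0 < j" "j < i1" for j
    proof (cases "j \<le> i'")
      case True
      show ?thesis
      proof
        assume "s j"
        then have "j \<in> A" using True by (simp add: A_def)
        then have "j \<le> i0" unfolding i0_def by (rule A(2))
        then show False using that by simp
      qed
    qed (use i1 that in auto)
    have modes: "snd (cyc_nth l j) \<and> \<not> snd (cyc_nth l' j)" if "i0 \<le> j" "j < i1" for j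
    proof -
      have "snd (cyc_nth l i') = snd (cyc_nth l i0) \<and> snd (cyc_nth l' i') = snd (cyc_nth l' i0)"
        by (rule const) (use i0 i1 gap in auto)
      moreover have "snd (cyc_nth l j) = snd (cyc_nth l i0) \<and> snd (cyc_nth l' j) = snd (cyc_nth l' i0)"
        by (rule const) (use that gap in auto)
      ultimately show ?thesis using i' by simp
    qed
    define k where "k = i1 - i0 - 1"
    have k: "i0 + k + 1 = i1" using i0 i1 by (simp add: k_def)
    have "cyc_nth l' i0 = ((True, True), False)" using val[of i0] modes[of i0] i0 i1 by simp
    moreover have "\<forall>j\<in>{1..k}. cyc_nth l' (i0 + j) = ((False, True), False)"
    proof
      fix j assume "j \<in> {1..k}"
      then have "i0 < i0 + j" "i0 + j < i1" using k by auto
      then show "cyc_nth l' (i0 + j) = ((False, True), False)" using val[of "i0 + j"] modes[of "i0 + j"] gap[of "i0 + j"] by simp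
    qed
    moreover have "fst (fst (cyc_nth l' (i0 + k + 1)))" using i1(2) by (simp only: k f s_def)
    ultimately show False using l'(2) unfolding no_bad_def by blast
  qed
qed

lemma labels_unique:
  assumes "cyc_chain l" "cyc_chain l'" "no_bad l" "no_bad l'" "map fst l = map fst l'"
  shows "l = l'"
proof (rule nth_equalityI)
  show len: "length l = length l'" using arg_cong[OF assms(5), of length] by simp
  fix i assume i: "i < length l"
  then have ne: "l \<noteq> []" "l' \<noteq> []" using len by auto
  have "snd (cyc_nth l i) = snd (cyc_nth l' i)"
    using labels_differ_False[of l l' i] labels_differ_False[of l' l i] assms ne by metis
  moreover have "fst (l ! i) = fst (l' ! i)" using arg_cong[OF assms(5), of "\<lambda>x. x ! i"] i len by simp
  ultimately show "l ! i = l' ! i" using i len by (simp add: cyc_nth_def prod_eq_iff)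
qed

lemma no_bad_rotate: "no_bad l \<Longrightarrow> no_bad (rotate m l)"
proof (cases "l = []")
  case False
  assume *: "no_bad l"
  have "\<not> (\<exists>i k. cyc_nth l (m + i) = ((True, True), False) \<and>
      (\<forall>j\<in>{1..k}. cyc_nth l (m + (i + j)) = ((False, True), False)) \<and> fst (fst (cyc_nth l (m + (i + k + 1)))))"
  proof
    assume "\<exists>i k. cyc_nth l (m + i) = ((True, True), False) \<and>
      (\<forall>j\<in>{1..k}. cyc_nth l (m + (i + j)) = ((False, True), False)) \<and> fst (fst (cyc_nth l (m + (i + k + 1))))"
    then obtain i k where "cyc_nth l (m + i) = ((True, True), False)"
      "\<forall>j\<in>{1..k}. cyc_nth l (m + i + j) = ((False, True), False)" "fst (fst (cyc_nth l (m + i + k + 1)))"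
      by (auto simp only: add.assoc)
    then show False using * unfolding no_bad_def by blast
  qed
  moreover have "\<not> (\<forall>i. cyc_nth l (m + i) = ((False, True), False))"
  proof
    assume a: "\<forall>i. cyc_nth l (m + i) = ((False, True), False)"
    have "cyc_nth l i = ((False, True), False)" for i
    proof -
      have "cyc_nth l i = cyc_nth l (i + m * length l)" by (simp add: cyc_nth_def)
      also have "i + m * length l = m + (i + m * (length l - 1))" using False by (cases l) auto
      finally show ?thesis using a by metis
    qed
    then show False using * by (simp add: no_bad_def)
  qed
  ultimately show ?thesis unfolding no_bad_def cyc_nth_rotate[OF False] by blast
qed simp

lemma ems_replicate_VTN:
  "ems ((x, True), False) (replicate k ((False, True), False)) = blks (replicate k (-1))"
  by (induction k arbitrary: x) (auto simp: em_def blk_def)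

lemma ems_eq_Nil [simp]: "ems p l = [] \<longleftrightarrow> l = []"
  by (cases l) (auto simp: em_def)

lemma last_ems_TTN: "l \<noteq> [] \<Longrightarrow> last l = ((True, y), False) \<Longrightarrow> last (ems p l) = CutN"
  by (induction l arbitrary: p) (auto simp: em_def split: if_splits)

text \<open>The forbidden pattern emits the tokens of the entries 0, -1, ..., -1, 0, which
  contradicts the third condition, or the second one if there is no -1. Pairs that are all
  \<open>((False, True), False)\<close> emit the word of entries -1 only.\<close>

lemma enc_no_bad:
  assumes w: "cyc_normal w"
  shows "no_bad (enc w)"
proof -
  define l where "l = enc w"
  let ?n = "length l"
  have ne: "l \<noteq> []" using enc_correct(1)[OF w] by (simp add: l_def)
  obtain m where m: "cyc_ems l = rotate m (blks w)" using enc_correct(3)[OF w] by (auto simp: l_def)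
  have False if bad: "cyc_nth l i = ((True, True), False)"
      "\<forall>j\<in>{1..k}. cyc_nth l (i + j) = ((False, True), False)" "fst (fst (cyc_nth l (i + k + 1)))" for i k
  proof -
    define r where "r = rotate (i + 1) l"
    have rne: "r \<noteq> []" "length r = ?n" using ne by (simp_all add: r_def)
    have rn: "cyc_nth r j = cyc_nth l (i + 1 + j)" for j by (simp only: r_def cyc_nth_rotate[OF ne])
    have rlast: "last r = ((True, True), False)"
    proof -
      have "(?n - 1) mod ?n = ?n - 1" using ne by simp
      then have "last r = cyc_nth r (?n - 1)" using rne by (simp add: last_conv_nth cyc_nth_def)
      also have "\<dots> = cyc_nth l (i + ?n)" using ne by (simp add: rn Suc_leI)
      finally show ?thesis using bad(1) cyc_nth_add_length by metis
    qed
    have rV: "cyc_nth r j = ((False, True), False)" if "j < k" for j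
      using bad(2)[rule_format, of "j + 1"] that by (simp add: rn)
    have k: "k < ?n"
    proof (rule ccontr)
      assume "\<not> k < ?n"
      then have "cyc_nth r (?n - 1) = ((False, True), False)" using rV[of "?n - 1"] ne by (cases l) auto
      moreover have "(?n - 1) mod ?n = ?n - 1" using ne by simp
      ultimately show False using rlast rne by (simp add: last_conv_nth cyc_nth_def)
    qed
    have "take k r = replicate k ((False, True), False)"
      using k rne rV by (intro nth_equalityI) (auto simp: cyc_nth_def)
    moreover obtain x where x: "x = r ! k" by blast
    ultimately have rr: "r = replicate k ((False, True), False) @ x # drop (Suc k) r"
      using k rne by (metis id_take_nth_drop)
    have sx: "fst (fst x)" using bad(3) rn[of k] k rne by (simp add: x cyc_nth_def add_ac)
    define Z where "Z = (if snd x then [Plus] else [CutN]) @ ems x (drop (Suc k) r)"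
    have "last (((True, True), False) # replicate k ((False, True), False)) \<in> {((True, True), False), ((False, True), False)}"
      by (cases k) auto
    then have emx: "em (last (((True, True), False) # replicate k ((False, True), False))) x
        = CutN # CutP # (if snd x then [Plus] else [CutN])"
      using sx by (auto simp: em_def)
    have e: "cyc_ems r = blks (replicate k (-1)) @ CutN # CutP # Z"
    proof -
      have "cyc_ems r = ems ((True, True), False) (replicate k ((False, True), False) @ x # drop (Suc k) r)"
        unfolding cyc_ems_def rlast using rr by simp
      also have "\<dots> = blks (replicate k (-1)) @ CutN # CutP # Z"
        by (simp add: ems_append emx Z_def ems_replicate_VTN del: last.simps)
      finally show ?thesis .
    qed
    have "Z \<noteq> []" by (simp add: Z_def)
    moreover have "last (cyc_ems r) = CutN" unfolding cyc_ems_def by (rule last_ems_TTN[OF rne(1) rlast])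
    ultimately obtain Z' where Z': "Z = Z' @ [CutN]" by (cases Z rule: rev_cases) (auto simp: e)
    \<comment> \<open>The last token comes from the sigma rho^-1 that opens the pattern and is the
      cut of the first zero. Moving it to the front makes the string begin with a whole
      entry.\<close>
    define R where "R = CutN # blks (replicate k (-1)) @ CutN # CutP # Z'"
    have "R = rotate (length (cyc_ems r) - 1) (cyc_ems r)"
    proof -
      have "cyc_ems r = (blks (replicate k (-1)) @ CutN # CutP # Z') @ [CutN]" by (simp add: e Z')
      then show ?thesis using rotate_append[of "blks (replicate k (-1)) @ CutN # CutP # Z'" "[CutN]"]
        by (simp add: R_def)
    qed
    moreover obtain m' where "cyc_ems r = rotate m' (cyc_ems l)" using cyc_ems_rotate r_def by blast
    ultimately have "R = rotate (length (cyc_ems r) - 1 + (m' + m)) (blks w)" by (simp add: m rotate_rotate)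
    then obtain j where j: "R = blks (rotate j w)" using rotate_blks by (metis R_def is_cut_simps(2) list.distinct(1) list.sel(1))
    define w2 where "w2 = rotate j w"
    have w2: "cyc_normal w2" using w by (simp add: w2_def)
    have "blks w2 = blks (0 # replicate k (-1) @ [0]) @ (CutP # Z')"
      using j by (simp add: R_def w2_def) (simp add: blk_def)
    from blks_append_inject[OF this] obtain w3 where w3: "w2 = (0 # replicate k (-1) @ [0]) @ w3" by auto
    have en: "entry w2 0 = 0" "entry w2 (k + 1) = 0" "\<forall>j\<in>{1..k}. entry w2 j = -1"
      unfolding w3 by (auto simp: entry_less nth_append nth_Cons')
    show False
    proof (cases "k = 0")
      case True
      then have "entry w2 (0 + 1) = 0" using en by simp
      then have "entry w2 0 \<le> -1 \<or> entry w2 0 \<ge> 1" using w2 unfolding cyc_normal_def by blast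
      then show False using en by simp
    next
      case False
      then have "\<exists>i k. k \<ge> 1 \<and> entry w2 i = 0 \<and> (\<forall>j\<in>{1..k}. entry w2 (i + j) = -1) \<and> entry w2 (i + k + 1) = 0"
        using en by (intro exI[of _ 0] exI[of _ k]) simp
      then show False using w2 unfolding cyc_normal_def by blast
    qed
  qed
  moreover have False if "\<forall>i. cyc_nth l i = ((False, True), False)"
  proof -
    have "l = replicate ?n ((False, True), False)"
    proof (rule nth_equalityI)
      fix i assume "i < ?n"
      then show "l ! i = replicate ?n ((False, True), False) ! i" using that[rule_format, of i] by (simp add: cyc_nth_def)
    qed simp
    then obtain n where n: "l = replicate n ((False, True), False)" "n > 0" using ne by auto
    have "last l = ((False, True), False)" using n by (cases n) auto
    then have "cyc_ems l = blks (replicate n (-1))" unfolding cyc_ems_def by (simp add: n(1) ems_replicate_VTN)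
    moreover have "is_cut (hd (blks (replicate n (-1))))" "blks (replicate n (-1)) \<noteq> []" using n hd_blks by auto
    ultimately obtain j where "blks (replicate n (-1)) = blks (rotate j w)" using rotate_blks m by metis
    then have "rotate j w = replicate (length (rotate j w)) (-1)" by (metis blks_inject length_replicate)
    moreover have "cyc_normal (rotate j w)" using w by simp
    ultimately show False unfolding cyc_normal_def by blast
  qed
  ultimately show ?thesis unfolding no_bad_def l_def by blast
qed

lemma prod_pairs_frame: "prod_pairs l = frame * lr_word (pair_word (map fst l)) * inverse frame"
  unfolding prod_pairs_def using prod_pair_elt[of "map fst l"] by simp

text \<open>As h is even, the connecting word has even length and splits into pairs, so the words of
  pairs, and not only those of letters, are rotations of each other.\<close>

lemma conjugate_pair_words:
  assumes "h * lr_word (pair_word u) = lr_word (pair_word u') * h" "psl_even h" "u \<noteq> []" "u' \<noteq> []"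
  shows "\<exists>q n. h * lr_word (pair_word u) ^ n = lr_word (pair_word q) \<and> q @ u = u' @ q"
proof -
  have "pair_word u \<noteq> []" "pair_word u' \<noteq> []" using assms(3,4) by (cases u; cases u'; force)+
  then obtain q n where q: "h * lr_word (pair_word u) ^ n = lr_word q" "q @ pair_word u = pair_word u' @ q"
    using conjugate_lr_words[OF _ _ assms(1)] by blast
  have "psl_even (lr_word (pair_word u) ^ n)" by (induction n) (auto simp: psl_even_mult_iff)
  then have "even (length q)" using q(1) assms(2) by (metis even_lr_word psl_even_mult_iff)
  then obtain q' where q': "q = pair_word q'" using pair_word_surj by blast
  have "pair_word (q' @ u) = pair_word (u' @ q')" using q(2) q' by simp
  then have "q' @ u = u' @ q'" by (simp only: pair_word_inj)
  then show ?thesis using q(1) q' by blast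
qed

theorem normal_word_unique:
  assumes w: "cyc_normal w" "cyc_normal w'" and c: "psl_conj (word_elt w) (word_elt w')"
  shows "\<exists>m. w' = rotate m w"
proof -
  define u u' where "u = map fst (enc w)" and "u' = map fst (enc w')"
  have ne: "u \<noteq> []" "u' \<noteq> []" using enc_correct(1) w by (simp_all add: u_def u'_def)
  have "psl_conj (prod_pairs (enc w)) (prod_pairs (enc w'))"
    using prod_enc w c psl_conj_sym psl_conj_trans by metis
  then obtain h where h: "psl_even h" "prod_pairs (enc w') = h * prod_pairs (enc w) * inverse h"
    by (auto simp: psl_conj_def)
  define h' where "h' = inverse frame * h * frame"
  have "lr_word (pair_word u') = inverse frame * prod_pairs (enc w') * frame"
    by (simp add: prod_pairs_frame u'_def mult.assoc)
  then have "h' * lr_word (pair_word u) = lr_word (pair_word u') * h'"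
    by (simp add: h(2) h'_def) (simp add: prod_pairs_frame u_def mult.assoc)
  moreover have "psl_even h'" using h(1) by (simp add: h'_def psl_even_mult_iff)
  ultimately obtain q n where "q @ u = u' @ q" using conjugate_pair_words ne by blast
  then obtain m where "u' = rotate m u" using append_commute_rotate ne by blast
  then have "map fst (enc w') = map fst (rotate m (enc w))" by (simp add: u_def u'_def rotate_map)
  then have "enc w' = rotate m (enc w)"
    using labels_unique enc_correct(2) enc_no_bad w cyc_chain_rotate no_bad_rotate by metis
  then obtain j where "cyc_ems (enc w') = rotate j (cyc_ems (enc w))" using cyc_ems_rotate by metis
  moreover obtain a where "cyc_ems (enc w) = rotate a (blks w)" using enc_correct(3)[OF w(1)] by blast
  moreover obtain b where b: "cyc_ems (enc w') = rotate b (blks w')" using enc_correct(3)[OF w(2)] by blast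
  ultimately have "rotate b (blks w') = rotate (j + a) (blks w)" by (simp add: rotate_rotate)
  then have "blks w' = rotate (b * length (blks w') - b + (j + a)) (blks w)"
    by (metis rotate_inverse rotate_rotate)
  moreover have "blks w' \<noteq> []" "is_cut (hd (blks w'))" using w(2) hd_blks by (auto simp: cyc_normal_def)
  ultimately obtain i where "blks w' = blks (rotate i w)" using rotate_blks by blast
  then show ?thesis by (auto simp: blks_inject)
qed

section \<open>Normal words represent hyperbolic elements\<close>

lemma lr_word_entries:
  "\<exists>a b c d. lr_word l = psl_of (a, b, c, d) \<and> a * d - b * c = 1 \<and> a \<ge> 1 \<and> d \<ge> 1 \<and>
    b \<ge> (if True \<in> set l then 1 else 0) \<and> c \<ge> (if False \<in> set l then 1 else 0)"
proof (induction l)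
  case Nil
  show ?case by (rule exI[of _ 1], rule exI[of _ 0], rule exI[of _ 0], rule exI[of _ 1]) (simp add: psl_one)
next
  case (Cons x l)
  then obtain a b c d where *: "lr_word l = psl_of (a, b, c, d)" "a * d - b * c = 1" "a \<ge> 1" "d \<ge> 1"
    "b \<ge> (if True \<in> set l then 1 else 0)" "c \<ge> (if False \<in> set l then 1 else 0)" by blast
  have bc: "b \<ge> 0" "c \<ge> 0" using *(5,6) by (auto split: if_splits)
  show ?case
  proof (cases x)
    case True
    have "lr_word (x # l) = psl_of (a + c, b + d, c, d)" "(a + c) * d - (b + d) * c = 1"
      using True * by (simp_all add: lr_letter_def psl_of_mult algebra_simps)
    then show ?thesis using * bc True
      by (intro exI[of _ "a + c"] exI[of _ "b + d"] exI[of _ c] exI[of _ d]) auto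
  next
    case False
    have "lr_word (x # l) = psl_of (a, b, a + c, b + d)" "a * (b + d) - b * (a + c) = 1"
      using False * by (simp_all add: lr_letter_def psl_of_mult algebra_simps)
    then show ?thesis using * bc False
      by (intro exI[of _ a] exI[of _ b] exI[of _ "a + c"] exI[of _ "b + d"]) auto
  qed
qed

text \<open>Both off-diagonal entries are at least 1, so ad >= 2 and the trace is at least
  3.\<close>

lemma lr_word_hyperbolic:
  assumes "True \<in> set l" "False \<in> set l"
  shows "psl_hyperbolic (lr_word l)"
proof -
  obtain a b c d where *: "lr_word l = psl_of (a, b, c, d)" "a * d - b * c = 1" "a \<ge> 1" "d \<ge> 1" "b \<ge> 1" "c \<ge> 1"
    using lr_word_entries[of l] assms by auto
  have "b * c \<ge> 1 * 1" using * by (intro mult_mono) auto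
  then have "a * d \<ge> 2" using *(2) by linarith
  then have "a + d \<ge> 3" using *(3,4) by (cases "a = 1"; cases "d = 1") auto
  then show ?thesis by (simp add: *(1) psl_hyperbolic_of[OF *(2)])
qed

lemma set_pair_word: "x \<in> set (pair_word u) \<longleftrightarrow> (\<exists>p\<in>set u. fst p = x \<or> snd p = x)"
  by (induction u rule: pair_word.induct) auto

lemma ems_Plus:
  "\<forall>q\<in>set (p # l). q = ((True, True), True) \<Longrightarrow> ems p l = replicate (length l) Plus"
  by (induction l arbitrary: p) (auto simp: em_def)

lemma ems_Minus:
  "\<forall>q\<in>set (p # l). q = ((False, False), False) \<Longrightarrow> ems p l = replicate (length l) Minus"
  by (induction l arbitrary: p) (auto simp: em_def)

lemma cyc_nth_in_set: "l \<noteq> [] \<Longrightarrow> cyc_nth l i \<in> set l"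
  by (simp add: cyc_nth_def)

text \<open>With one letter only, all pairs are sigma^-1 rho or all are sigma rho^-1. The chain
  condition and \<open>no_bad\<close> then fix all labels, and the output consists of
  \<open>Minus\<close> only or of \<open>Plus\<close> only, without the cuts that every word
  has.\<close>

lemma enc_both_letters:
  assumes w: "cyc_normal w"
  shows "x \<in> set (pair_word (map fst (enc w)))"
proof (rule ccontr)
  assume "\<not> ?thesis"
  then have x: "fst (fst q) = (\<not> x)" "snd (fst q) = (\<not> x)" if "q \<in> set (enc w)" for q
    using that by (auto simp: set_pair_word)
  let ?l = "enc w"
  have ne: "?l \<noteq> []" and ch: "cyc_chain ?l" and nb: "no_bad ?l"
    using enc_correct(1,2)[OF w] enc_no_bad[OF w] by auto
  obtain m where m: "cyc_ems ?l = rotate m (blks w)" using enc_correct(3)[OF w] by blast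
  have "w \<noteq> []" using w by (simp add: cyc_normal_def)
  then have "\<exists>t\<in>set (blks w). is_cut t" using hd_blks[of w] by (meson blks_eq_Nil hd_in_set)
  then have cut: "\<exists>t\<in>set (cyc_ems ?l). is_cut t" by (simp add: m)
  have l: "\<forall>q\<in>set (last ?l # ?l). q \<in> set ?l" using ne by simp
  show False
  proof (cases x)
    case True
    have "\<not> snd q" if "q \<in> set ?l" for q
    proof
      assume s: "snd q"
      obtain i where "i < length ?l" "?l ! i = q" using \<open>q \<in> set ?l\<close> unfolding in_set_conv_nth by blast
      then have i: "q = cyc_nth ?l i" by (simp add: cyc_nth_def)
      have "snd (fst q)" using cyc_chain_nth(2)[OF ch ne, of i] s unfolding i[symmetric] by blast
      then show False using x(2)[OF that] True by simp
    qed
    then have "cyc_ems ?l = replicate (length ?l) Minus" unfolding cyc_ems_def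
    proof (intro ems_Minus ballI)
      fix q assume "q \<in> set (last ?l # ?l)"
      then have "q \<in> set ?l" using l by blast
      then show "q = ((False, False), False)" using x True \<open>\<And>q. q \<in> set ?l \<Longrightarrow> \<not> snd q\<close> by (simp add: prod_eq_iff)
    qed
    then show False using cut by auto
  next
    case False
    have "snd q" if "q \<in> set ?l" for q
    proof (rule ccontr)
      assume s: "\<not> snd q"
      obtain i where "i < length ?l" "?l ! i = q" using \<open>q \<in> set ?l\<close> unfolding in_set_conv_nth by blast
      then have i: "q = cyc_nth ?l i" by (simp add: cyc_nth_def)
      have "cyc_nth ?l i = ((True, True), False)" using i s x[OF that] False by (simp add: prod_eq_iff)
      moreover have "fst (fst (cyc_nth ?l (i + 0 + 1)))" using x(1)[OF cyc_nth_in_set[OF ne]] False by simp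
      moreover have "\<forall>j\<in>{1..0::nat}. cyc_nth ?l (i + j) = ((False, True), False)" by simp
      ultimately show False using nb unfolding no_bad_def by blast
    qed
    then have "cyc_ems ?l = replicate (length ?l) Plus" unfolding cyc_ems_def
    proof (intro ems_Plus ballI)
      fix q assume "q \<in> set (last ?l # ?l)"
      then have "q \<in> set ?l" using l by blast
      then show "q = ((True, True), True)" using x False \<open>\<And>q. q \<in> set ?l \<Longrightarrow>  snd q\<close> by (simp add: prod_eq_iff)
    qed
    then show False using cut by auto
  qed
qed

theorem cyc_normal_hyperbolic:
  assumes "cyc_normal w"
  shows "psl_hyperbolic (word_elt w)"
proof -
  have "psl_hyperbolic (prod_pairs (enc w))"
    unfolding prod_pairs_frame psl_hyperbolic_conj
    by (rule lr_word_hyperbolic) (rule enc_both_letters[OF assms])+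
  then show ?thesis using prod_enc[OF assms] psl_conj_hyperbolic by blast
qed

section \<open>From the even subgroup to Gamma(2)\<close>

lemma word_elt_degree: "psl_Gamma2 (word_elt v * inverse psl_rho ^ length v)"
proof (induction v)
  case (Cons k v)
  have "word_elt (k # v) * inverse psl_rho ^ length (k # v)
      = alphap k * (psl_rho * (word_elt v * inverse psl_rho ^ length v) * inverse psl_rho)"
    by (simp only: word_elt_simps block_def list.size add_0_right add_Suc_right power_Suc2 mult.assoc)
  then show ?case using psl_Gamma2_mult[OF psl_Gamma2_alphap psl_Gamma2_conj[OF Cons]] by simp
qed simp

lemma rho_power: "inverse psl_rho ^ n = inverse psl_rho ^ (n mod 3)"
proof -
  have "inverse psl_rho ^ 3 = 1"
    by (simp add: power3_eq_cube mult.assoc rho_sigma_rels)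
  then have "inverse psl_rho ^ (3 * (n div 3) + n mod 3) = inverse psl_rho ^ (n mod 3)"
    by (simp only: power_add power_mult power_one mult_1_left)
  then show ?thesis by simp
qed

text \<open>Modulo Gamma(2) every \<open>block\<close> equals rho, because alpha lies in Gamma(2).
  The class of a word is therefore rho to the power of its length, and rho has order 3 in the
  quotient.\<close>

lemma psl_Gamma2_word_iff: "psl_Gamma2 (word_elt v) \<longleftrightarrow> 3 dvd length v"
proof -
  have "psl_Gamma2 (inverse psl_rho ^ length v) \<longleftrightarrow> length v mod 3 = 0"
  proof -
    have "length v mod 3 = 0 \<or> length v mod 3 = 1 \<or> length v mod 3 = 2" by linarith
    then show ?thesis by (subst rho_power)
      (auto simp: power2_eq_square rho_sigma_rels, auto simp: psl_compute psl_Gamma2_of)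
  qed
  moreover have "psl_Gamma2 (word_elt v) \<longleftrightarrow> psl_Gamma2 (inverse psl_rho ^ length v)"
    using word_elt_degree[of v] psl_Gamma2_mult_iff[of "word_elt v" "inverse psl_rho ^ length v"]
      psl_Gamma2_mult_iff[of "inverse psl_rho ^ length v" "word_elt v"] by blast
  ultimately show ?thesis by (simp add: dvd_eq_mod_eq_0)
qed

lemma psl_even_coset:
  assumes "psl_even k"
  shows "\<exists>i<3. psl_Gamma2 (k * psl_rho ^ i)"
proof -
  obtain a b c d where k: "k = psl_of (a, b, c, d)" and det: "a * d - b * c = 1" by (rule psl_cases)
  have e: "even (b + c)" "odd a \<or> odd d" using assms by (simp_all add: k psl_even_of[OF det])
  have 1: "k * psl_rho = psl_of (b, - a - b, d, - c - d)"
    using det by (simp add: k psl_compute)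
  have 2: "k * psl_rho * psl_rho = psl_of (- a - b, a, - c - d, c)"
    using det unfolding 1 by (simp add: psl_compute algebra_simps)
  have det1: "b * (- c - d) - (- a - b) * d = 1" "(- a - b) * c - a * (- c - d) = 1"
    using det by (simp_all add: algebra_simps)
  have "psl_Gamma2 k \<or> psl_Gamma2 (k * psl_rho) \<or> psl_Gamma2 (k * psl_rho * psl_rho)"
    unfolding 2 unfolding 1 unfolding k psl_Gamma2_of[OF det] psl_Gamma2_of[OF det1(1)] psl_Gamma2_of[OF det1(2)]
    using e det_odd[OF det] by auto
  then show ?thesis
  proof (elim disjE)
    assume "psl_Gamma2 k" then show ?thesis by (intro exI[of _ 0]) simp
  next
    assume "psl_Gamma2 (k * psl_rho)" then show ?thesis by (intro exI[of _ 1]) simp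
  next
    assume "psl_Gamma2 (k * psl_rho * psl_rho)" then show ?thesis
      by (intro exI[of _ 2]) (simp add: power2_eq_square mult.assoc)
  qed
qed

lemma psl_Gamma2_mult_word:
  "psl_Gamma2 (k * word_elt v) \<longleftrightarrow> psl_Gamma2 (k * psl_rho ^ length v)"
proof -
  define g where "g = word_elt v * inverse psl_rho ^ length v"
  have g: "psl_Gamma2 g" unfolding g_def by (rule word_elt_degree)
  have "word_elt v = g * psl_rho ^ length v"
    unfolding g_def psl_inverse_power[symmetric] by (simp add: mult.assoc)
  then have "k * word_elt v = (k * g * inverse k) * (k * psl_rho ^ length v)" by (simp add: mult.assoc)
  then show ?thesis using psl_Gamma2_mult_iff(1)[OF psl_Gamma2_conj[OF g]] by metis
qed

text \<open>The conjugator k found in the even subgroup is corrected by a prefix: rotating by i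
  replaces k by k times the element of the first i entries, and some i < 3 brings this into
  Gamma(2).\<close>

theorem Gamma2_normal_word_exists:
  assumes "psl_hyperbolic g" "psl_Gamma2 g"
  shows "\<exists>w h. normal_word w \<and> psl_Gamma2 h \<and> g = h * word_elt w * inverse h"
proof -
  obtain w where w: "cyc_normal w" "psl_conj (word_elt w) g"
    using normal_word_exists assms psl_Gamma2_even by blast
  then obtain k where k: "psl_even k" "g = k * word_elt w * inverse k" by (auto simp: psl_conj_def)
  have "word_elt w = inverse k * g * inverse (inverse k)" by (simp add: k(2) mult.assoc)
  then have "psl_Gamma2 (word_elt w)" using psl_Gamma2_conj assms(2) by metis
  then have len: "3 dvd length w" by (simp add: psl_Gamma2_word_iff)
  moreover have "w \<noteq> []" using w(1) by (simp add: cyc_normal_def)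
  ultimately have len3: "length w \<ge> 3" by (simp add: dvd_imp_le)
  obtain i where i: "i < 3" "psl_Gamma2 (k * psl_rho ^ i)" using psl_even_coset[OF k(1)] by blast
  define c where "c = word_elt (take i w)"
  have h: "psl_Gamma2 (k * c)" using i len3 by (simp add: c_def psl_Gamma2_mult_word)
  have "word_elt w = c * word_elt (drop i w)" by (metis append_take_drop_id word_elt_simps(3) c_def)
  moreover have "word_elt (rotate i w) = word_elt (drop i w) * c"
    using i len3 by (simp add: rotate_drop_take c_def)
  ultimately have "g = (k * c) * word_elt (rotate i w) * inverse (k * c)" by (simp add: k(2) mult.assoc)
  moreover have "normal_word (rotate i w)" using w(1) len by (simp add: normal_word_iff)
  ultimately show ?thesis using h by blast
qed

lemma entry_concat_replicate:
  assumes "n > 0"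
  shows "entry (concat (replicate n v)) i = entry v i"
proof -
  have *: "j < n * length v \<Longrightarrow> concat (replicate n v) ! j = v ! (j mod length v)" for j n
  proof (induction n arbitrary: j)
    case (Suc n)
    then show ?case by (auto simp: nth_append mod_if)
  qed simp
  show ?thesis
  proof (cases "v = []")
    case False
    then have "i mod (n * length v) < n * length v" using assms by simp
    from *[OF this] show ?thesis using assms
      by (simp add: entry_def length_concat_replicate mod_mod_cancel)
  qed simp
qed

lemma cyc_normal_concat_replicate:
  assumes "n > 0"
  shows "cyc_normal (concat (replicate n v)) \<longleftrightarrow> cyc_normal v"
proof -
  have e: "(w = replicate (length w) (-1)) \<longleftrightarrow> (\<forall>i. entry w i = -1)" if "w \<noteq> []" for w :: "int list"
  proof
    assume a: "w = replicate (length w) (-1)"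
    show "\<forall>i. entry w i = -1"
      by (subst a) (use that in \<open>simp add: entry_replicate\<close>)
  next
    assume a: "\<forall>i. entry w i = -1"
    show "w = replicate (length w) (-1)"
    proof (rule nth_equalityI)
      fix i assume "i < length w"
      then show "w ! i = replicate (length w) (-1) ! i" using a[rule_format, of i] by (simp add: entry_less)
    qed simp
  qed
  have "concat (replicate n v) = [] \<longleftrightarrow> v = []" using assms by auto
  then show ?thesis using e[of v] e[of "concat (replicate n v)"]
    unfolding cyc_normal_def entry_concat_replicate[OF assms] by (cases "v = []") auto
qed

lemma rotate_concat_replicate: "rotate (length v) (concat (replicate n v)) = concat (replicate n v)"
proof (cases n)
  case (Suc m)
  have "concat (replicate n v) = v @ concat (replicate m v)" by (simp add: Suc)
  moreover have "concat (replicate n v) = concat (replicate m v) @ v"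
    by (metis Suc concat.simps concat_append append_Nil2 replicate_Suc replicate_append_same)
  ultimately show ?thesis by (metis rotate_append)
qed simp

text \<open>An element of degree nonzero modulo 3 that commutes with the word is, up to a positive power
  of the word, a power of a common root; the root has nonzero degree, too, and the word is periodic
  with the length of the root.\<close>

lemma commuting_element_period:
  assumes w: "normal_word w" and z: "psl_even z" "z * word_elt w = word_elt w * z" "\<not> psl_Gamma2 z"
  shows "\<exists>p. \<not> 3 dvd p \<and> rotate p w = w"
proof -
  have cw: "cyc_normal w" "3 dvd length w" using w by (simp_all add: normal_word_iff)
  define u where "u = map fst (enc w)"
  define M where "M = lr_word (pair_word u)"
  obtain h where h: "psl_even h" "prod_pairs (enc w) = h * word_elt w * inverse h"
    using prod_enc[OF cw(1)] by (auto simp: psl_conj_def)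
  define x where "x = inverse frame * h"
  have M: "M = x * word_elt w * inverse x"
    using h(2) prod_pairs_frame[of "enc w"] unfolding M_def u_def x_def
    by (metis (no_types, lifting) mult.assoc psl_inverse(3) psl_inverse_inverse psl_inverse_mult psl_inverse(2) mult.right_neutral)
  define Z where "Z = x * z * inverse x"
  have ZM: "Z * M = M * Z"
  proof -
    have "Z * M = x * (z * word_elt w) * inverse x" by (simp add: Z_def M mult.assoc)
    also have "\<dots> = M * Z" by (simp only: z(2)) (simp add: Z_def M mult.assoc)
    finally show ?thesis .
  qed
  have ne: "u \<noteq> []" using enc_correct(1)[OF cw(1)] by (simp add: u_def)
  have "psl_even Z" using z(1) by (simp add: Z_def psl_even_mult_iff)
  then obtain q n where q: "Z * M ^ n = lr_word (pair_word q)" "q @ u = u @ q"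
    using conjugate_pair_words[of Z u u] ZM ne unfolding M_def by blast
  obtain a b r where r: "concat (replicate a r) = q" "concat (replicate b r) = u"
    using comm_append_are_replicate[OF q(2)] by blast
  define R where "R = lr_word (pair_word r)"
  have pw: "pair_word (concat (replicate n r)) = concat (replicate n (pair_word r))" for n
    by (induction n) auto
  have Ra: "R ^ a = Z * M ^ n" and Rb: "R ^ b = M"
    using r q(1) unfolding R_def M_def by (metis pw lr_word_concat_replicate)+
  have b: "b > 0" using r(2) ne by (cases b) auto
  have "y \<in> set (pair_word r)" for y
  proof -
    have "y \<in> set (concat (replicate b (pair_word r)))"
      using enc_both_letters[OF cw(1), of y] r(2) pw[of b] by (simp add: u_def)
    then show ?thesis using b by auto
  qed
  then have "psl_hyperbolic R" unfolding R_def by (intro lr_word_hyperbolic)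
  moreover have "psl_even R" by (simp add: R_def)
  moreover define R' where "R' = inverse x * R * inverse (inverse x)"
  ultimately have "psl_hyperbolic R'" "psl_even R'"
    by (simp only: psl_hyperbolic_conj, simp add: psl_even_mult_iff)
  then obtain v where v: "cyc_normal v" "psl_conj (word_elt v) R'" using normal_word_exists by blast
  have R'n: "R' ^ j = inverse x * R ^ j * x" for j
    unfolding R'_def psl_conj_power by simp
  have "word_elt w = R' ^ b" unfolding R'n Rb M by (simp add: mult.assoc)
  moreover obtain y where y: "psl_even y" "R' = y * word_elt v * inverse y"
    using v(2) by (auto simp: psl_conj_def)
  ultimately have "word_elt w = y * word_elt (concat (replicate b v)) * inverse y"
    by (simp add: psl_conj_power word_elt_concat_replicate)
  then have "psl_conj (word_elt (concat (replicate b v))) (word_elt w)" using y(1) unfolding psl_conj_def by blast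
  \<comment> \<open>The length of \<open>v\<close> will turn out not to be divisible by 3, so
    uniqueness is applied to \<open>cyc_normal\<close> words.\<close>
  then obtain j where j: "w = rotate j (concat (replicate b v))"
    using normal_word_unique cw(1) v(1) cyc_normal_concat_replicate[OF b] by metis
  have "rotate (length v) w = w" unfolding j rotate_rotate
    by (metis add.commute rotate_rotate rotate_concat_replicate)
  \<comment> \<open>A root in Gamma(2) would put \<open>R' ^ a\<close> into Gamma(2), which is z
    times a power of the word, and hence z as well.\<close>
  moreover have "\<not> 3 dvd length v"
  proof
    assume "3 dvd length v"
    then have "psl_Gamma2 (word_elt v)" by (simp add: psl_Gamma2_word_iff)
    then have "psl_Gamma2 R'" using y(2) psl_Gamma2_conj by metis
    then have "psl_Gamma2 (R' ^ a)" by (rule psl_Gamma2_power)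
    moreover have "R' ^ a = z * word_elt w ^ n"
      unfolding R'n Ra unfolding M psl_conj_power by (simp add: Z_def mult.assoc)
    moreover have "psl_Gamma2 (word_elt w ^ n)" using cw(2) by (intro psl_Gamma2_power) (simp add: psl_Gamma2_word_iff)
    ultimately show False using z(3) psl_Gamma2_mult_iff(2) by metis
  qed
  ultimately show ?thesis by blast
qed

lemma rotate_period: "rotate p w = w \<Longrightarrow> rotate (t * p) w = w"
  by (induction t) (simp_all add: rotate_rotate[symmetric] del: rotate_rotate)

text \<open>Uniqueness in the even subgroup gives a rotation by m'. If 3 does not divide m', the
  prefix times h is an element outside Gamma(2) that commutes with the word. The resulting period p
  is invertible modulo 3, so some m' + t p with the same effect is a multiple of 3.\<close>

theorem Gamma2_normal_word_unique:
  assumes w: "normal_word w" "normal_word w'" and h: "psl_Gamma2 h" "word_elt w' = h * word_elt w * inverse h"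
  shows "(w, w') \<in> shift_rel"
proof -
  have cw: "cyc_normal w" "cyc_normal w'" "3 dvd length w" using w by (simp_all add: normal_word_iff)
  have "psl_conj (word_elt w) (word_elt w')" unfolding psl_conj_def using h psl_Gamma2_even by blast
  then obtain m where m: "w' = rotate m w" using normal_word_unique cw by blast
  define m' where "m' = m mod length w"
  have m': "w' = rotate m' w" unfolding m m'_def by (rule rotate_conv_mod)
  have wne: "w \<noteq> []" using cw by (simp add: cyc_normal_def)
  then have less: "m' < length w" by (simp add: m'_def)
  define c where "c = word_elt (take m' w)"
  define d where "d = word_elt (drop m' w)"
  have W: "word_elt w = c * d" by (metis append_take_drop_id word_elt_simps(3) c_def d_def)
  have W': "word_elt w' = d * c" using less by (simp add: m' rotate_drop_take c_def d_def)
  define z where "z = c * h"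
  have "h * (c * d) = (d * c) * h" using h(2) unfolding W W' by (simp add: mult.assoc)
  then have z: "z * word_elt w = word_elt w * z" by (simp add: z_def W mult.assoc)
  have zg: "psl_Gamma2 z \<longleftrightarrow> 3 dvd m'"
    using psl_Gamma2_mult_iff(2)[OF h(1), of c] less by (simp add: z_def c_def psl_Gamma2_word_iff)
  show ?thesis
  proof (cases "3 dvd m'")
    case True
    then show ?thesis using m' unfolding shift_rel_def dvd_def by blast
  next
    case False
    have "psl_even z" using psl_Gamma2_even[OF h(1)] by (simp add: z_def c_def psl_even_mult_iff)
    then obtain p where p: "\<not> 3 dvd p" "rotate p w = w"
      using commuting_element_period[OF w(1) _ z] zg False by blast
    have "\<exists>t<3. 3 dvd m' + t * p"
    proof -
      have "p mod 3 = 1 \<or> p mod 3 = 2" using p(1) by presburger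
      moreover have "m' mod 3 = 1 \<or> m' mod 3 = 2" using False by presburger
      ultimately have "3 dvd m' + 1 * p \<or> 3 dvd m' + 2 * p" by presburger
      then show ?thesis by (elim disjE) (rule exI[of _ 1], simp, rule exI[of _ 2], simp)
    qed
    then obtain t where "3 dvd m' + t * p" by blast
    then obtain k where k: "m' + t * p = 3 * k" by (auto simp: dvd_def)
    have "w' = rotate (m' + t * p) w"
      using m' rotate_period[OF p(2)] by (metis rotate_rotate)
    then show ?thesis unfolding shift_rel_def k by blast
  qed
qed

section \<open>The action on the upper half-plane\<close>

abbreviation "uhp \<equiv> upper_half_plane"

lift_definition act :: "psl2z \<Rightarrow> complex \<Rightarrow> complex" is moebius_map
proof -
  fix g h assume "psl_rel g h"
  moreover have "moebius_map (imat_neg g) z = moebius_map g z" for z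
  proof (cases g rule: prod_cases4)
    case (fields a b c d)
    have "of_int (- a) * z + of_int (- b) = - (of_int a * z + of_int b)"
      "of_int (- c) * z + of_int (- d) = - (of_int c * z + of_int d)" by simp_all
    moreover have "- N / - D = N / D" for N D :: complex by simp
    ultimately show ?thesis unfolding fields imat_neg.simps moebius_map.simps by (simp only:)
  qed
  ultimately show "moebius_map g = moebius_map h" by (auto simp: psl_rel_def)
qed

lemma act_of: "a * d - b * c = 1 \<Longrightarrow> act (psl_of (a, b, c, d)) = moebius_map (a, b, c, d)"
  by (simp add: psl_of_def act.abs_eq psl_rel_def)

lemma act_in_uhp [simp]: "z \<in> uhp \<Longrightarrow> act g z \<in> uhp"
proof (cases g rule: psl_cases)
  case (1 a b c d)
  assume "z \<in> uhp"
  then have z: "Im z > 0" by (simp add: upper_half_plane_def)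
  show ?thesis unfolding 1(1) act_of[OF 1(2)] upper_half_plane_def
    using Im_moebius[OF 1(2), of z] denom_nonzero[OF z 1(2)] z by simp
qed

lemma act_one [simp]: "act 1 z = z"
  by (simp add: psl_one act_of)

lemma act_mult: "z \<in> uhp \<Longrightarrow> act (g * h) z = act g (act h z)"
proof -
  assume "z \<in> uhp"
  then have z: "Im z > 0" by (simp add: upper_half_plane_def)
  obtain a b c d p q r s where gh: "g = psl_of (p, q, r, s)" "p * s - q * r = 1"
    "h = psl_of (a, b, c, d)" "a * d - b * c = 1" by (metis psl_cases)
  have det: "(p * a + q * c) * (r * b + s * d) - (p * b + q * d) * (r * a + s * c) = 1"
    using gh(2,4) by algebra
  have "act g (act h z) = moebius_map (p, q, r, s) (moebius_map (a, b, c, d) z)"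
    by (simp only: gh(1,3) act_of[OF gh(2)] act_of[OF gh(4)])
  also have "\<dots> = (of_int p * (of_int a * z + of_int b) + of_int q * (of_int c * z + of_int d)) /
      (of_int r * (of_int a * z + of_int b) + of_int s * (of_int c * z + of_int d))"
    unfolding moebius_map.simps(1)[of a] by (rule moebius_divide[OF denom_nonzero[OF z gh(4)]])
  also have "\<dots> = moebius_map (p * a + q * c, p * b + q * d, r * a + s * c, r * b + s * d) z"
    by (simp add: algebra_simps)
  also have "\<dots> = act (g * h) z"
    using det by (simp only: gh(1,3) psl_of_mult imat_det.simps gh(2,4) imat_mult.simps act_of)
  finally show ?thesis by simp
qed

lemma act_inverse [simp]:
  "z \<in> uhp \<Longrightarrow> act (inverse g) (act g z) = z" "z \<in> uhp \<Longrightarrow> act g (act (inverse g) z) = z"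
  by (simp_all add: act_mult[symmetric])

lemma psl_Gamma2_cases:
  assumes "psl_Gamma2 g"
  obtains a b c d where "g = psl_of (a, b, c, d)" "a * d - b * c = 1" "(a, b, c, d) \<in> Gamma2"
proof (cases g rule: psl_cases)
  case (1 a b c d)
  then show ?thesis using assms that by (auto simp: psl_Gamma2_of Gamma2_def)
qed

lemma Gamma2_rel_act: "(z, w) \<in> Gamma2_rel \<longleftrightarrow> z \<in> uhp \<and> (\<exists>g. psl_Gamma2 g \<and> w = act g z)"
proof
  assume "(z, w) \<in> Gamma2_rel"
  then obtain a b c d where g: "(a, b, c, d) \<in> Gamma2" "w = moebius_map (a, b, c, d) z" "z \<in> uhp"
    by (auto simp: Gamma2_rel_def)
  then have "a * d - b * c = 1" by (simp add: Gamma2_def)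
  then have "psl_Gamma2 (psl_of (a, b, c, d))" "w = act (psl_of (a, b, c, d)) z"
    using g by (simp_all add: psl_Gamma2_of Gamma2_def act_of)
  then show "z \<in> uhp \<and> (\<exists>g. psl_Gamma2 g \<and> w = act g z)" using g by blast
next
  assume "z \<in> uhp \<and> (\<exists>g. psl_Gamma2 g \<and> w = act g z)"
  then obtain g where g: "psl_Gamma2 g" "w = act g z" "z \<in> uhp" by blast
  then obtain a b c d where *: "g = psl_of (a, b, c, d)" "a * d - b * c = 1" "(a, b, c, d) \<in> Gamma2"
    by (meson psl_Gamma2_cases)
  then have "w = moebius_map (a, b, c, d) z" using g by (simp only: act_of)
  moreover have "w \<in> uhp" using g by simp
  ultimately show "(z, w) \<in> Gamma2_rel" using *(3) g(3) unfolding Gamma2_rel_def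
    by (auto intro!: bexI[of _ "(a, b, c, d)"])
qed

lemma hyp_dist_act [simp]:
  assumes "psl_Gamma2 g" "z \<in> uhp" "w \<in> uhp"
  shows "hyp_dist (act g z) (act g w) = hyp_dist z w"
proof -
  obtain a b c d where *: "g = psl_of (a, b, c, d)" "a * d - b * c = 1" "(a, b, c, d) \<in> Gamma2"
    using assms by (meson psl_Gamma2_cases)
  show ?thesis using hyp_dist_moebius[OF assms(2,3) *(3)] by (simp only: *(1) act_of[OF *(2)])
qed

text \<open>A fixed point in the upper half-plane forces a trace of absolute value at most 2. In
  Gamma(2) the trace is even and nonzero, so it is 2 or -2, and then the vanishing discriminant
  makes the matrix the identity up to sign.\<close>

lemma act_free:
  assumes "psl_Gamma2 g" "z \<in> uhp" "act g z = z"
  shows "g = 1"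
proof -
  obtain a b c d where g: "g = psl_of (a, b, c, d)" and det: "a * d - b * c = 1" and G: "(a, b, c, d) \<in> Gamma2"
    using assms by (meson psl_Gamma2_cases)
  have par: "odd a" "odd d" "even b" "even c" using G by (auto simp: Gamma2_def)
  have z: "Im z > 0" using assms by (simp add: upper_half_plane_def)
  define x y where "x = Re z" and "y = Im z"
  have y: "y > 0" using z by (simp add: y_def)
  have "moebius_map (a, b, c, d) z = z" using assms(3) by (simp only: g act_of[OF det])
  then have e: "of_int a * z + of_int b = z * (of_int c * z + of_int d)"
    using denom_nonzero[OF z det] by (simp add: divide_eq_eq)
  have im: "a * y = c * (x * y) + c * (x * y) + d * y"
    using arg_cong[OF e, of Im] by (simp add: x_def y_def algebra_simps)
  then have im: "real_of_int a - real_of_int d = 2 * real_of_int c * x"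
  proof -
    have "y * (real_of_int a - real_of_int d - 2 * real_of_int c * x) = 0" using im by (simp add: algebra_simps)
    then show ?thesis using y by simp
  qed
  have re: "a * x + b = c * (x * x) - c * (y * y) + d * x"
    using arg_cong[OF e, of Re] by (simp add: x_def y_def algebra_simps)
  have "(real_of_int a - d)\<^sup>2 + 4 * real_of_int b * c = - 4 * (c * y)\<^sup>2"
  proof -
    have "4 * c * (a * x + b) = 4 * c * (c * (x * x) - c * (y * y) + d * x)" using re by simp
    moreover have "(real_of_int a - d) * (real_of_int a - d) = (2 * real_of_int c * x) * (2 * real_of_int c * x)"
      "4 * c * x * (real_of_int a - real_of_int d) = 4 * c * x * (2 * real_of_int c * x)"
      using im by simp_all
    ultimately show ?thesis by (simp add: power2_eq_square algebra_simps)
  qed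
  note disc = this
  have disc': "(real_of_int a - d)\<^sup>2 + 4 * real_of_int b * c = real_of_int ((a + d)\<^sup>2 - 4 * (a * d - b * c))"
    by (simp add: power2_eq_square algebra_simps)
  have "real_of_int ((a + d)\<^sup>2 - 4 * (a * d - b * c)) \<le> 0"
    unfolding disc'[symmetric] disc by simp
  then have "(a + d)\<^sup>2 \<le> 4" unfolding of_int_le_0_iff using det by simp
  then have "\<bar>a + d\<bar> \<le> 2" using abs_le_square_iff[of "a + d" 2] by simp
  \<comment> \<open>For d = -a the determinant is -a^2 - bc, which is -1 modulo 4 because a is odd
    and b, c are even; so it cannot be 1.\<close>
  moreover have "a + d \<noteq> 0"
  proof
    assume "a + d = 0"
    then have d: "d = - a" by simp
    obtain a' b' c' where "a = 2 * a' + 1" "b = 2 * b'" "c = 2 * c'" using par by (metis evenE oddE)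
    then have "- (2 * a' + 1) * (2 * a' + 1) - (2 * b') * (2 * c') = 1" using det d by (simp add: algebra_simps)
    then have "4 * (- a' * a' - a' - b' * c') = 2" by (simp add: algebra_simps)
    then show False by presburger
  qed
  moreover have "even (a + d)" using par by simp
  ultimately have tr: "a + d = 2 \<or> a + d = -2" by presburger
  have "c = 0"
  proof (rule ccontr)
    assume "c \<noteq> 0"
    then have "(real_of_int c * y)\<^sup>2 > 0" using y by simp
    then have "(real_of_int a - d)\<^sup>2 + 4 * real_of_int b * c < 0"
      using disc by linarith
    then have "(a + d)\<^sup>2 < 4" unfolding disc' of_int_less_0_iff using det by simp
    then show False using tr by auto
  qed
  moreover from this have ad: "a = d" using im by simp
  ultimately have "b = 0" using re by simp
  have "a = 1 \<or> a = -1" using tr ad by auto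
  then show ?thesis using \<open>b = 0\<close> \<open>c = 0\<close> ad by (auto simp: g psl_one psl_of_eq_iff)
qed

lemma mem_Rep_pants_proj: "z \<in> uhp \<Longrightarrow> Rep_pants (pants_proj z) = Gamma2_rel `` {z}"
  unfolding pants_proj_def by (rule Abs_pants_inverse) (rule quotientI)

lemma Rep_pants_proj_iff: "z \<in> uhp \<Longrightarrow> w \<in> Rep_pants (pants_proj z) \<longleftrightarrow> (\<exists>g. psl_Gamma2 g \<and> w = act g z)"
  by (simp add: mem_Rep_pants_proj Gamma2_rel_act)

lemma pants_proj_self: "z \<in> uhp \<Longrightarrow> z \<in> Rep_pants (pants_proj z)"
  by (auto simp: Rep_pants_proj_iff intro!: exI[of _ 1])

lemma pants_proj_eq_iff:
  assumes "z \<in> uhp" "w \<in> uhp"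
  shows "pants_proj z = pants_proj w \<longleftrightarrow> (\<exists>g. psl_Gamma2 g \<and> w = act g z)"
proof -
  have "pants_proj z = pants_proj w \<longleftrightarrow> Rep_pants (pants_proj z) = Rep_pants (pants_proj w)"
    by (simp add: Rep_pants_inject)
  also have "\<dots> \<longleftrightarrow> (z, w) \<in> Gamma2_rel"
    unfolding mem_Rep_pants_proj[OF assms(1)] mem_Rep_pants_proj[OF assms(2)]
    by (rule eq_equiv_class_iff[OF equiv_Gamma2_rel assms])
  finally show ?thesis using assms by (simp add: Gamma2_rel_act)
qed

lemma pants_proj_act [simp]: "psl_Gamma2 g \<Longrightarrow> z \<in> uhp \<Longrightarrow> pants_proj (act g z) = pants_proj z"
  using pants_proj_eq_iff[of z "act g z"] by auto

lemma pants_proj_surj: "\<exists>z\<in>uhp. pants_proj z = p"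
proof -
  obtain z where "z \<in> Rep_pants p" using Rep_pants_nonempty by blast
  then have "z \<in> uhp" "Rep_pants p = Gamma2_rel `` {z}" by (rule Rep_pants_orbit)+
  then have "Rep_pants (pants_proj z) = Rep_pants p" by (simp add: mem_Rep_pants_proj)
  then show ?thesis using \<open>z \<in> uhp\<close> by (auto simp: Rep_pants_inject)
qed

lemma dist_pants_proj_le: "z \<in> uhp \<Longrightarrow> w \<in> uhp \<Longrightarrow> dist (pants_proj z) (pants_proj w) \<le> hyp_dist z w"
  by (intro dist_pants_le pants_proj_self)

lemma dist_pants_proj_attained:
  assumes "z \<in> uhp" "w \<in> uhp"
  shows "\<exists>g. psl_Gamma2 g \<and> dist (pants_proj z) (pants_proj w) = hyp_dist z (act g w)"
  using dist_pants_attained[OF pants_proj_self[OF assms(1)], of "pants_proj w"] assms(2)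
  by (auto simp: Rep_pants_proj_iff)

section \<open>Hyperbolic distance and the Euclidean topology\<close>

lemma hyp_dist_self [simp]: "z \<in> uhp \<Longrightarrow> hyp_dist z z = 0"
  by (simp add: hyp_dist_eq_0)

lemma hyp_dist_nonneg [simp]: "z \<in> uhp \<Longrightarrow> w \<in> uhp \<Longrightarrow> hyp_dist z w \<ge> 0"
  by (rule cosh_hyp_dist(2))

lemma continuous_on_hyp_dist:
  assumes "continuous_on S f" "continuous_on S g" "\<And>x. x \<in> S \<Longrightarrow> f x \<in> uhp" "\<And>x. x \<in> S \<Longrightarrow> g x \<in> uhp"
  shows "continuous_on S (\<lambda>x. hyp_dist (f x) (g x))"
  unfolding hyp_dist_def
proof (rule continuous_on_compose2[OF continuous_on_arcosh[OF order.refl]])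
  have pos: "Im (f x) > 0" "Im (g x) > 0" if "x \<in> S" for x
    using assms(3,4)[OF that] by (simp_all add: upper_half_plane_def)
  show "continuous_on S (\<lambda>x. 1 + (cmod (f x - g x))\<^sup>2 / (2 * Im (f x) * Im (g x)))"
    by (intro continuous_intros assms) (use pos in force)
  show "(\<lambda>x. 1 + (cmod (f x - g x))\<^sup>2 / (2 * Im (f x) * Im (g x))) ` S \<subseteq> {1..}"
  proof (rule image_subsetI)
    fix x assume x: "x \<in> S"
    have "(cmod (f x - g x))\<^sup>2 / (2 * Im (f x) * Im (g x)) \<ge> 0"
      by (intro divide_nonneg_nonneg mult_nonneg_nonneg) (use pos[OF x] in simp_all)
    then show "1 + (cmod (f x - g x))\<^sup>2 / (2 * Im (f x) * Im (g x)) \<in> {1..}" by simp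
  qed
qed

text \<open>Here |z - w|^2 = 2 Im z Im w (C - 1) with C the hyperbolic cosine of the distance, and
  Im w <= 2 C Im z. The bound depends on w through the distance only and tends to 0 with it.\<close>

lemma cmod_le_hyp_dist:
  assumes "z \<in> uhp" "w \<in> uhp"
  shows "(cmod (z - w))\<^sup>2 \<le> 4 * (Im z)\<^sup>2 * (cosh (hyp_dist z w) * (cosh (hyp_dist z w) - 1))"
proof -
  define C where "C = cosh (hyp_dist z w)"
  have pos: "Im z > 0" "Im w > 0" using assms by (simp_all add: upper_half_plane_def)
  have C1: "C \<ge> 1" unfolding C_def by (rule cosh_real_ge_1)
  have e: "(cmod (z - w))\<^sup>2 = 2 * Im z * Im w * (C - 1)"
    using cosh_hyp_dist(1)[OF assms] pos by (simp add: C_def field_simps)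
  have "(Im z - Im w)\<^sup>2 \<le> (cmod (z - w))\<^sup>2"
    by (simp add: cmod_power2)
  then have "Im w * Im w + Im z * Im z \<le> C * (Im w * (Im z * 2))"
    unfolding e by (simp add: power2_eq_square algebra_simps)
  moreover have "Im z * Im z \<ge> 0" by simp
  ultimately have "Im w * Im w \<le> C * (Im w * (Im z * 2))" by linarith
  then have "Im w * Im w \<le> (2 * Im z * C) * Im w" by (simp add: algebra_simps)
  then have w: "Im w \<le> 2 * Im z * C" using pos by (simp only: mult_le_cancel_right_pos)
  have "2 * Im z * (C - 1) * Im w \<le> 2 * Im z * (C - 1) * (2 * Im z * C)"
    by (rule mult_left_mono[OF w]) (use pos C1 in simp)
  then show ?thesis unfolding e C_def[symmetric] by (simp add: power2_eq_square algebra_simps)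
qed

lemma continuous_on_of_hyp_dist:
  assumes "\<And>x. x \<in> S \<Longrightarrow> f x \<in> uhp"
    and "\<And>x. x \<in> S \<Longrightarrow> ((\<lambda>y. hyp_dist (f x) (f y)) \<longlongrightarrow> 0) (at x within S)"
  shows "continuous_on S f"
  unfolding continuous_on_def
proof
  fix x assume x: "x \<in> S"
  let ?F = "at x within S"
  let ?C = "\<lambda>y. cosh (hyp_dist (f x) (f y))"
  have "(?C \<longlongrightarrow> cosh 0) ?F"
    by (intro tendsto_intros assms(2)[OF x])
  then have "((\<lambda>y. 4 * (Im (f x))\<^sup>2 * (?C y * (?C y - 1))) \<longlongrightarrow> 4 * (Im (f x))\<^sup>2 * (1 * (1 - 1))) ?F"
    by (intro tendsto_intros) simp_all
  then have lim: "((\<lambda>y. sqrt (4 * (Im (f x))\<^sup>2 * (?C y * (?C y - 1)))) \<longlongrightarrow> 0) ?F"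
    using tendsto_real_sqrt by fastforce
  have "\<forall>\<^sub>F y in ?F. dist (f y) (f x) \<le> sqrt (4 * (Im (f x))\<^sup>2 * (?C y * (?C y - 1)))"
    unfolding eventually_at_filter
  proof (intro always_eventually allI impI)
    fix y assume "y \<in> S"
    have "dist (f y) (f x) = cmod (f x - f y)" by (simp add: dist_norm norm_minus_commute)
    then show "dist (f y) (f x) \<le> sqrt (4 * (Im (f x))\<^sup>2 * (?C y * (?C y - 1)))"
      using cmod_le_hyp_dist[OF assms(1)[OF x] assms(1)[OF \<open>y \<in> S\<close>]] by (intro real_le_rsqrt) (simp only:)
  qed
  note le = this
  have ge: "\<forall>\<^sub>F y in ?F. 0 \<le> dist (f y) (f x)" by (intro always_eventually allI zero_le_dist)
  have "((\<lambda>y. dist (f y) (f x)) \<longlongrightarrow> 0) ?F"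
    by (rule tendsto_sandwich[OF ge le tendsto_const lim])
  then show "(f \<longlongrightarrow> f x) ?F" by (subst tendsto_dist_iff)
qed

lemma continuous_on_act: "continuous_on uhp (act g)"
proof (cases g rule: psl_cases)
  case (1 a b c d)
  show ?thesis unfolding 1(1) act_of[OF 1(2)]
    by (rule continuous_on_eq[of _ "\<lambda>z. (of_int a * z + of_int b) / (of_int c * z + of_int d)"])
      (auto intro!: continuous_intros dest: denom_nonzero[OF _ 1(2)] simp: upper_half_plane_def)
qed

lemma continuous_on_act_compose:
  "continuous_on S f \<Longrightarrow> (\<And>x. x \<in> S \<Longrightarrow> f x \<in> uhp) \<Longrightarrow> continuous_on S (\<lambda>x. act g (f x))"
  by (rule continuous_on_compose2[OF continuous_on_act]) auto

lemma continuous_on_pants_proj_compose: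
  assumes "continuous_on S f" "\<And>x. x \<in> S \<Longrightarrow> f x \<in> uhp"
  shows "continuous_on S (\<lambda>x. pants_proj (f x))"
  unfolding continuous_on_def
proof
  fix x assume x: "x \<in> S"
  let ?F = "at x within S"
  have "continuous_on S (\<lambda>y. hyp_dist (f y) (f x))"
    using assms x by (intro continuous_on_hyp_dist) auto
  then have lim: "((\<lambda>y. hyp_dist (f y) (f x)) \<longlongrightarrow> 0) ?F"
    using x assms(2)[OF x] unfolding continuous_on_def by force
  have "\<forall>\<^sub>F y in ?F. dist (pants_proj (f y)) (pants_proj (f x)) \<le> hyp_dist (f y) (f x)"
    unfolding eventually_at_filter
    by (intro always_eventually allI impI dist_pants_proj_le assms(2) x)
  note le = this
  have ge: "\<forall>\<^sub>F y in ?F. 0 \<le> dist (pants_proj (f y)) (pants_proj (f x))" by (intro always_eventually allI zero_le_dist)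
  have "((\<lambda>y. dist (pants_proj (f y)) (pants_proj (f x))) \<longlongrightarrow> 0) ?F"
    by (rule tendsto_sandwich[OF ge le tendsto_const lim])
  then show "((\<lambda>x. pants_proj (f x)) \<longlongrightarrow> pants_proj (f x)) ?F" by (subst tendsto_dist_iff)
qed

section \<open>Lifts of paths and homotopies\<close>

lemma injectivity_radius_at:
  assumes z: "z \<in> uhp"
  shows "\<exists>r>0. \<forall>g. psl_Gamma2 g \<longrightarrow> g \<noteq> 1 \<longrightarrow> r \<le> hyp_dist z (act g z)"
proof -
  define F where "F = {v. (z, v) \<in> Gamma2_rel \<and> hyp_dist z v \<le> 1}"
  have fin: "finite F" unfolding F_def by (rule finite_orbit_ball[OF z z])
  define A where "A = insert 1 (hyp_dist z ` (F - {z}))"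
  have finA: "finite A" using fin by (simp add: A_def)
  have pos: "x > 0" if x: "x \<in> A" for x
  proof (cases "x = 1")
    case False
    then obtain v where v: "v \<in> F" "v \<noteq> z" "x = hyp_dist z v" using x by (auto simp: A_def)
    then have vu: "v \<in> uhp" by (auto simp: F_def Gamma2_rel_def)
    have "x \<noteq> 0" using v hyp_dist_eq_0[OF z vu] by auto
    then show ?thesis using hyp_dist_nonneg[OF z vu] v(3) by linarith
  qed simp
  show ?thesis
  proof (intro exI[of _ "Min A"] conjI allI impI)
    show "Min A > 0" using finA pos by (subst Min_gr_iff) (auto simp: A_def)
    fix g assume g: "psl_Gamma2 g" "g \<noteq> 1"
    have "act g z \<noteq> z" using act_free[OF g(1) z] g(2) by blast
    moreover have "(z, act g z) \<in> Gamma2_rel" using g z by (auto simp: Gamma2_rel_act)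
    ultimately have "hyp_dist z (act g z) \<in> A \<or> hyp_dist z (act g z) > 1" by (auto simp: A_def F_def)
    then show "Min A \<le> hyp_dist z (act g z)"
    proof
      assume "hyp_dist z (act g z) \<in> A" then show ?thesis using finA by simp
    next
      assume "hyp_dist z (act g z) > 1"
      moreover have "Min A \<le> 1" using finA by (intro Min_le) (simp_all add: A_def)
      ultimately show ?thesis by linarith
    qed
  qed
qed

text \<open>A displacement bound uniform over all points above K. It exists for compact K but not
  for the whole surface, whose cusps carry arbitrarily short loops.\<close>

definition inj_radius :: "pants set \<Rightarrow> real \<Rightarrow> bool" where
  "inj_radius K r \<longleftrightarrow> r > 0 \<and>
    (\<forall>z\<in>uhp. pants_proj z \<in> K \<longrightarrow> (\<forall>g. psl_Gamma2 g \<longrightarrow> g \<noteq> 1 \<longrightarrow> r \<le> hyp_dist z (act g z)))"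

lemma inj_radius_ball: "\<exists>e>0. inj_radius (ball p e) e"
proof -
  obtain z where z: "z \<in> uhp" "pants_proj z = p" using pants_proj_surj by blast
  obtain r where r: "r > 0" "\<And>g. psl_Gamma2 g \<Longrightarrow> g \<noteq> 1 \<Longrightarrow> r \<le> hyp_dist z (act g z)"
    using injectivity_radius_at[OF z(1)] by blast
  \<comment> \<open>Within distance r/4 of z the displacement is still at least r - 2 (r/4). The
    value r/4 is used so that the radius of the ball also serves as the bound.\<close>
  have "inj_radius (ball p (r / 4)) (r / 4)" unfolding inj_radius_def
  proof (intro conjI ballI impI allI)
    fix w g assume w: "w \<in> uhp" "pants_proj w \<in> ball p (r / 4)" and g: "psl_Gamma2 g" "g \<noteq> 1"
    obtain k where k: "psl_Gamma2 k" "dist (pants_proj z) (pants_proj w) = hyp_dist z (act k w)"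
      using dist_pants_proj_attained[OF z(1) w(1)] by blast
    define w' where "w' = act k w"
    have w': "w' \<in> uhp" using w by (simp add: w'_def)
    have d: "hyp_dist z w' < r / 4" using k w z by (simp add: w'_def)
    define g' where "g' = k * g * inverse k"
    have g': "psl_Gamma2 g'" "g' \<noteq> 1"
      using g k psl_Gamma2_conj by (auto simp: g'_def) (metis mult.right_neutral psl_inverse(2) psl_mult_cancel mult.assoc)
    have "act g' w' = act k (act g w)" using w by (simp add: g'_def w'_def act_mult)
    then have e: "hyp_dist w' (act g' w') = hyp_dist w (act g w)" using k w by (simp add: w'_def)
    have "r \<le> hyp_dist z (act g' z)" by (rule r(2)[OF g'])
    also have "\<dots> \<le> hyp_dist z w' + hyp_dist w' (act g' z)" using z w' by (intro hyp_dist_triangle) auto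
    also have "hyp_dist w' (act g' z) \<le> hyp_dist w' (act g' w') + hyp_dist (act g' w') (act g' z)"
      using z w' by (intro hyp_dist_triangle) auto
    also have "hyp_dist (act g' w') (act g' z) = hyp_dist z w'" using g' z w' by (simp add: hyp_dist_commute)
    finally show "r / 4 \<le> hyp_dist w (act g w)" using d e r(1) by simp
  qed (use r in simp)
  then show ?thesis using r(1) by (intro exI[of _ "r / 4"]) simp
qed

lemma inj_radius_compact:
  assumes "compact K"
  shows "\<exists>r. inj_radius K r"
proof -
  obtain e where e: "\<And>p. e p > 0" "\<And>p. inj_radius (ball p (e p)) (e p)"
    using inj_radius_ball by metis
  obtain C where C: "C \<subseteq> K" "finite C" "K \<subseteq> (\<Union>p\<in>C. ball p (e p))"
    using compactE_image[OF assms, of K "\<lambda>p. ball p (e p)"] e(1) by (metis (no_types, lifting) UN_I centre_in_ball open_ball subsetI)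
  have "inj_radius K (Min (insert 1 (e ` C)))" unfolding inj_radius_def
  proof (intro conjI ballI impI allI)
    show "Min (insert 1 (e ` C)) > 0" using C(2) e(1) by (subst Min_gr_iff) auto
    fix z g assume z: "z \<in> uhp" "pants_proj z \<in> K" and g: "psl_Gamma2 g" "g \<noteq> 1"
    obtain p where p: "p \<in> C" "pants_proj z \<in> ball p (e p)" using C z by blast
    have "Min (insert 1 (e ` C)) \<le> e p" using C(2) p(1) by (intro Min_le) auto
    also have "\<dots> \<le> hyp_dist z (act g z)" using e(2)[of p] p(2) z g unfolding inj_radius_def by blast
    finally show "Min (insert 1 (e ` C)) \<le> hyp_dist z (act g z)" .
  qed
  then show ?thesis by blast
qed

lemma inj_radius_eq:
  assumes "inj_radius K r" "z \<in> uhp" "pants_proj z \<in> K" "psl_Gamma2 g" "hyp_dist z (act g z) < r"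
  shows "g = 1"
  using assms unfolding inj_radius_def by force

lemma inj_radius_eq':
  assumes K: "inj_radius K r" "pants_proj z \<in> K" and z: "z \<in> uhp" "w \<in> uhp"
    and eq: "pants_proj z = pants_proj w" and less: "hyp_dist z w < r"
  shows "z = w"
proof -
  obtain g where g: "psl_Gamma2 g" "w = act g z" using eq pants_proj_eq_iff[OF z] by blast
  then have "g = 1" using inj_radius_eq[OF K(1) z(1) K(2) g(1)] less by simp
  then show ?thesis using g z by simp
qed

text \<open>The translate of w nearest to z is no farther from z than w is, hence closer than r to
  w, and so equals w.\<close>

lemma hyp_dist_eq_dist:
  assumes K: "inj_radius K r" "pants_proj z \<in> K" "pants_proj w \<in> K" and z: "z \<in> uhp" "w \<in> uhp"
    and less: "hyp_dist z w < r / 2"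
  shows "dist (pants_proj z) (pants_proj w) = hyp_dist z w"
proof -
  obtain g where g: "psl_Gamma2 g" "dist (pants_proj z) (pants_proj w) = hyp_dist z (act g w)"
    using dist_pants_proj_attained[OF z] by blast
  have "hyp_dist w (act g w) \<le> hyp_dist w z + hyp_dist z (act g w)"
    using z by (intro hyp_dist_triangle) auto
  also have "hyp_dist z (act g w) \<le> hyp_dist z w" using g(2) dist_pants_proj_le[OF z] by simp
  finally have "hyp_dist w (act g w) < r" using less by (simp add: hyp_dist_commute)
  then have "g = 1" using inj_radius_eq[OF K(1) z(2) K(3) g(1)] by simp
  then show ?thesis using g z by simp
qed

section \<open>Lifting curves and homotopies\<close>

definition is_lift :: "real set \<Rightarrow> (real \<Rightarrow> pants) \<Rightarrow> (real \<Rightarrow> complex) \<Rightarrow> bool" where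
  "is_lift S c z \<longleftrightarrow> continuous_on S z \<and> (\<forall>t\<in>S. z t \<in> uhp \<and> pants_proj (z t) = c t)"

lemma is_liftD:
  assumes "is_lift S c z"
  shows "continuous_on S z" "t \<in> S \<Longrightarrow> z t \<in> uhp" "t \<in> S \<Longrightarrow> pants_proj (z t) = c t"
  using assms by (auto simp: is_lift_def)

lemma is_lift_act: "is_lift S c z \<Longrightarrow> psl_Gamma2 g \<Longrightarrow> is_lift S c (\<lambda>t. act g (z t))"
  unfolding is_lift_def by (auto intro: continuous_on_act_compose)

text \<open>The lift is chosen pointwise as a preimage within r/4 of the given lift. No continuity
  is imposed on the choice, since the injectivity radius leaves no alternative and so forces
  it.\<close>

lemma nearby_lift:
  assumes K: "inj_radius K r" and z0: "is_lift S c0 z0"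
    and c1: "continuous_on S c1" "\<And>t. t \<in> S \<Longrightarrow> c1 t \<in> K"
    and near: "\<And>t. t \<in> S \<Longrightarrow> dist (c0 t) (c1 t) < r / 4"
  shows "\<exists>z1. is_lift S c1 z1 \<and> (\<forall>t\<in>S. hyp_dist (z0 t) (z1 t) < r / 4)"
proof -
  have r: "r > 0" using K by (simp add: inj_radius_def)
  have "\<exists>w. w \<in> uhp \<and> pants_proj w = c1 t \<and> hyp_dist (z0 t) w < r / 4" if t: "t \<in> S" for t
  proof -
    obtain w where w: "w \<in> uhp" "pants_proj w = c1 t" using pants_proj_surj by blast
    obtain g where "psl_Gamma2 g" "dist (pants_proj (z0 t)) (pants_proj w) = hyp_dist (z0 t) (act g w)"
      using dist_pants_proj_attained is_liftD(2)[OF z0 t] w by blast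
    then show ?thesis using w near[OF t] is_liftD(3)[OF z0 t] by (intro exI[of _ "act g w"]) simp
  qed
  then obtain z1 where z1: "\<And>t. t \<in> S \<Longrightarrow> z1 t \<in> uhp" "\<And>t. t \<in> S \<Longrightarrow> pants_proj (z1 t) = c1 t"
    "\<And>t. t \<in> S \<Longrightarrow> hyp_dist (z0 t) (z1 t) < r / 4" by metis
  have "continuous_on S z1"
  proof (rule continuous_on_of_hyp_dist)
    fix t assume t: "t \<in> S"
    let ?F = "at t within S"
    have u: "z0 t \<in> uhp" by (rule is_liftD(2)[OF z0 t])
    have "continuous_on S (\<lambda>s. hyp_dist (z0 t) (z0 s))"
      using is_liftD[OF z0] t by (intro continuous_on_hyp_dist) auto
    then have "((\<lambda>s. hyp_dist (z0 t) (z0 s)) \<longlongrightarrow> 0) ?F"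
      using t u unfolding continuous_on_def by force
    then have ev0: "\<forall>\<^sub>F s in ?F. hyp_dist (z0 t) (z0 s) < r / 4"
      using r by (intro order_tendstoD) auto
    have lim: "((\<lambda>s. dist (c1 t) (c1 s)) \<longlongrightarrow> dist (c1 t) (c1 t)) ?F"
      using c1(1) t unfolding continuous_on_def by (intro tendsto_intros) auto
    then have ev1: "\<forall>\<^sub>F s in ?F. dist (c1 t) (c1 s) < r / 4"
      using r by (intro order_tendstoD) auto
    have "\<forall>\<^sub>F s in ?F. s \<in> S" by (simp add: eventually_at_filter)
    with ev0 ev1 have "\<forall>\<^sub>F s in ?F. dist (c1 t) (c1 s) = hyp_dist (z1 t) (z1 s)"
    proof eventually_elim
      case (elim s)
      have us: "z0 s \<in> uhp" by (rule is_liftD(2)[OF z0 elim(3)])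
      obtain g where g: "psl_Gamma2 g" "dist (c1 t) (c1 s) = hyp_dist (z1 t) (act g (z1 s))"
        using dist_pants_proj_attained[OF z1(1)[OF t] z1(1)[OF elim(3)]] z1(2) t elim(3) by auto
      \<comment> \<open>The path through \<open>z0 s\<close>, \<open>z0 t\<close> and
        \<open>z1 t\<close> has four legs shorter than r/4, so the displacement is below r and g =
        1.\<close>
      have "hyp_dist (z1 s) (act g (z1 s)) \<le> hyp_dist (z1 s) (z0 s) + hyp_dist (z0 s) (act g (z1 s))"
        "hyp_dist (z0 s) (act g (z1 s)) \<le> hyp_dist (z0 s) (z0 t) + hyp_dist (z0 t) (act g (z1 s))"
        "hyp_dist (z0 t) (act g (z1 s)) \<le> hyp_dist (z0 t) (z1 t) + hyp_dist (z1 t) (act g (z1 s))"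
        using u us z1(1) t elim(3) by (intro hyp_dist_triangle; simp)+
      then have "hyp_dist (z1 s) (act g (z1 s)) < r"
        using z1(3)[OF t] z1(3)[OF elim(3)] g(2) elim(1,2)
        by (simp add: hyp_dist_commute[of "z1 s" "z0 s"] hyp_dist_commute[of "z0 s" "z0 t"])
      then have "g = 1" using inj_radius_eq[OF K z1(1)[OF elim(3)]] z1(2)[OF elim(3)] c1(2)[OF elim(3)] g(1) by simp
      then show ?case using g(2) z1(1)[OF elim(3)] by simp
    qed
    from Lim_transform_eventually[OF lim this] show "((\<lambda>s. hyp_dist (z1 t) (z1 s)) \<longlongrightarrow> 0) ?F" by simp
  qed (rule z1(1))
  then show ?thesis using z1 unfolding is_lift_def by blast
qed

text \<open>After matching at one point, the distance of the two lifts is a continuous function on a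
  connected set that is either 0 or at least r, hence identically 0.\<close>

lemma lift_unique:
  assumes z: "is_lift S c z" "is_lift S c z'" and S: "compact S" "connected S" "S \<noteq> {}"
  shows "\<exists>g. psl_Gamma2 g \<and> (\<forall>t\<in>S. z' t = act g (z t))"
proof -
  have "compact ((\<lambda>t. pants_proj (z t)) ` S)"
    using is_liftD[OF z(1)] S by (intro compact_continuous_image continuous_on_pants_proj_compose) auto
  then obtain r where r: "inj_radius ((\<lambda>t. pants_proj (z t)) ` S) r" using inj_radius_compact by blast
  obtain t0 where t0: "t0 \<in> S" using S by blast
  have "pants_proj (z t0) = pants_proj (z' t0)" using is_liftD(3)[OF z(1) t0] is_liftD(3)[OF z(2) t0] by simp
  then obtain g where g: "psl_Gamma2 g" "z' t0 = act g (z t0)"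
    using pants_proj_eq_iff[OF is_liftD(2)[OF z(1) t0] is_liftD(2)[OF z(2) t0]] by blast
  define f where "f t = hyp_dist (act g (z t)) (z' t)" for t
  have cont: "continuous_on S f" unfolding f_def
    using is_liftD[OF z(1)] is_liftD[OF z(2)] by (intro continuous_on_hyp_dist continuous_on_act_compose) auto
  have dich: "f t = 0 \<or> f t \<ge> r" if "t \<in> S" for t
  proof (rule ccontr)
    assume "\<not> ?thesis"
    then have "hyp_dist (act g (z t)) (z' t) < r" "f t \<noteq> 0" by (auto simp: f_def)
    then have "act g (z t) = z' t"
      using is_liftD[OF z(1)] is_liftD[OF z(2)] that g(1) by (intro inj_radius_eq'[OF r]) auto
    then show False using \<open>f t \<noteq> 0\<close> is_liftD(2)[OF z(2) that] by (simp add: f_def)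
  qed
  have f0: "f t0 = 0" using g is_liftD(2)[OF z(2) t0] by (simp add: f_def)
  have r0: "r > 0" using r by (simp add: inj_radius_def)
  have "f t = 0" if t: "t \<in> S" for t
  proof (rule ccontr)
    assume "f t \<noteq> 0"
    then have "f t \<ge> r" using dich[OF t] by blast
    moreover have "connected (f ` S)" using cont S by (intro connected_continuous_image) auto
    then have "{f t0..f t} \<subseteq> f ` S" using t0 t by (intro connected_contains_Icc) auto
    ultimately have "r / 2 \<in> f ` S" using f0 r0 by auto
    then obtain s where "s \<in> S" "f s = r / 2" by auto
    then show False using dich[of s] r0 by auto
  qed
  then have "z' t = act g (z t)" if "t \<in> S" for t
    using that is_liftD(2)[OF z(1) that] is_liftD(2)[OF z(2) that] hyp_dist_eq_0[of "act g (z t)" "z' t"]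
    by (simp add: f_def)
  with g(1) show ?thesis by blast
qed

text \<open>Only the curves at the parameters k/n are lifted, each close to the preceding one,
  instead of the whole square. If the homotopy runs through closed curves, the deck transformation
  joining the endpoints is carried along: both ends move by less than r/4, too little for it to
  change.\<close>

lemma homotopy_lift_end:
  assumes h: "continuous_on ({0..1} \<times> {0..1}) (h :: real \<times> real \<Rightarrow> pants)"
    and z: "is_lift {0..1} (\<lambda>t. h (0, t)) z"
  shows "\<exists>z'. is_lift {0..1} (\<lambda>t. h (1, t)) z' \<and>
    ((\<forall>s\<in>{0..1}. h (s, 1) = h (s, 0)) \<longrightarrow> (\<forall>g. psl_Gamma2 g \<longrightarrow> z 1 = act g (z 0) \<longrightarrow> z' 1 = act g (z' 0)))"
proof -
  define K where "K = h ` ({0..1} \<times> {0..1})"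
  have comp: "compact ({0..1::real} \<times> {0..1::real})" by (intro compact_Times compact_Icc)
  have "compact K" unfolding K_def by (rule compact_continuous_image[OF h comp])
  then obtain r where r: "inj_radius K r" using inj_radius_compact by blast
  have r0: "r > 0" using r by (simp add: inj_radius_def)
  have "uniformly_continuous_on ({0..1} \<times> {0..1}) h" by (rule compact_uniformly_continuous[OF h comp])
  then obtain d where d: "d > 0" "\<And>x y. x \<in> {0..1} \<times> {0..1} \<Longrightarrow> y \<in> {0..1} \<times> {0..1} \<Longrightarrow> dist y x < d \<Longrightarrow> dist (h y) (h x) < r / 4"
    using r0 unfolding uniformly_continuous_on_def by (metis divide_pos_pos zero_less_numeral)
  obtain n :: nat where n: "n > 0" "1 / real n < d"
    using d(1) by (metis nat_approx_posE zero_less_Suc)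
  have "\<exists>z'. is_lift {0..1} (\<lambda>t. h (real k / n, t)) z' \<and>
    ((\<forall>s\<in>{0..1}. h (s, 1) = h (s, 0)) \<longrightarrow> (\<forall>g. psl_Gamma2 g \<longrightarrow> z 1 = act g (z 0) \<longrightarrow> z' 1 = act g (z' 0)))" if "k \<le> n" for k
    using that
  proof (induction k)
    case 0
    then show ?case using z by auto
  next
    case (Suc k)
    then obtain z0 where z0: "is_lift {0..1} (\<lambda>t. h (real k / n, t)) z0"
      "(\<forall>s\<in>{0..1}. h (s, 1) = h (s, 0)) \<longrightarrow> (\<forall>g. psl_Gamma2 g \<longrightarrow> z 1 = act g (z 0) \<longrightarrow> z0 1 = act g (z0 0))"
      by auto
    let ?s = "real k / n" and ?s' = "real (Suc k) / n"
    have s: "?s \<in> {0..1}" "?s' \<in> {0..1}" using Suc.prems n by (auto simp: divide_simps)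
    have "\<exists>z1. is_lift {0..1} (\<lambda>t. h (?s', t)) z1 \<and> (\<forall>t\<in>{0..1}. hyp_dist (z0 t) (z1 t) < r / 4)"
    proof (rule nearby_lift[OF r z0(1)])
      show "continuous_on {0..1} (\<lambda>t. h (?s', t))"
        by (rule continuous_on_compose2[OF h]) (use s in \<open>auto intro!: continuous_intros\<close>)
      show "h (?s', t) \<in> K" if "t \<in> {0..1}" for t using that s by (auto simp: K_def)
      show "dist (h (?s, t)) (h (?s', t)) < r / 4" if t: "t \<in> {0..1}" for t
      proof (rule d(2))
        have "dist (?s, t) (?s', t) = \<bar>?s - ?s'\<bar>" by (simp add: dist_Pair_Pair dist_real_def)
        also have "\<dots> = 1 / n" using n by (simp add: divide_simps)
        finally show "dist (?s, t) (?s', t) < d" using n by simp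
      qed (use s t in auto)
    qed
    then obtain z1 where z1: "is_lift {0..1} (\<lambda>t. h (?s', t)) z1" "\<And>t. t \<in> {0..1} \<Longrightarrow> hyp_dist (z0 t) (z1 t) < r / 4"
      by blast
    have "z1 1 = act g (z1 0)" if cl: "\<forall>s\<in>{0..1}. h (s, 1) = h (s, 0)" and g: "psl_Gamma2 g" "z 1 = act g (z 0)" for g
    proof -
      have e: "z0 1 = act g (z0 0)" using z0(2) cl g by blast
      have u: "z0 0 \<in> uhp" "z1 0 \<in> uhp" "z0 1 \<in> uhp" "z1 1 \<in> uhp"
        using is_liftD(2)[OF z0(1)] is_liftD(2)[OF z1(1)] by auto
      show ?thesis
      proof (rule inj_radius_eq'[OF r])
        show "pants_proj (z1 1) \<in> K" using is_liftD(3)[OF z1(1), of 1] s by (auto simp: K_def)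
        show "pants_proj (z1 1) = pants_proj (act g (z1 0))"
          using is_liftD(3)[OF z1(1), of 1] is_liftD(3)[OF z1(1), of 0] cl s g u by simp
        have "hyp_dist (z1 1) (act g (z1 0)) \<le> hyp_dist (z1 1) (z0 1) + hyp_dist (z0 1) (act g (z1 0))"
          using u by (intro hyp_dist_triangle) auto
        also have "hyp_dist (z0 1) (act g (z1 0)) = hyp_dist (z0 0) (z1 0)" using u g by (simp add: e)
        finally show "hyp_dist (z1 1) (act g (z1 0)) < r"
          using z1(2)[of 0] z1(2)[of 1] r0 by (simp add: hyp_dist_commute)
      qed (use u in auto)
    qed
    then show ?case using z1(1) by blast
  qed
  from this[of n] n show ?thesis by simp
qed

text \<open>The homotopy h(s, t) = c(st) contracts the path to its starting point, where a constant
  lift exists.\<close>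

lemma path_lift:
  assumes c: "continuous_on {0..1} (c :: real \<Rightarrow> pants)"
  shows "\<exists>z. is_lift {0..1} c z"
proof -
  obtain z0 where z0: "z0 \<in> uhp" "pants_proj z0 = c 0" using pants_proj_surj by blast
  define h where "h = (\<lambda>(s::real, t). c (s * t))"
  have "continuous_on ({0..1} \<times> {0..1}) h" unfolding h_def case_prod_beta
    by (rule continuous_on_compose2[OF c])
      (auto intro!: continuous_intros mult_nonneg_nonneg mult_le_one)
  moreover have "is_lift {0..1} (\<lambda>t. h (0, t)) (\<lambda>_. z0)"
    using z0 by (simp add: is_lift_def h_def)
  ultimately obtain z where "is_lift {0..1} (\<lambda>t. h (1, t)) z" using homotopy_lift_end by blast
  then show ?thesis by (auto simp: h_def)
qed

text \<open>A relation rather than a function: another lift of the same closed path replaces g by a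
  conjugate in Gamma(2).\<close>

definition monodromy :: "(real \<Rightarrow> pants) \<Rightarrow> psl2z \<Rightarrow> bool" where
  "monodromy c g \<longleftrightarrow> psl_Gamma2 g \<and> (\<exists>z. is_lift {0..1} c z \<and> z 1 = act g (z 0))"

lemma monodromy_exists:
  assumes "path c" "pathfinish c = pathstart c"
  shows "\<exists>g. monodromy c g"
proof -
  obtain z where z: "is_lift {0..1} c z" using path_lift assms by (auto simp: path_def)
  have "pants_proj (z 0) = pants_proj (z 1)"
    using is_liftD(3)[OF z, of 0] is_liftD(3)[OF z, of 1] assms(2) by (simp add: pathfinish_def pathstart_def)
  then obtain g where "psl_Gamma2 g" "z 1 = act g (z 0)"
    using pants_proj_eq_iff is_liftD(2)[OF z, of 0] is_liftD(2)[OF z, of 1] by auto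
  then show ?thesis using z by (auto simp: monodromy_def)
qed

text \<open>Two lifts differ by some k in Gamma(2), so g' k and k g agree at a point, and the action
  is free.\<close>

lemma monodromy_unique:
  assumes "monodromy c g" "monodromy c g'"
  shows "\<exists>k. psl_Gamma2 k \<and> g' = k * g * inverse k"
proof -
  obtain z where z: "is_lift {0..1} c z" "z 1 = act g (z 0)" "psl_Gamma2 g" using assms(1) by (auto simp: monodromy_def)
  obtain z' where z': "is_lift {0..1} c z'" "z' 1 = act g' (z' 0)" "psl_Gamma2 g'" using assms(2) by (auto simp: monodromy_def)
  obtain k where k: "psl_Gamma2 k" "\<And>t. t \<in> {0..1} \<Longrightarrow> z' t = act k (z t)"
    using lift_unique[OF z(1) z'(1)] by auto
  have u: "z 0 \<in> uhp" using is_liftD(2)[OF z(1)] by simp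
  have "act (g' * k) (z 0) = act (k * g) (z 0)"
    using u k(2)[of 0] k(2)[of 1] z(2) z'(2) by (simp add: act_mult)
  then have "act (inverse (k * g) * (g' * k)) (z 0) = act (inverse (k * g)) (act (k * g) (z 0))"
    by (simp only: act_mult[OF u, of "inverse (k * g)"])
  also have "\<dots> = z 0" using u by (rule act_inverse)
  finally have "act (inverse (k * g) * (g' * k)) (z 0) = z 0" .
  moreover have "psl_Gamma2 (inverse (k * g) * (g' * k))"
    using z z' k by (intro psl_Gamma2_mult) (simp_all add: psl_Gamma2_mult del: psl_inverse_mult)
  ultimately have "inverse (k * g) * (g' * k) = 1" using act_free u by blast
  then have "g' * k = k * g" by (metis mult.right_neutral psl_inverse(4))
  then have "g' = k * g * inverse k" by (metis mult.assoc mult.right_neutral psl_inverse(2))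
  then show ?thesis using k(1) by blast
qed

lemma monodromy_conj:
  assumes "monodromy c g" "psl_Gamma2 k"
  shows "monodromy c (k * g * inverse k)"
proof -
  obtain z where z: "is_lift {0..1} c z" "z 1 = act g (z 0)" "psl_Gamma2 g" using assms(1) by (auto simp: monodromy_def)
  have u: "z 0 \<in> uhp" using is_liftD(2)[OF z(1)] by simp
  have "act k (z 1) = act (k * g * inverse k) (act k (z 0))"
    using u z(2) by (simp add: act_mult)
  then show ?thesis using is_lift_act[OF z(1) assms(2)] psl_Gamma2_conj[OF z(3)] by (auto simp: monodromy_def)
qed

lemma monodromy_homotopic:
  assumes "monodromy c0 g" "homotopic_loops UNIV c0 c1"
  shows "monodromy c1 g"
proof -
  obtain h where h: "continuous_on ({0..1::real} \<times> {0..1::real}) h" "\<forall>x\<in>{0..1}. h (0, x) = c0 x"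
      "\<forall>x\<in>{0..1}. h (1, x) = c1 x" "\<forall>t\<in>{0..1}. pathfinish (h \<circ> Pair t) = pathstart (h \<circ> Pair t)"
    using assms(2) unfolding homotopic_loops by blast
  obtain z where z: "is_lift {0..1} c0 z" "z 1 = act g (z 0)" "psl_Gamma2 g" using assms(1) by (auto simp: monodromy_def)
  have "is_lift {0..1} (\<lambda>t. h (0, t)) z" using z(1) h(2) by (simp add: is_lift_def)
  from homotopy_lift_end[OF h(1) this] obtain z' where z': "is_lift {0..1} (\<lambda>t. h (1, t)) z'"
    "(\<forall>s\<in>{0..1}. h (s, 1) = h (s, 0)) \<longrightarrow> (\<forall>g. psl_Gamma2 g \<longrightarrow> z 1 = act g (z 0) \<longrightarrow> z' 1 = act g (z' 0))" by blast
  have "\<forall>s\<in>{0..1}. h (s, 1) = h (s, 0)" using h(4) by (simp add: pathfinish_def pathstart_def)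
  then have "z' 1 = act g (z' 0)" using z'(2) z by blast
  moreover have "is_lift {0..1} c1 z'" using z'(1) h(3) by (simp add: is_lift_def)
  ultimately show ?thesis using z(3) by (auto simp: monodromy_def)
qed

lemma convex_uhp: "convex uhp"
  unfolding upper_half_plane_def using convex_halfspace_Im_gt[of 0] by simp

lemma linepath_in_uhp: "z \<in> uhp \<Longrightarrow> w \<in> uhp \<Longrightarrow> t \<in> {0..1} \<Longrightarrow> linepath z w t \<in> uhp"
  using convexD_alt[OF convex_uhp, of z w t] by (simp add: linepath_def)

text \<open>The half-plane is convex, so the lift can be moved linearly to the segment with the same
  endpoints. Those stay related by g, and the projected paths remain closed.\<close>

lemma homotopic_to_segment:
  assumes z: "is_lift {0..1} c z" "z 1 = act g (z 0)" "psl_Gamma2 g"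
  shows "homotopic_loops UNIV c (pants_proj \<circ> linepath (z 0) (act g (z 0)))"
  unfolding homotopic_loops
proof (intro exI conjI)
  let ?l = "linepath (z 0) (act g (z 0))"
  let ?h = "\<lambda>(s, t). pants_proj (linepath (z t) (?l t) s)"
  have u: "z t \<in> uhp" "?l t \<in> uhp" if "t \<in> {0..1}" for t
    using is_liftD(2)[OF z(1)] that by (auto intro!: linepath_in_uhp)
  have cz: "continuous_on ({0..1} \<times> {0..1}) (\<lambda>x::real\<times>real. z (snd x))"
    by (rule continuous_on_compose2[OF is_liftD(1)[OF z(1)]]) (auto intro!: continuous_intros)
  show "continuous_on ({0..1} \<times> {0..1}) ?h" unfolding case_prod_beta
  proof (rule continuous_on_pants_proj_compose)
    show "continuous_on ({0..1} \<times> {0..1}) (\<lambda>x. linepath (z (snd x)) (?l (snd x)) (fst x))"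
      unfolding linepath_def by (intro continuous_intros cz)
    show "linepath (z (snd x)) (?l (snd x)) (fst x) \<in> uhp" if "x \<in> {0..1} \<times> {0..1}" for x
      using that u by (intro linepath_in_uhp) auto
  qed
  show "\<forall>x\<in>{0..1}. ?h (0, x) = c x" using is_liftD(3)[OF z(1)] by (simp add: linepath_def)
  show "\<forall>x\<in>{0..1}. ?h (1, x) = (pants_proj \<circ> ?l) x" by (simp add: linepath_def)
  show "\<forall>t\<in>{0..1}. pathfinish (?h \<circ> Pair t) = pathstart (?h \<circ> Pair t)"
  proof
    fix t :: real assume "t \<in> {0..1}"
    have "linepath (z 1) (?l 1) t = act g (z 0)" "linepath (z 0) (?l 0) t = z 0"
      using z(2) by (simp_all add: linepath_def algebra_simps)
    then show "pathfinish (?h \<circ> Pair t) = pathstart (?h \<circ> Pair t)"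
      using z(3) u(1)[of 0] by (simp add: pathfinish_def pathstart_def)
  qed
qed auto

text \<open>Moving the base point along a segment carries the segment to its image under g along
  with it, so free homotopy depends on g alone.\<close>

lemma homotopic_segments:
  assumes z: "z \<in> uhp" "w \<in> uhp" and g: "psl_Gamma2 g"
  shows "homotopic_loops UNIV (pants_proj \<circ> linepath z (act g z)) (pants_proj \<circ> linepath w (act g w))"
  unfolding homotopic_loops
proof (intro exI conjI)
  let ?l = "linepath z w"
  let ?h = "\<lambda>(s, t). pants_proj (linepath (?l s) (act g (?l s)) t)"
  have u: "?l t \<in> uhp" "act g (?l t) \<in> uhp" if "t \<in> {0..1}" for t
    using linepath_in_uhp[OF z that] by simp_all
  show "continuous_on ({0..1} \<times> {0..1}) ?h" unfolding case_prod_beta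
  proof (rule continuous_on_pants_proj_compose)
    have "continuous_on ({0..1} \<times> {0..1}) (\<lambda>x::real\<times>real. act g (?l (fst x)))"
      by (rule continuous_on_act_compose) (use u in \<open>auto simp: linepath_def intro!: continuous_intros\<close>)
    then show "continuous_on ({0..1} \<times> {0..1}) (\<lambda>x. linepath (?l (fst x)) (act g (?l (fst x))) (snd x))"
      unfolding linepath_def by (intro continuous_intros)
    show "linepath (?l (fst x)) (act g (?l (fst x))) (snd x) \<in> uhp" if "x \<in> {0..1} \<times> {0..1}" for x
      using that by (auto intro!: linepath_in_uhp act_in_uhp z)
  qed
  show "\<forall>x\<in>{0..1}. ?h (0, x) = (pants_proj \<circ> linepath z (act g z)) x" by (simp add: linepath_def)
  show "\<forall>x\<in>{0..1}. ?h (1, x) = (pants_proj \<circ> linepath w (act g w)) x" by (simp add: linepath_def)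
  show "\<forall>t\<in>{0..1}. pathfinish (?h \<circ> Pair t) = pathstart (?h \<circ> Pair t)"
    using u g by (simp add: pathfinish_def pathstart_def linepath_0' linepath_1')
qed auto

lemma homotopic_of_monodromy:
  assumes "monodromy c0 g" "monodromy c1 g"
  shows "homotopic_loops UNIV c0 c1"
proof -
  obtain z where z: "is_lift {0..1} c0 z" "z 1 = act g (z 0)" "psl_Gamma2 g" using assms(1) by (auto simp: monodromy_def)
  obtain w where w: "is_lift {0..1} c1 w" "w 1 = act g (w 0)" using assms(2) by (auto simp: monodromy_def)
  have "z 0 \<in> uhp" "w 0 \<in> uhp" using is_liftD(2)[OF z(1)] is_liftD(2)[OF w(1)] by auto
  then show ?thesis
    using homotopic_to_segment[OF z] homotopic_to_segment[OF w(1,2) z(3)] homotopic_segments[OF _ _ z(3)]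
    by (meson homotopic_loops_sym homotopic_loops_trans)
qed

section \<open>Monodromy of the word loops\<close>

definition based_lift :: "(real \<Rightarrow> pants) \<Rightarrow> psl2z \<Rightarrow> bool" where
  "based_lift c g \<longleftrightarrow> (\<exists>z. is_lift {0..1} c z \<and> z 0 = \<i> \<and> z 1 = act g \<i>)"

lemma i_in_uhp [simp]: "\<i> \<in> uhp"
  by (simp add: upper_half_plane_def)

lemma based_lift_const: "based_lift (\<lambda>_. pants_proj \<i>) 1"
  unfolding based_lift_def is_lift_def by (intro exI[of _ "\<lambda>_. \<i>"]) simp

lemma based_lift_pathstart: "based_lift c g \<Longrightarrow> pathstart c = pants_proj \<i>"
  by (auto simp: based_lift_def is_lift_def pathstart_def dest: bspec[of _ _ 0])

text \<open>The lift of the second loop has to start where the first lift ends, so it is translated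
  by g and ends at the image of the base point under g g'. Concatenation thus corresponds to
  multiplication in the same order.\<close>

lemma based_lift_join:
  assumes "based_lift c g" "based_lift c' g'" "psl_Gamma2 g"
  shows "based_lift (c +++ c') (g * g')"
proof -
  obtain z where z: "is_lift {0..1} c z" "z 0 = \<i>" "z 1 = act g \<i>" using assms(1) by (auto simp: based_lift_def)
  obtain z' where z': "is_lift {0..1} c' z'" "z' 0 = \<i>" "z' 1 = act g' \<i>" using assms(2) by (auto simp: based_lift_def)
  let ?w = "\<lambda>t. act g (z' t)"
  have w: "is_lift {0..1} c' ?w" by (rule is_lift_act[OF z'(1) assms(3)])
  have "is_lift {0..1} (c +++ c') (z +++ ?w)" unfolding is_lift_def
  proof
    have "path (z +++ ?w)" using is_liftD(1)[OF z(1)] is_liftD(1)[OF w] z z'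
      by (intro path_join_imp) (simp_all add: path_def pathfinish_def pathstart_def)
    then show "continuous_on {0..1} (z +++ ?w)" by (simp add: path_def)
    show "\<forall>t\<in>{0..1}. (z +++ ?w) t \<in> uhp \<and> pants_proj ((z +++ ?w) t) = (c +++ c') t"
      using is_liftD(2,3)[OF z(1)] is_liftD(2,3)[OF w] by (auto simp: joinpaths_def)
  qed
  moreover have "(z +++ ?w) 0 = \<i>" "(z +++ ?w) 1 = act (g * g') \<i>"
    using z z' by (simp_all add: joinpaths_def act_mult)
  ultimately show ?thesis by (auto simp: based_lift_def)
qed

lemma based_lift_reverse:
  assumes "based_lift c g" "psl_Gamma2 g"
  shows "based_lift (reversepath c) (inverse g)"
proof -
  obtain z where z: "is_lift {0..1} c z" "z 0 = \<i>" "z 1 = act g \<i>" using assms(1) by (auto simp: based_lift_def)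
  have "is_lift {0..1} (reversepath c) (reversepath z)"
    using is_liftD[OF z(1)] by (auto simp: is_lift_def reversepath_def intro!: continuous_on_compose2[of "{0..1}" z] continuous_intros)
  then have "is_lift {0..1} (reversepath c) (\<lambda>t. act (inverse g) (reversepath z t))"
    using assms(2) by (intro is_lift_act) simp_all
  then show ?thesis unfolding based_lift_def
    by (intro exI[of _ "\<lambda>t. act (inverse g) (reversepath z t)"]) (simp add: reversepath_def z)
qed

lemma based_lift_path_pow:
  assumes "based_lift c g" "psl_Gamma2 g"
  shows "based_lift (path_pow c n) (g ^ n)"
proof (induction n)
  case 0
  then show ?case using based_lift_pathstart[OF assms(1)] based_lift_const by simp
next
  case (Suc n)
  then show ?case using based_lift_join[OF assms(1) _ assms(2)] by simp
qed

lemma based_lift_loop_of: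
  assumes "(a, b, c, d) \<in> Gamma2"
  shows "based_lift (loop_of (a, b, c, d)) (psl_of (a, b, c, d))"
proof -
  have det: "a * d - b * c = 1" using assms by (simp add: Gamma2_def)
  let ?g = "psl_of (a, b, c, d)"
  have "loop_of (a, b, c, d) = pants_proj \<circ> linepath \<i> (act ?g \<i>)"
    unfolding loop_of_def act_of[OF det] ..
  moreover have "linepath \<i> (act ?g \<i>) t \<in> uhp" if "t \<in> {0..1}" for t
    using that by (intro linepath_in_uhp act_in_uhp) auto
  ultimately show ?thesis unfolding based_lift_def is_lift_def
    by (intro exI[of _ "linepath \<i> (act ?g \<i>)"]) (auto simp: linepath_def intro!: continuous_intros)
qed

lemma alphap_power: "alphap 1 ^ n = alphap (int n)"
  by (induction n) (simp_all add: alphap_add[symmetric])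

text \<open>Stated for conjugates of alpha, so that it covers the loops around all three punctures
  at once.\<close>

lemma based_lift_powi:
  assumes c: "based_lift c (h * alphap 1 * inverse h)"
  shows "based_lift (path_powi c k) (h * alphap k * inverse h)"
proof -
  have G: "psl_Gamma2 (h * alphap 1 * inverse h)" by (intro psl_Gamma2_conj) simp
  have p: "(h * alphap 1 * inverse h) ^ n = h * alphap (int n) * inverse h" for n
    by (simp only: psl_conj_power alphap_power)
  show ?thesis
  proof (cases "k \<ge> 0")
    case True
    then show ?thesis using based_lift_path_pow[OF c G, of "nat k"] by (simp add: path_powi_def p)
  next
    case False
    have "inverse (h * alphap 1 * inverse h) ^ nat (- k) = inverse (h * alphap (- k) * inverse h)"
      using False by (simp only: psl_inverse_power[symmetric] p) simp
    also have "\<dots> = h * alphap k * inverse h" by (simp add: alphap_inverse mult.assoc)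
    finally show ?thesis using based_lift_path_pow[OF based_lift_reverse[OF c G], of "nat (- k)"] False G
      by (simp only: path_powi_def psl_Gamma2_inverse) simp
  qed
qed

lemma based_lift_generators:
  "based_lift loop_alpha (1 * alphap 1 * inverse 1)"
  "based_lift loop_beta (psl_rho * alphap 1 * inverse psl_rho)"
  "based_lift loop_gamma (inverse psl_rho * alphap 1 * inverse (inverse psl_rho))"
proof -
  have "1 * alphap 1 * inverse 1 = psl_of (1, 2, 0, 1)" by (simp add: psl_compute)
  moreover have "psl_rho * alphap 1 * inverse psl_rho = psl_of (1, 0, -2, 1)" by (simp add: psl_compute)
  moreover have "inverse psl_rho * alphap 1 * inverse (inverse psl_rho) = psl_of (1, -2, 2, -3)"
    by (simp add: psl_compute)
  ultimately show "based_lift loop_alpha (1 * alphap 1 * inverse 1)"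
    "based_lift loop_beta (psl_rho * alphap 1 * inverse psl_rho)"
    "based_lift loop_gamma (inverse psl_rho * alphap 1 * inverse (inverse psl_rho))"
    unfolding loop_alpha_def loop_beta_def loop_gamma_def
    by (simp_all only:) (rule based_lift_loop_of; simp add: Gamma2_def)+
qed

lemma based_lift_word:
  assumes "3 dvd length w"
  shows "based_lift (word_loop w) (word_elt w)"
  using assms
proof (induction w rule: word_loop.induct)
  case (1 l m n w)
  let ?a = "1 * alphap l * inverse 1" and ?b = "psl_rho * alphap m * inverse psl_rho"
    and ?c = "inverse psl_rho * alphap n * inverse (inverse psl_rho)"
  have "3 dvd length w" using 1(2) by simp presburger
  then have "based_lift (word_loop w) (word_elt w)" by (rule 1(1))
  then have "based_lift (word_loop (l # m # n # w)) (?a * (?b * (?c * word_elt w)))"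
    unfolding word_loop.simps
    by (intro based_lift_join based_lift_powi based_lift_generators psl_Gamma2_conj psl_Gamma2_alphap)
  also have "?a * (?b * (?c * word_elt w)) = word_elt (l # m # n # w)"
    by (simp add: block_def mult.assoc rho_sigma_rels)
  finally show ?case .
next
  case ("2_1")
  then show ?case using based_lift_const by simp
qed (auto dest: dvd_imp_le)

theorem monodromy_word_loop:
  assumes "3 dvd length w"
  shows "monodromy (word_loop w) (word_elt w)"
  using based_lift_word[OF assms] assms psl_Gamma2_word_iff by (auto simp: based_lift_def monodromy_def)

section \<open>Geodesics in Lorentzian coordinates\<close>

type_synonym lvec = "real \<times> real \<times> real"

fun lform :: "lvec \<Rightarrow> lvec \<Rightarrow> real" where
  "lform (a, b, c) (p, q, r) = a * r + c * p - 2 * b * q"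

text \<open>These are the entries of the symmetric matrix \<open>M M\<^sup>T\<close> with \<open>M \<i> = z\<close>; then \<open>lform\<close> is the
  polarised determinant and \<open>g\<close> acts by \<open>S \<mapsto> g S g\<^sup>T\<close>.\<close>

definition coords :: "complex \<Rightarrow> lvec" where
  "coords z = (1 / Im z, Re z / Im z, ((Re z)\<^sup>2 + (Im z)\<^sup>2) / Im z)"

fun lpoint :: "lvec \<Rightarrow> complex" where
  "lpoint (a, b, c) = Complex (b / a) (1 / a)"

definition cone :: "lvec \<Rightarrow> bool" where
  "cone P \<longleftrightarrow> fst P \<ge> 0 \<and> snd (snd P) \<ge> 0 \<and> lform P P = 0"

text \<open>A triple (p, q, r) is the symmetric matrix with rows (r, q) and (q, p): the first
  coordinate is the lower right entry.\<close>

lift_definition lact :: "psl2z \<Rightarrow> lvec \<Rightarrow> lvec" is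
  "\<lambda>(a, b, c, d) (p, q, r). ((of_int c)\<^sup>2 * r + 2 * of_int c * of_int d * q + (of_int d)\<^sup>2 * p,
     of_int a * of_int c * r + (of_int a * of_int d + of_int b * of_int c) * q + of_int b * of_int d * p,
     (of_int a)\<^sup>2 * r + 2 * of_int a * of_int b * q + (of_int b)\<^sup>2 * p)"
  by (auto simp: psl_rel_def fun_eq_iff)

lemma lact_of: "a * d - b * c = 1 \<Longrightarrow> lact (psl_of (a, b, c, d)) (p, q, r) =
   ((of_int c)\<^sup>2 * r + 2 * of_int c * of_int d * q + (of_int d)\<^sup>2 * p,
     of_int a * of_int c * r + (of_int a * of_int d + of_int b * of_int c) * q + of_int b * of_int d * p,
     (of_int a)\<^sup>2 * r + 2 * of_int a * of_int b * q + (of_int b)\<^sup>2 * p)"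
  by (simp add: psl_of_def lact.abs_eq psl_rel_def)

lemma lform_commute: "lform P Q = lform Q P"
  by (cases P; cases Q) simp

lemma lform_add: "lform (P + P') Q = lform P Q + lform P' Q" "lform Q (P + P') = lform Q P + lform Q P'"
  by (cases P; cases P'; cases Q; simp add: algebra_simps)+

lemma lform_scale: "lform (k *\<^sub>R P) Q = k * lform P Q" "lform Q (k *\<^sub>R P) = k * lform Q P"
  by (cases P; cases Q; simp add: algebra_simps)+

lemma lact_linear: "lact g (P + Q) = lact g P + lact g Q" "lact g (k *\<^sub>R P) = k *\<^sub>R lact g P"
  by (cases g rule: psl_cases; cases P; cases Q; simp add: lact_of algebra_simps)+

lemma lform_lact: "lform (lact g P) (lact g Q) = lform P Q"
proof -
  obtain a b c d where g: "g = psl_of (a, b, c, d)" "a * d - b * c = 1" by (rule psl_cases)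
  obtain p q r p' q' r' where P: "P = (p, q, r)" "Q = (p', q', r')" by (metis prod.exhaust)
  have det: "real_of_int a * of_int d - of_int b * of_int c = 1"
    using arg_cong[OF g(2), of real_of_int] by simp
  show ?thesis unfolding P lform.simps g(1) lact_of[OF g(2)] using det by algebra
qed

lemma coords_lpoint:
  assumes "a > 0" "a * c - b\<^sup>2 = 1"
  shows "coords (lpoint (a, b, c)) = (a, b, c)" "lpoint (a, b, c) \<in> uhp"
proof -
  have "b * b + 1 = a * c" using assms(2) by (simp add: power2_eq_square)
  then have "((b / a)\<^sup>2 + (1 / a)\<^sup>2) / (1 / a) = c"
    using assms(1) by (simp add: field_simps power2_eq_square)
  then show "coords (lpoint (a, b, c)) = (a, b, c)" using assms(1) by (simp add: coords_def)
  show "lpoint (a, b, c) \<in> uhp" using assms by (simp add: upper_half_plane_def)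
qed

lemma lpoint_coords: "z \<in> uhp \<Longrightarrow> lpoint (coords z) = z"
  by (simp add: coords_def upper_half_plane_def complex_eq_iff)

lemma coords_inject: "z \<in> uhp \<Longrightarrow> w \<in> uhp \<Longrightarrow> coords z = coords w \<longleftrightarrow> z = w"
  by (metis lpoint_coords)

lemma lform_coords:
  assumes "z \<in> uhp" "w \<in> uhp"
  shows "lform (coords z) (coords w) = 2 * cosh (hyp_dist z w)"
proof -
  have "Im z > 0" "Im w > 0" using assms by (simp_all add: upper_half_plane_def)
  then show ?thesis unfolding cosh_hyp_dist(1)[OF assms] coords_def lform.simps cmod_power2
    by (simp add: field_simps power2_eq_square)
qed

lemma lform_coords_self: "z \<in> uhp \<Longrightarrow> lform (coords z) (coords z) = 2"
  by (simp add: lform_coords)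

lemma coords_act:
  assumes "z \<in> uhp"
  shows "coords (act g z) = lact g (coords z)"
proof -
  obtain a b c d where g: "g = psl_of (a, b, c, d)" "a * d - b * c = 1" by (rule psl_cases)
  have z: "Im z > 0" using assms by (simp add: upper_half_plane_def)
  define x y where "x = Re z" and "y = Im z"
  have y: "y > 0" using z by (simp add: y_def)
  define A B C D :: real where "A = of_int a" and "B = of_int b" and "C = of_int c" and "D = of_int d"
  have det: "A * D - B * C = 1" unfolding A_def B_def C_def D_def
    using arg_cong[OF g(2), of real_of_int] by simp
  define n where "n = (C * x + D)\<^sup>2 + (C * y)\<^sup>2"
  have nz: "of_int c * z + of_int d \<noteq> 0" by (rule denom_nonzero[OF z g(2)])
  have n2: "(cmod (of_int c * z + of_int d))\<^sup>2 = n"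
    by (simp add: n_def C_def D_def x_def y_def cmod_power2)
  have "(cmod (of_int c * z + of_int d))\<^sup>2 > 0" using nz by simp
  then have n: "n > 0" "(cmod (of_int c * z + of_int d))\<^sup>2 = n" using n2 by simp_all
  have im: "Im (act g z) = y / n"
    unfolding g(1) act_of[OF g(2)] Im_moebius[OF g(2)] n(2) y_def ..
  have re: "Re (act g z) = ((A * x + B) * (C * x + D) + A * C * y\<^sup>2) / n"
    unfolding g(1) act_of[OF g(2)] moebius_map.simps Re_divide
    by (simp add: n_def A_def B_def C_def D_def x_def y_def power2_eq_square algebra_simps)
  have sq: "(Re (act g z))\<^sup>2 + (Im (act g z))\<^sup>2 = ((A * x + B)\<^sup>2 + (A * y)\<^sup>2) / n"
  proof -
    have "((A * x + B) * (C * x + D) + A * C * y\<^sup>2)\<^sup>2 + y\<^sup>2 = ((A * x + B)\<^sup>2 + (A * y)\<^sup>2) * n"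
      unfolding n_def using det by algebra
    then show ?thesis unfolding re im using n(1) by (simp add: power_divide field_simps power2_eq_square)
  qed
  have e: "coords (act g z) = (n / y, ((A * x + B) * (C * x + D) + A * C * y\<^sup>2) / y, ((A * x + B)\<^sup>2 + (A * y)\<^sup>2) / y)"
    unfolding coords_def sq unfolding im re using n(1) y by (simp add: field_simps)
  show ?thesis unfolding e unfolding g(1) coords_def lact_of[OF g(2)] x_def[symmetric] y_def[symmetric]
    A_def[symmetric] B_def[symmetric] C_def[symmetric] D_def[symmetric]
    using y by (simp add: n_def field_simps power2_eq_square)
qed

section \<open>Geodesic lines and axes of hyperbolic elements\<close>

definition geoline :: "lvec \<Rightarrow> lvec \<Rightarrow> bool" where
  "geoline P N \<longleftrightarrow> cone P \<and> cone N \<and> lform P N = 1"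

text \<open>A geodesic of the hyperboloid model, with null vectors P and N over its endpoints for t
  tending to infinity and to minus infinity. Points have \<open>lform V V = 2\<close>; the
  normalisation \<open>lform P N = 1\<close> puts the curve on this hyperboloid, with unit
  speed.\<close>

definition line_vec :: "lvec \<Rightarrow> lvec \<Rightarrow> real \<Rightarrow> lvec" where
  "line_vec P N t = exp t *\<^sub>R P + exp (- t) *\<^sub>R N"

definition line :: "lvec \<Rightarrow> lvec \<Rightarrow> real \<Rightarrow> complex" where
  "line P N t = lpoint (line_vec P N t)"

lemma cone_zero: "cone (p, q, r) \<Longrightarrow> p = 0 \<Longrightarrow> q = 0"
  by (simp add: cone_def)

lemma line_vec_form:
  assumes "geoline P N"
  shows "lform (line_vec P N s) (line_vec P N t) = 2 * cosh (s - t)"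
proof -
  have z: "lform P P = 0" "lform N N = 0" "lform P N = 1" "lform N P = 1"
    using assms lform_commute[of N P] by (simp_all add: geoline_def cone_def)
  have "lform (line_vec P N s) (line_vec P N t) = exp s * exp (- t) + exp (- s) * exp t"
    unfolding line_vec_def by (simp add: lform_add lform_scale z)
  also have "\<dots> = 2 * cosh (s - t)" by (simp add: cosh_def exp_diff exp_minus field_simps)
  finally show ?thesis .
qed

lemma line_props:
  assumes "geoline P N"
  shows "line P N t \<in> uhp" "coords (line P N t) = line_vec P N t"
proof -
  obtain p q r p' q' r' where P: "P = (p, q, r)" "N = (p', q', r')" by (metis prod.exhaust)
  obtain a b c where v: "line_vec P N t = (a, b, c)" by (metis prod.exhaust)
  have "lform (line_vec P N t) (line_vec P N t) = 2" using line_vec_form[OF assms, of t t] by simp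
  then have Q: "a * c - b\<^sup>2 = 1" by (simp add: v power2_eq_square)
  have a: "a = exp t * p + exp (- t) * p'" using v by (simp add: line_vec_def P)
  have cn: "cone (p, q, r)" "cone (p', q', r')" "lform (p, q, r) (p', q', r') = 1"
    using assms by (simp_all add: geoline_def P)
  then have pp: "p \<ge> 0" "p' \<ge> 0" by (simp_all add: cone_def)
  have "a > 0"
  proof (rule ccontr)
    assume "\<not> a > 0"
    moreover have "exp t * p \<ge> 0" "exp (- t) * p' \<ge> 0" using pp by simp_all
    ultimately have "exp t * p = 0" "exp (- t) * p' = 0" using a by linarith+
    then have "p = 0" "p' = 0" by simp_all
    then show False using cn cone_zero[of p q r] cone_zero[of p' q' r'] by simp
  qed
  then show "line P N t \<in> uhp" "coords (line P N t) = line_vec P N t"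
    unfolding line_def v using coords_lpoint[OF _ Q] by auto
qed

lemma hyp_dist_line:
  assumes "geoline P N"
  shows "hyp_dist (line P N s) (line P N t) = \<bar>s - t\<bar>"
proof -
  have "cosh (hyp_dist (line P N s) (line P N t)) = cosh (s - t)"
    using lform_coords[OF line_props(1)[OF assms, of s] line_props(1)[OF assms, of t]]
    by (simp add: line_props(2)[OF assms] line_vec_form[OF assms])
  then have "cosh (hyp_dist (line P N s) (line P N t)) = cosh \<bar>s - t\<bar>" by (simp add: cosh_def abs_if add.commute)
  then show ?thesis using hyp_dist_nonneg line_props(1)[OF assms]
    by (metis abs_ge_zero arcosh_cosh_real)
qed

text \<open>P is the expanded and N the contracted eigenvector, and v is the translation length. As
  v > 0, the direction of the line is the one in which g moves it, which encodes the
  orientation.\<close>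

definition axis_of :: "psl2z \<Rightarrow> real \<Rightarrow> lvec \<Rightarrow> lvec \<Rightarrow> bool" where
  "axis_of g v P N \<longleftrightarrow> v > 0 \<and> geoline P N \<and> lact g P = exp v *\<^sub>R P \<and> lact g N = exp (- v) *\<^sub>R N"

lemma axis_act:
  assumes "axis_of g v P N"
  shows "act g (line P N t) = line P N (t + v)"
proof -
  have G: "geoline P N" using assms by (simp add: axis_of_def)
  have "coords (act g (line P N t)) = lact g (line_vec P N t)"
    by (simp add: coords_act line_props[OF G])
  also have "\<dots> = line_vec P N (t + v)"
    using assms by (simp add: line_vec_def lact_linear axis_of_def mult_exp_exp)
  also have "\<dots> = coords (line P N (t + v))" by (simp add: line_props[OF G])
  finally show ?thesis using coords_inject line_props(1)[OF G] act_in_uhp by blast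
qed

lemma axis_power:
  assumes "axis_of g v P N" "n > 0"
  shows "axis_of (g ^ n) (real n * v) P N"
proof -
  have mult: "lact (g * h) Q = lact g (lact h Q)" for g h Q
  proof -
    obtain a b c d p q r s where gh: "g = psl_of (a, b, c, d)" "a * d - b * c = 1"
      "h = psl_of (p, q, r, s)" "p * s - q * r = 1" by (metis psl_cases)
    have det: "(a * p + b * r) * (c * q + d * s) - (a * q + b * s) * (c * p + d * r) = 1"
      using gh(2,4) by algebra
    obtain x y w where Q: "Q = (x, y, w)" by (metis prod.exhaust)
    show ?thesis unfolding gh(1,3) Q
      by (simp add: psl_of_mult gh(2,4) lact_of det) (auto simp: power2_eq_square algebra_simps)
  qed
  have one: "lact 1 Q = Q" for Q by (cases Q) (simp add: psl_one lact_of)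
  have "lact (g ^ n) P = exp (real n * v) *\<^sub>R P \<and> lact (g ^ n) N = exp (- (real n * v)) *\<^sub>R N"
  proof (induction n)
    case (Suc n)
    then show ?case using assms(1) by (simp add: mult lact_linear axis_of_def mult_exp_exp algebra_simps)
  qed (simp add: one)
  then show ?thesis using assms by (simp add: axis_of_def)
qed

text \<open>Orthogonal null vectors in Lorentzian space are proportional: all 2 by 2 minors of the
  two coordinate triples vanish. The sign conditions of the cone make the factor positive.\<close>

lemma cone_proportional:
  assumes P: "cone P" "P \<noteq> 0" and Q: "cone Q" "Q \<noteq> 0" and PQ: "lform P Q = 0"
  shows "\<exists>k>0. Q = k *\<^sub>R P"
proof -
  obtain p q r p' q' r' where e: "P = (p, q, r)" "Q = (p', q', r')" by (metis prod.exhaust)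
  have h: "p \<ge> 0" "r \<ge> 0" "p * r = q * q" "p' \<ge> 0" "r' \<ge> 0" "p' * r' = q' * q'" "p * r' + r * p' = 2 * q * q'"
    using assms by (simp_all add: e cone_def)
  have "(p * r' - r * p')\<^sup>2 = (p * r' + r * p')\<^sup>2 - 4 * (p * r) * (p' * r')" by (simp add: power2_eq_square algebra_simps)
  also have "\<dots> = 0" unfolding h(3,6,7) by (simp add: power2_eq_square algebra_simps)
  finally have 1: "p * r' = r * p'" by simp
  then have 2: "p * r' = q * q'" using h(7) by (simp add: mult.commute)
  have "(p * q' - q * p')\<^sup>2 = p * p * (q' * q') + p' * p' * (q * q) - 2 * p * p' * (q * q')" by (simp add: power2_eq_square algebra_simps)
  also have "\<dots> = p * p' * (p * r' + p' * r - 2 * (q * q'))" unfolding h(3,6)[symmetric] by (simp add: algebra_simps)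
  also have "\<dots> = 0" using h(7) by (simp add: algebra_simps)
  finally have 3: "p * q' = q * p'" by simp
  have "(r * q' - q * r')\<^sup>2 = r * r * (q' * q') + r' * r' * (q * q) - 2 * r * r' * (q * q')" by (simp add: power2_eq_square algebra_simps)
  also have "\<dots> = r * r' * (r * p' + r' * p - 2 * (q * q'))" unfolding h(3,6)[symmetric] by (simp add: algebra_simps)
  also have "\<dots> = 0" using h(7) by (simp add: algebra_simps)
  finally have 4: "r * q' = q * r'" by simp
  show ?thesis
  proof (cases "p = 0")
    case False
    then have p: "p > 0" using h by simp
    have Qe: "Q = (p' / p) *\<^sub>R P" using p 1 3 by (simp add: e field_simps)
    moreover have "p' \<noteq> 0" using Q(2) Qe by (auto simp: e zero_prod_def)
    ultimately show ?thesis using p h(4) by (intro exI[of _ "p' / p"]) auto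
  next
    case True
    then have q: "q = 0" using h by simp
    then have r: "r > 0" using P(2) True h by (auto simp: e zero_prod_def less_le)
    have "p' = 0" "q' = 0" using 1 4 True q r by auto
    then have "r' > 0" using Q(2) h by (auto simp: e zero_prod_def less_le)
    then show ?thesis using r True q \<open>p' = 0\<close> \<open>q' = 0\<close> by (intro exI[of _ "r' / r"]) (simp add: e)
  qed
qed

text \<open>\<open>lact g\<close> preserves the form and expands both P and P', so their product is
  multiplied by exp (v + v') and must be 0. Hence the null vectors agree up to factors k and 1/k,
  which amounts to a shift by ln k.\<close>

lemma axis_unique:
  assumes "axis_of g v P N" "axis_of g v' P' N'"
  shows "v' = v \<and> (\<exists>d. \<forall>t. line P' N' t = line P N (t + d))"
proof -
  have a: "v > 0" "cone P" "cone N" "lform P N = 1" "lact g P = exp v *\<^sub>R P" "lact g N = exp (- v) *\<^sub>R N"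
    "v' > 0" "cone P'" "cone N'" "lform P' N' = 1" "lact g P' = exp v' *\<^sub>R P'" "lact g N' = exp (- v') *\<^sub>R N'"
    using assms by (simp_all add: axis_of_def geoline_def)
  have l0: "lform 0 Q = 0" "lform Q 0 = 0" for Q by (cases Q; simp add: zero_prod_def)+
  have ne: "P \<noteq> 0" "N \<noteq> 0" "P' \<noteq> 0" "N' \<noteq> 0" using a(4,10) l0 by (metis zero_neq_one)+
  have "lform P P' = exp (v + v') * lform P P'"
    using lform_lact[of g P P'] by (simp add: a lform_scale exp_add mult.commute)
  moreover have "exp (v + v') \<noteq> 1" using a by simp
  ultimately have "lform P P' = 0" by simp
  then obtain k where k: "k > 0" "P' = k *\<^sub>R P" using cone_proportional a ne by blast
  have "lform N N' = exp (- (v + v')) * lform N N'"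
    using lform_lact[of g N N'] by (simp add: a lform_scale exp_add exp_diff exp_minus field_simps)
  moreover have "exp (- (v + v')) \<noteq> 1" using a by simp
  ultimately have "lform N N' = 0" by simp
  then obtain m where m: "m > 0" "N' = m *\<^sub>R N" using cone_proportional a ne by blast
  have km: "k * m = 1" using a(4,10) by (simp add: k m lform_scale mult.commute)
  have "exp v' *\<^sub>R P' = lact g P'" by (simp only: a(11))
  also have "\<dots> = exp v *\<^sub>R P'" by (simp add: k(2) lact_linear a(5) mult.commute)
  finally have v: "v' = v" using ne by simp
  have "line P' N' t = line P N (t + ln k)" for t
  proof -
    have "m = exp (- ln k)" using km k by (simp add: exp_minus field_simps)
    then have "line_vec P' N' t = line_vec P N (t + ln k)"
      using k(1) unfolding line_vec_def k(2) m(2) by (simp add: exp_add) (simp add: exp_diff exp_minus field_simps)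
    then show ?thesis by (simp add: line_def)
  qed
  with v show ?thesis by blast
qed

text \<open>The vector (1, x, x^2) is the symmetric square of (x, 1), which is an eigenvector of the
  matrix if x is a fixed point. Its eigenvalue under \<open>lact g\<close> is the square of that of
  the matrix, whence v = 2 ln l.\<close>

lemma hyperbolic_axis:
  assumes "psl_hyperbolic g"
  shows "\<exists>v P N. axis_of g v P N"
proof -
  have "\<exists>a b c d. g = psl_of (a, b, c, d) \<and> a * d - b * c = 1 \<and> a + d > 2"
  proof -
    obtain a b c d where g: "g = psl_of (a, b, c, d)" "a * d - b * c = 1" by (rule psl_cases)
    then have "\<bar>a + d\<bar> > 2" using assms by (simp add: psl_hyperbolic_of)
    then consider "a + d > 2" | "(- a) + (- d) > 2" by linarith
    then show ?thesis
    proof cases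
      case 2
      moreover have "g = psl_of (- a, - b, - c, - d)" using g psl_of_neg[of "(a, b, c, d)"] by simp
      moreover have "(- a) * (- d) - (- b) * (- c) = 1" using g(2) by simp
      ultimately show ?thesis by blast
    qed (use g in blast)
  qed
  then obtain a b c d where g: "g = psl_of (a, b, c, d)" "a * d - b * c = 1" "a + d > 2" by blast
  have c0: "c \<noteq> 0"
  proof
    assume "c = 0"
    then have "a * d = 1" using g by simp
    then show False using g(3) zmult_eq_1_iff[of a d] by auto
  qed
  define A B C D :: real where "A = of_int a" and "B = of_int b" and "C = of_int c" and "D = of_int d"
  have det: "A * D - B * C = 1" unfolding A_def B_def C_def D_def
    using arg_cong[OF g(2), of real_of_int] by simp
  have C0: "C \<noteq> 0" using c0 by (simp add: C_def)
  define T where "T = A + D"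
  have T: "T > 2" using g(3) unfolding T_def A_def D_def by linarith
  define E where "E = sqrt (T\<^sup>2 - 4)"
  have "T\<^sup>2 > 2\<^sup>2" using T by (intro power_strict_mono) auto
  then have E: "E > 0" "E * E = T * T - 4" by (simp_all add: E_def power2_eq_square[symmetric])
  define l where "l = (T + E) / 2"
  define m where "m = (T - E) / 2"
  have lm: "l * m = 1" "l + m = T" "l > 1"
  proof -
    have "4 * (l * m) = T * T - E * E" by (simp add: l_def m_def field_simps)
    then show "l * m = 1" using E(2) by simp
    show "l + m = T" by (simp add: l_def m_def field_simps)
    show "l > 1" using E T by (simp add: l_def)
  qed
  have l2: "l * l = T * l - 1" and m2: "m * m = T * m - 1"
    using lm by (simp_all flip: lm(2) add: algebra_simps)
  define x where "x = (l - D) / C"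
  define x' where "x' = (m - D) / C"
  have xx: "C * x + D = l" "C * x' + D = m" using C0 by (simp_all add: x_def x'_def)
  have root: "A * y + B = t * y" if y: "C * y = t - D" and t: "t * t = T * t - 1" for y t
  proof -
    have "C * (A * y + B) = A * (C * y) + B * C" by (simp add: algebra_simps)
    also have "\<dots> = A * t - 1" unfolding y using det by (simp add: algebra_simps)
    also have "\<dots> = t * t - t * D" unfolding t T_def by (simp add: algebra_simps)
    also have "\<dots> = t * (C * y)" unfolding y by (simp add: algebra_simps)
    finally have "C * (A * y + B) = C * (t * y)" by (simp add: algebra_simps)
    then show ?thesis using C0 by simp
  qed
  have ev: "A * x + B = l * x" "A * x' + B = m * x'"
    using root[of x l] root[of x' m] xx l2 m2 by (simp_all add: eq_diff_eq)
  have act_sq: "lact g (1, y, y * y) = ((C * y + D)\<^sup>2, (A * y + B) * (C * y + D), (A * y + B)\<^sup>2)" for y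
    unfolding g(1) lact_of[OF g(2)] A_def[symmetric] B_def[symmetric] C_def[symmetric] D_def[symmetric]
    by (simp add: power2_eq_square algebra_simps)
  \<comment> \<open>The product of (1, x, x^2) and (1, x', x'^2) under \<open>lform\<close> is (x -
    x')^2.\<close>
  define n where "n = 1 / (x - x')\<^sup>2"
  have "C * (x - x') = E" unfolding right_diff_distrib using xx by (simp add: l_def m_def field_simps)
  then have ne: "x \<noteq> x'" using E by auto
  define v where "v = 2 * ln l"
  have ev': "exp v = l\<^sup>2" "exp (- v) = m\<^sup>2"
  proof -
    show 1: "exp v = l\<^sup>2" using lm(3) unfolding v_def by (simp add: exp_double)
    have "m = 1 / l" using lm by (simp add: field_simps)
    then show "exp (- v) = m\<^sup>2" by (simp add: exp_minus 1 power_divide field_simps)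
  qed
  have "v > 0" using lm(3) by (simp add: v_def)
  moreover have "geoline (1, x, x * x) (n *\<^sub>R (1, x', x' * x'))"
    using ne unfolding geoline_def cone_def lform_scale
    by (simp add: n_def) (simp add: power2_eq_square field_simps)
  moreover have "lact g (1, x, x * x) = exp v *\<^sub>R (1, x, x * x)"
    unfolding act_sq xx ev ev' by (simp add: power2_eq_square algebra_simps)
  moreover have "lact g (n *\<^sub>R (1, x', x' * x')) = exp (- v) *\<^sub>R (n *\<^sub>R (1, x', x' * x'))"
    unfolding lact_linear act_sq xx ev ev' by (simp add: power2_eq_square algebra_simps)
  ultimately show ?thesis unfolding axis_of_def by blast
qed

text \<open>A vector of the cone is the symmetric square of some (x, y). That vector is an
  eigenvector of the matrix with an eigenvalue m satisfying m^2 = exp v, and the trace m + 1/m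
  exceeds 2 in absolute value.\<close>

lemma axis_hyperbolic:
  assumes "axis_of g v P N"
  shows "psl_hyperbolic g"
proof -
  obtain a b c d where g: "g = psl_of (a, b, c, d)" "a * d - b * c = 1" by (rule psl_cases)
  obtain p q r where P: "P = (p, q, r)" by (metis prod.exhaust)
  define A B C D :: real where "A = of_int a" and "B = of_int b" and "C = of_int c" and "D = of_int d"
  have det: "A * D - B * C = 1" unfolding A_def B_def C_def D_def
    using arg_cong[OF g(2), of real_of_int] by simp
  have ax: "v > 0" "cone P" "lform P N = 1" "lact g P = exp v *\<^sub>R P"
    using assms by (simp_all add: axis_of_def geoline_def)
  have cn: "p \<ge> 0" "r \<ge> 0" "p * r = q * q" using ax(2) by (simp_all add: P cone_def)
  have eq: "C\<^sup>2 * r + 2 * C * D * q + D\<^sup>2 * p = exp v * p"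
    "A * C * r + (A * D + B * C) * q + B * D * p = exp v * q"
    "A\<^sup>2 * r + 2 * A * B * q + B\<^sup>2 * p = exp v * r"
    using ax(4) unfolding P g(1) lact_of[OF g(2)] A_def B_def C_def D_def by simp_all
  define k where "k = exp (v / 2)"
  have k: "k > 1" "k * k = exp v" using ax(1) by (simp_all add: k_def flip: exp_add)
  obtain x y where xy: "p = y * y" "q = x * y" "r = x * x"
  proof (cases "q \<ge> 0")
    case True
    have "q = sqrt r * sqrt p" using cn True by (simp add: real_sqrt_mult[symmetric] mult.commute)
    then show thesis using cn by (intro that[of "sqrt p" "sqrt r"]) simp_all
  next
    case False
    have "- q = sqrt r * sqrt p" using cn False by (simp add: real_sqrt_mult[symmetric] mult.commute real_sqrt_abs2)
    then show thesis using cn by (intro that[of "sqrt p" "- sqrt r"]) simp_all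
  qed
  have nz: "x \<noteq> 0 \<or> y \<noteq> 0"
  proof (rule ccontr)
    assume "\<not> ?thesis"
    then have "P = 0" by (simp add: P xy zero_prod_def)
    then show False using ax(3) by (cases N) (simp add: zero_prod_def)
  qed
  define X Y where "X = A * x + B * y" and "Y = C * x + D * y"
  have XY: "Y * Y = (k * y) * (k * y)" "X * Y = (k * x) * (k * y)" "X * X = (k * x) * (k * x)"
  proof -
    have "Y * Y = C\<^sup>2 * r + 2 * C * D * q + D\<^sup>2 * p" by (simp add: Y_def xy power2_eq_square algebra_simps)
    then show "Y * Y = (k * y) * (k * y)" using eq(1) k(2) by (simp add: xy algebra_simps)
    have "X * Y = A * C * r + (A * D + B * C) * q + B * D * p" by (simp add: X_def Y_def xy algebra_simps)
    then show "X * Y = (k * x) * (k * y)" using eq(2) k(2) by (simp add: xy algebra_simps)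
    have "X * X = A\<^sup>2 * r + 2 * A * B * q + B\<^sup>2 * p" by (simp add: X_def xy power2_eq_square algebra_simps)
    then show "X * X = (k * x) * (k * x)" using eq(3) k(2) by (simp add: xy algebra_simps)
  qed
  have "\<exists>m. m * m = k * k \<and> X = m * x \<and> Y = m * y"
  proof (cases "y = 0")
    case False
    define m where "m = Y / y"
    have m: "Y = m * y" using False by (simp add: m_def)
    then have "(m * m) * (y * y) = (k * k) * (y * y)" using XY(1) by (simp add: algebra_simps)
    then have mm: "m * m = k * k" using False by simp
    then have "m \<noteq> 0" using k(1) by auto
    have "X * (m * y) = (m * x) * (m * y)" using XY(2) mm m by algebra
    moreover have "m * y \<noteq> 0" using \<open>m \<noteq> 0\<close> False by simp
    ultimately have "X = m * x" by (metis mult_right_cancel)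
    then show ?thesis using m mm by blast
  next
    case True
    then have x: "x \<noteq> 0" and Y: "Y = 0" using nz XY(1) by auto
    have m: "X = (X / x) * x" using x by simp
    then have "(X / x) * (X / x) * (x * x) = (k * k) * (x * x)" using XY(3) by (simp add: algebra_simps)
    then have "(X / x) * (X / x) = k * k" using x by simp
    then show ?thesis using m Y True by (intro exI[of _ "X / x"]) simp
  qed
  then obtain m where m: "m * m = k * k" "A * x + B * y = m * x" "C * x + D * y = m * y"
    unfolding X_def Y_def by blast
  have "((A - m) * (D - m) - B * C) * x = 0 \<and> ((A - m) * (D - m) - B * C) * y = 0"
    using m(2,3) by algebra
  then have "(A - m) * (D - m) - B * C = 0" using nz by auto
  then have "m * m + 1 = (A + D) * m" using det by (simp add: algebra_simps)
  then have "(A + D) * m = k * k + 1" using m(1) by simp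
  moreover have "k * k + 1 > 0" using k(1) by (simp add: add_pos_pos)
  ultimately have "\<bar>A + D\<bar> * \<bar>m\<bar> = k * k + 1" by (metis abs_mult abs_of_pos)
  moreover have "\<bar>m\<bar> = k" using m(1) k(1) by (metis abs_mult_self_eq abs_of_pos less_trans power2_eq_square power2_eq_iff_nonneg abs_ge_zero zero_less_one less_imp_le)
  ultimately have "\<bar>A + D\<bar> * k = k * k + 1" by simp
  moreover have "(k - 1) * (k - 1) > 0" using k(1) by simp
  ultimately have "\<bar>A + D\<bar> * k > 2 * k" by (simp add: algebra_simps)
  then have "\<bar>A + D\<bar> > 2" using k(1) by simp
  then have "\<bar>a + d\<bar> > 2" unfolding A_def D_def by linarith
  then show ?thesis by (simp add: g(1) psl_hyperbolic_of[OF g(2)])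
qed

section \<open>Local geodesics are geodesic lines\<close>

lemma lform_null:
  assumes z: "z \<in> uhp" and Y: "lform Y Y = 0" "lform Y (coords z) = 0"
  shows "Y = 0"
proof -
  obtain p q r a b c where e: "Y = (p, q, r)" "coords z = (a, b, c)" by (metis prod.exhaust)
  have a: "a > 0" "a * c = b * b + 1" using z lform_coords_self[OF z] by (simp_all add: e)
      (use e in \<open>auto simp: coords_def upper_half_plane_def\<close>)
  have 1: "p * r = q * q" and 2: "p * c + r * a = 2 * q * b" using Y by (simp_all add: e)
  have "(p * c - r * a)\<^sup>2 = (p * c + r * a)\<^sup>2 - 4 * (p * r) * (a * c)" by (simp add: power2_eq_square algebra_simps)
  also have "\<dots> = - 4 * (q * q)" unfolding 1 2 a(2) by (simp add: power2_eq_square algebra_simps)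
  finally have "(p * c - r * a)\<^sup>2 + 4 * (q * q) = 0" by simp
  moreover have "(p * c - r * a)\<^sup>2 \<ge> 0" "q * q \<ge> 0" by simp_all
  ultimately have "(p * c - r * a)\<^sup>2 = 0" "q * q = 0" by linarith+
  then have q: "q = 0" and pc: "p * c = r * a" by simp_all
  have "p * c + r * a = 0" using 2 q by simp
  then have "r * a = 0" "p * c = 0" using pc by linarith+
  moreover have "c \<noteq> 0" using a by (metis add_pos_nonneg mult_zero_right zero_le_square zero_less_one add.commute less_irrefl)
  ultimately show ?thesis using a q by (simp add: e zero_prod_def)
qed

text \<open>Three points whose distances add up span only a plane. The addition formulas for sinh
  and cosh make the difference of the two sides orthogonal to all three points. It is therefore null
  and orthogonal to a timelike vector, hence 0.\<close>

lemma geodesic_three_points: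
  assumes z: "\<And>t. t \<in> S \<Longrightarrow> z t \<in> uhp"
    and d: "\<And>s t. s \<in> S \<Longrightarrow> t \<in> S \<Longrightarrow> hyp_dist (z s) (z t) = v * \<bar>s - t\<bar>" and v: "v > 0"
    and stu: "s \<in> S" "t \<in> S" "u \<in> S"
  shows "sinh (v * (u - s)) *\<^sub>R coords (z t)
    = sinh (v * (u - t)) *\<^sub>R coords (z s) + sinh (v * (t - s)) *\<^sub>R coords (z u)"
proof -
  define V where "V t = coords (z t)" for t
  have f: "lform (V s) (V t) = 2 * cosh (v * s - v * t)" if "s \<in> S" "t \<in> S" for s t
  proof -
    have "v * \<bar>s - t\<bar> = \<bar>v * s - v * t\<bar>" using v by (simp add: abs_mult right_diff_distrib[symmetric])
    then have "cosh (v * \<bar>s - t\<bar>) = cosh (v * s - v * t)" by (simp add: cosh_def abs_if add.commute)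
    then show ?thesis using lform_coords[OF z z] that d by (simp add: V_def)
  qed
  define Y where "Y = sinh (v * u - v * s) *\<^sub>R V t + (- sinh (v * u - v * t)) *\<^sub>R V s + (- sinh (v * t - v * s)) *\<^sub>R V u"
  have Yx: "lform Y (V x) = 2 * (sinh (v * u - v * s) * cosh (v * t - v * x) - sinh (v * u - v * t) * cosh (v * s - v * x)
      - sinh (v * t - v * s) * cosh (v * u - v * x))" if "x \<in> S" for x
    unfolding Y_def lform_add lform_scale f[OF stu(2) that] f[OF stu(1) that] f[OF stu(3) that] by (simp add: algebra_simps)
  have Y0: "lform Y (V s) = 0" "lform Y (V t) = 0" "lform Y (V u) = 0"
  proof -
    have h: "cosh x * cosh x = 1 + sinh x * sinh x" for x :: real
      using cosh_square_eq[of x] by (simp add: power2_eq_square)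
    show "lform Y (V s) = 0" unfolding Yx[OF stu(1)]
      by (simp add: sinh_diff cosh_diff) (use h[of "v * s"] in algebra)
    show "lform Y (V t) = 0" unfolding Yx[OF stu(2)]
      by (simp add: sinh_diff cosh_diff) (use h[of "v * t"] in algebra)
    show "lform Y (V u) = 0" unfolding Yx[OF stu(3)]
      by (simp add: sinh_diff cosh_diff) (use h[of "v * u"] in algebra)
  qed
  have "lform Y Y = 0" by (subst (2) Y_def) (simp only: lform_add lform_scale Y0 mult_zero_right add_0_right)
  then have "Y = 0" using lform_null[OF z[OF stu(1)]] Y0(1) by (simp add: V_def)
  then show ?thesis unfolding Y_def V_def right_diff_distrib[symmetric]
    by (simp add: add_eq_0_iff algebra_simps)
qed

lemma exp_coeffs_unique:
  fixes P N P' N' :: "'a::real_vector"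
  assumes "v > 0" "a \<noteq> b"
    "exp (v * a) *\<^sub>R P + exp (- (v * a)) *\<^sub>R N = exp (v * a) *\<^sub>R P' + exp (- (v * a)) *\<^sub>R N'"
    "exp (v * b) *\<^sub>R P + exp (- (v * b)) *\<^sub>R N = exp (v * b) *\<^sub>R P' + exp (- (v * b)) *\<^sub>R N'"
  shows "P = P' \<and> N = N'"
proof -
  define D E where "D = P - P'" and "E = N - N'"
  have "exp (v * x) *\<^sub>R D + exp (- (v * x)) *\<^sub>R E = 0" if x: "x = a \<or> x = b" for x
    using assms(3,4) x by (auto simp: D_def E_def algebra_simps)
  then have e: "exp (v * x) *\<^sub>R (exp (v * x) *\<^sub>R D + exp (- (v * x)) *\<^sub>R E) = 0" if x: "x = a \<or> x = b" for x
    using x by auto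
  have "exp (2 * (v * x)) *\<^sub>R D + E = 0" if x: "x = a \<or> x = b" for x
    using e[OF x] by (simp add: scaleR_add_right mult_exp_exp)
  from this[of a] this[of b] have "exp (2 * (v * a)) *\<^sub>R D = exp (2 * (v * b)) *\<^sub>R D"
    by (auto simp: add_eq_0_iff)
  then have D: "D = 0" using assms(1,2) by simp
  then have "E = 0" using e[of a] by simp
  with D show ?thesis by (simp add: D_def E_def)
qed

text \<open>Two values determine the coefficients, so local expressions agree on overlaps. The
  coefficients are locally constant on a connected set.\<close>

lemma exp_coeffs_global:
  fixes V :: "real \<Rightarrow> 'a::real_normed_vector"
  assumes v: "v > 0" and I: "open I" "connected I" "I \<noteq> {}"
    and loc: "\<And>t0. t0 \<in> I \<Longrightarrow> \<exists>e>0. \<exists>P N. \<forall>t\<in>I. \<bar>t - t0\<bar> < e \<longrightarrow> V t = exp (v * t) *\<^sub>R P + exp (- (v * t)) *\<^sub>R N"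
  shows "\<exists>P N. \<forall>t\<in>I. V t = exp (v * t) *\<^sub>R P + exp (- (v * t)) *\<^sub>R N"
proof -
  obtain e P N where e: "\<And>t0. t0 \<in> I \<Longrightarrow> e t0 > 0"
    and PN: "\<And>t0 t. t0 \<in> I \<Longrightarrow> t \<in> I \<Longrightarrow> \<bar>t - t0\<bar> < e t0 \<Longrightarrow> V t = exp (v * t) *\<^sub>R P t0 + exp (- (v * t)) *\<^sub>R N t0"
    using loc by metis
  have "(\<lambda>t. (P t, N t)) constant_on I"
  proof (rule locally_constant_imp_constant[OF I(2)])
    fix t0 assume t0: "t0 \<in> I"
    show "\<exists>T. openin (top_of_set I) T \<and> t0 \<in> T \<and> (\<forall>x\<in>T. (P x, N x) = (P t0, N t0))"
    proof (intro exI[of _ "I \<inter> ball t0 (e t0)"] conjI ballI)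
      show "openin (top_of_set I) (I \<inter> ball t0 (e t0))" by (simp add: openin_open_Int)
      fix x assume x: "x \<in> I \<inter> ball t0 (e t0)"
      have "open (I \<inter> ball t0 (e t0) \<inter> ball x (e x))" using I(1) by (intro open_Int) auto
      moreover have "x \<in> I \<inter> ball t0 (e t0) \<inter> ball x (e x)" using x e by auto
      ultimately obtain d where d: "d > 0" "ball x d \<subseteq> I \<inter> ball t0 (e t0) \<inter> ball x (e x)"
        unfolding open_contains_ball by blast
      have *: "exp (v * y) *\<^sub>R P x + exp (- (v * y)) *\<^sub>R N x = exp (v * y) *\<^sub>R P t0 + exp (- (v * y)) *\<^sub>R N t0"
        if "y \<in> ball x d" for y
      proof -
        have "y \<in> I" "\<bar>y - t0\<bar> < e t0" "\<bar>y - x\<bar> < e x"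
          using d(2) that by (auto simp: dist_real_def abs_minus_commute)
        then show ?thesis using PN[of t0 y] PN[of x y] t0 x by simp
      qed
      have "x \<in> ball x d" "x + d / 2 \<in> ball x d" "x \<noteq> x + d / 2" using d(1) by (auto simp: dist_real_def)
      from exp_coeffs_unique[OF v this(3) *[OF this(1)] *[OF this(2)]]
      show "(P x, N x) = (P t0, N t0)" by simp
    qed (use t0 e in auto)
  qed
  then obtain Q where "\<forall>t\<in>I. (P t, N t) = Q" by (auto simp: constant_on_def)
  then have "V t = exp (v * t) *\<^sub>R fst Q + exp (- (v * t)) *\<^sub>R snd Q" if "t \<in> I" for t
    using PN[OF that that] e[OF that] that by (metis abs_zero diff_self fst_conv snd_conv)
  then show ?thesis by blast
qed

lemma geodesic_exp_form:
  assumes z: "\<And>t. t \<in> {0<..<2} \<Longrightarrow> z t \<in> uhp" and v: "v > 0"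
    and loc: "\<And>t. t \<in> {0<..<2::real} \<Longrightarrow> \<exists>e>0. \<forall>s\<in>{0<..<2}. \<forall>s'\<in>{0<..<2}. \<bar>s - t\<bar> < e \<longrightarrow> \<bar>s' - t\<bar> < e \<longrightarrow>
      hyp_dist (z s) (z s') = v * \<bar>s - s'\<bar>"
  shows "\<exists>P N. \<forall>t\<in>{0<..<2}. coords (z t) = exp (v * t) *\<^sub>R P + exp (- (v * t)) *\<^sub>R N"
proof (rule exp_coeffs_global[OF v])
  fix t0 :: real assume t0: "t0 \<in> {0<..<2}"
  obtain e where e: "e > 0" "\<And>s s'. s \<in> {0<..<2} \<Longrightarrow> s' \<in> {0<..<2} \<Longrightarrow> \<bar>s - t0\<bar> < e \<Longrightarrow> \<bar>s' - t0\<bar> < e \<Longrightarrow>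
      hyp_dist (z s) (z s') = v * \<bar>s - s'\<bar>" using loc[OF t0] by blast
  define S where "S = {0<..<2} \<inter> {s. \<bar>s - t0\<bar> < e}"
  define d where "d = min e (min t0 (2 - t0)) / 2"
  have d: "d > 0" "d < e" "d < t0" "d < 2 - t0" using e(1) t0 by (auto simp: d_def min_def)
  define s u where "s = t0 - d" and "u = t0 + d"
  have su: "s \<in> S" "u \<in> S" "s < u" using d t0 by (auto simp: S_def s_def u_def)
  define H where "H = sinh (v * (u - s))"
  have H: "H > 0" using v su by (simp add: H_def)
  \<comment> \<open>P and N are found by expanding the sinh coefficients of the three-point relation
    in powers of exp (v t).\<close>
  define P where "P = (1 / (2 * H)) *\<^sub>R (exp (- (v * s)) *\<^sub>R coords (z u) - exp (- (v * u)) *\<^sub>R coords (z s))"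
  define N where "N = (1 / (2 * H)) *\<^sub>R (exp (v * u) *\<^sub>R coords (z s) - exp (v * s) *\<^sub>R coords (z u))"
  have "coords (z t) = exp (v * t) *\<^sub>R P + exp (- (v * t)) *\<^sub>R N" if t: "t \<in> S" for t
  proof -
    have "H *\<^sub>R coords (z t) = sinh (v * (u - t)) *\<^sub>R coords (z s) + sinh (v * (t - s)) *\<^sub>R coords (z u)"
      unfolding H_def by (rule geodesic_three_points[of S]) (use e z su t v in \<open>auto simp: S_def\<close>)
    also have "sinh (v * (u - t)) = (exp (v * u) * exp (- (v * t)) - exp (- (v * u)) * exp (v * t)) / 2"
      by (simp add: sinh_def mult_exp_exp algebra_simps)
    also have "sinh (v * (t - s)) = (exp (v * t) * exp (- (v * s)) - exp (- (v * t)) * exp (v * s)) / 2"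
      by (simp add: sinh_def mult_exp_exp algebra_simps)
    finally have "(1 / H) *\<^sub>R (H *\<^sub>R coords (z t)) = (1 / H) *\<^sub>R (((exp (v * u) * exp (- (v * t)) - exp (- (v * u)) * exp (v * t)) / 2) *\<^sub>R coords (z s)
       + ((exp (v * t) * exp (- (v * s)) - exp (- (v * t)) * exp (v * s)) / 2) *\<^sub>R coords (z u))" by simp
    then have "coords (z t) = (1 / H) *\<^sub>R (((exp (v * u) * exp (- (v * t)) - exp (- (v * u)) * exp (v * t)) / 2) *\<^sub>R coords (z s)
       + ((exp (v * t) * exp (- (v * s)) - exp (- (v * t)) * exp (v * s)) / 2) *\<^sub>R coords (z u))" using H by simp
    also have "\<dots> = exp (v * t) *\<^sub>R P + exp (- (v * t)) *\<^sub>R N"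
      unfolding P_def N_def
      by (cases "coords (z s)"; cases "coords (z u)") (use H in \<open>simp add: field_simps\<close>)
    finally show ?thesis .
  qed
  then show "\<exists>e>0. \<exists>P N. \<forall>t\<in>{0<..<2}. \<bar>t - t0\<bar> < e \<longrightarrow> coords (z t) = exp (v * t) *\<^sub>R P + exp (- (v * t)) *\<^sub>R N"
    using e(1) unfolding S_def by blast
qed (auto intro: connected_Ioo)

text \<open>Null vectors on opposite halves of the light cone cannot have product 1: the inequality
  of arithmetic and geometric means bounds |2 q q'| by |p r' + r p'|, so two nonpositive summands
  give a nonpositive product.\<close>

lemma cone_signs:
  fixes p q r p' q' r' :: real
  assumes "p * r = q * q" "p' * r' = q' * q'" "p * r' + r * p' - 2 * q * q' = 1"
  shows "\<not> (p * r' \<le> 0 \<and> r * p' \<le> 0)"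
proof
  assume s: "p * r' \<le> 0 \<and> r * p' \<le> 0"
  have "(2 * q * q')\<^sup>2 = 4 * (q * q) * (q' * q')" by (simp add: power2_eq_square)
  also have "\<dots> = 4 * (p * r') * (r * p')" by (simp add: assms(1,2)[symmetric])
  also have "\<dots> \<le> (p * r' + r * p')\<^sup>2"
    using zero_le_power2[of "p * r' - r * p'"] by (simp add: power2_eq_square algebra_simps)
  finally have "\<bar>2 * q * q'\<bar> \<le> \<bar>p * r' + r * p'\<bar>" by (metis abs_le_square_iff)
  then show False using s assms(3) by linarith
qed

text \<open>The condition \<open>lform V V = 2\<close> along the curve is a quadratic equation in X
  = exp (2 v t). Three values of X force its coefficients to vanish, so P and N are null with
  product 1. The signs follow since the points have positive outer coordinates.\<close>

lemma geoline_of_exp_form: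
  assumes v: "v > 0" and z: "\<And>t. t \<in> {0<..<2::real} \<Longrightarrow> z t \<in> uhp"
    and V: "\<And>t. t \<in> {0<..<2} \<Longrightarrow> coords (z t) = exp (v * t) *\<^sub>R P + exp (- (v * t)) *\<^sub>R N"
  shows "geoline P N"
proof -
  define a b c where "a = lform P P" and "b = lform N N" and "c = 2 * lform P N - 2"
  define x where "x t = exp (v * t)" for t :: real
  have eq: "a * (x t * x t * x t * x t) + b + c * (x t * x t) = 0" if t: "t \<in> {0<..<2}" for t
  proof -
    have y: "exp (- (v * t)) * x t = 1" by (simp add: x_def mult_exp_exp)
    define y where "y = exp (- (v * t))"
    have xy: "x t * y = 1" using y by (simp add: y_def mult.commute)
    have "lform (coords (z t)) (coords (z t)) = 2" by (rule lform_coords_self[OF z[OF t]])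
    then have "x t * x t * lform P P + y * y * lform N N + 2 * (x t * y) * lform P N = 2"
      unfolding V[OF t] x_def[symmetric] y_def[symmetric]
      by (simp add: lform_add lform_scale lform_commute[of N P] algebra_simps)
    then have "x t * x t * a + y * y * b + c = 0" using xy by (simp add: a_def b_def c_def)
    then have "x t * x t * (x t * x t * a + y * y * b + c) = 0" by simp
    then have "x t * x t * x t * x t * a + (x t * y) * (x t * y) * b + x t * x t * c = 0" by (simp add: algebra_simps)
    then show ?thesis unfolding xy by (simp add: algebra_simps)
  qed
  \<comment> \<open>This is exp v, so X takes the values q, q^2 and q^3 at t = 1/2, 1 and
    3/2.\<close>
  define q where "q = exp (v * (1/2)) * exp (v * (1/2))"
  have q: "q > 1" using v by (simp add: q_def mult_exp_exp)
  have e1: "a * (q * q) + b + c * q = 0"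
    using eq[of "1/2"] by (simp add: x_def q_def algebra_simps)
  have x1: "x 1 = q" by (simp add: x_def q_def mult_exp_exp)
  have e2: "a * (q * q * q * q) + b + c * (q * q) = 0" using eq[of 1] by (simp add: x1)
  have x3: "x (3/2) * x (3/2) = q * q * q" by (simp add: x_def q_def mult_exp_exp)
  have e3: "a * (q * q * q * q * q * q) + b + c * (q * q * q) = 0"
    using eq[of "3/2"] unfolding mult.assoc x3 by (simp add: x3[unfolded mult.assoc] mult.assoc[symmetric])
  have "(q - 1) * q * (a * (q * (q + 1)) + c) = 0" "(q - 1) * (q * q) * (a * (q * q * (q + 1)) + c) = 0"
    using e1 e2 e3 by algebra+
  then have f: "a * (q * (q + 1)) + c = 0" "a * (q * q * (q + 1)) + c = 0" using q by auto
  then have "a * (q * (q + 1) * (q - 1)) = 0" by algebra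
  then have a0: "a = 0" using q by auto
  then have c0: "c = 0" using f by simp
  then have b0: "b = 0" using e1 a0 by simp
  obtain p qq r p' q' r' where P: "P = (p, qq, r)" "N = (p', q', r')" by (metis prod.exhaust)
  have h: "p * r = qq * qq" "p' * r' = q' * q'" "p * r' + r * p' - 2 * qq * q' = 1"
    using a0 b0 c0 by (simp_all add: a_def b_def c_def P)
  have pos: "x 1 * p + exp (- v) * p' > 0 \<and> x 1 * r + exp (- v) * r' > 0"
  proof -
    have "Im (z 1) > 0" using z[of 1] by (simp add: upper_half_plane_def)
    then have "fst (coords (z 1)) > 0 \<and> snd (snd (coords (z 1))) > 0"
      by (auto simp: coords_def intro!: divide_pos_pos add_nonneg_pos)
    then show ?thesis using V[of 1] by (simp add: P x_def)
  qed
  have ex: "x 1 > 0" "exp (- v) > 0" by (simp_all add: x_def)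
  have cs: "\<not> (p * r' \<le> 0 \<and> r * p' \<le> 0)" by (rule cone_signs[OF h])
  have sq: "p * r \<ge> 0" "p' * r' \<ge> 0" using h by simp_all
  have pos': "\<not> (p \<le> 0 \<and> p' \<le> 0)" "\<not> (r \<le> 0 \<and> r' \<le> 0)"
    using pos ex mult_nonneg_nonpos[of "x 1" p] mult_nonneg_nonpos[of "exp (- v)" p']
      mult_nonneg_nonpos[of "x 1" r] mult_nonneg_nonpos[of "exp (- v)" r'] by linarith+
  have "p \<ge> 0 \<and> r \<ge> 0 \<and> p' \<ge> 0 \<and> r' \<ge> 0"
    using cs sq pos' by (auto simp: zero_le_mult_iff mult_le_0_iff) 
  then show ?thesis using h by (simp add: geoline_def cone_def P mult.commute)
qed

section \<open>Closed geodesics and their monodromy\<close>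

lemma periodic_int:
  assumes "\<And>t. f (t + 1) = f (t::real)"
  shows "f (t + real_of_int k) = f t"
proof -
  have nat: "f (t + real n) = f t" for t n
  proof (induction n)
    case (Suc n)
    then show ?case using assms[of "t + real n"] by (simp add: add_ac)
  qed simp
  show ?thesis
  proof (cases "k \<ge> 0")
    case True
    then show ?thesis using nat[of t "nat k"] by simp
  next
    case False
    then show ?thesis using nat[of "t + real_of_int k" "nat (- k)"] by simp
  qed
qed

lemma geodesic_loop_continuous:
  assumes "geodesic_loop c"
  shows "continuous_on S c"
proof -
  obtain v where v: "v > 0" "\<And>t. \<exists>e>0. \<forall>s s'. \<bar>s - t\<bar> < e \<longrightarrow> \<bar>s' - t\<bar> < e \<longrightarrow> dist (c s) (c s') = v * \<bar>s - s'\<bar>"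
    using assms unfolding geodesic_loop_def by metis
  have "isCont c t" for t
    unfolding continuous_at_eps_delta
  proof (intro allI impI)
    fix \<epsilon> :: real assume eps: "\<epsilon> > 0"
    obtain e where e: "e > 0" "\<And>s s'. \<bar>s - t\<bar> < e \<Longrightarrow> \<bar>s' - t\<bar> < e \<Longrightarrow> dist (c s) (c s') = v * \<bar>s - s'\<bar>"
      using v(2)[of t] by blast
    show "\<exists>d>0. \<forall>x'. dist x' t < d \<longrightarrow> dist (c x') (c t) < \<epsilon>"
    proof (intro exI[of _ "min e (\<epsilon> / v)"] conjI allI impI)
      fix x assume "dist x t < min e (\<epsilon> / v)"
      then have x: "\<bar>x - t\<bar> < e" "\<bar>x - t\<bar> < \<epsilon> / v" by (auto simp: dist_real_def)
      then have "dist (c x) (c t) = v * \<bar>x - t\<bar>" using e by simp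
      also have "\<dots> < \<epsilon>" using x(2) v(1) by (simp add: field_simps)
      finally show "dist (c x) (c t) < \<epsilon>" .
    qed (use e eps v in simp)
  qed
  then show ?thesis by (simp add: continuous_at_imp_continuous_on)
qed

text \<open>Two periods are lifted, so that z (t + 1) = g z (t) can be compared on a whole interval
  and not only at an endpoint.\<close>

lemma lift_extend:
  assumes z: "is_lift {0..1} c z" "z 1 = act g (z 0)" "psl_Gamma2 g" and c: "\<And>t. c (t + 1) = c t"
  shows "is_lift {0..2} c (\<lambda>t. if t \<le> 1 then z t else act g (z (t - 1)))"
  unfolding is_lift_def
proof
  let ?w = "\<lambda>t. act g (z (t - 1))"
  have "continuous_on {1..2} (\<lambda>t. z (t - 1))"
    by (rule continuous_on_compose2[OF is_liftD(1)[OF z(1)]]) (auto intro!: continuous_intros)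
  then have "continuous_on {1..2} ?w"
    by (rule continuous_on_act_compose) (use is_liftD(2)[OF z(1)] in auto)
  then have "continuous_on ({0..1} \<union> {1..2}) (\<lambda>t. if t \<le> 1 then z t else ?w t)"
    using is_liftD(1)[OF z(1)] z(2) by (intro continuous_on_cases) auto
  moreover have "{0..1} \<union> {1..2} = {0..2::real}" by auto
  ultimately show "continuous_on {0..2} (\<lambda>t. if t \<le> 1 then z t else ?w t)" by simp
  show "\<forall>t\<in>{0..2}. (if t \<le> 1 then z t else ?w t) \<in> uhp \<and> pants_proj (if t \<le> 1 then z t else ?w t) = c t"
  proof
    fix t :: real assume t: "t \<in> {0..2}"
    show "(if t \<le> 1 then z t else ?w t) \<in> uhp \<and> pants_proj (if t \<le> 1 then z t else ?w t) = c t"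
    proof (cases "t \<le> 1")
      case False
      then have "t - 1 \<in> {0..1}" using t by auto
      then show ?thesis using is_liftD(2,3)[OF z(1), of "t - 1"] z(3) c[of "t - 1"] False by simp
    qed (use t is_liftD(2,3)[OF z(1), of t] in simp)
  qed
qed

text \<open>Close to t the lift stays within r/4 of its value at t, and points closer than half the
  injectivity radius are as far apart as their projections.\<close>

lemma lift_local_isometry:
  assumes c: "geodesic_loop c" and z: "is_lift S c z" and S: "compact S"
    and v: "\<And>t. \<exists>e>0. \<forall>s s'. \<bar>s - t\<bar> < e \<longrightarrow> \<bar>s' - t\<bar> < e \<longrightarrow> dist (c s) (c s') = v * \<bar>s - s'\<bar>"
    and t: "t \<in> S"
  shows "\<exists>e>0. \<forall>s\<in>S. \<forall>s'\<in>S. \<bar>s - t\<bar> < e \<longrightarrow> \<bar>s' - t\<bar> < e \<longrightarrow> hyp_dist (z s) (z s') = v * \<bar>s - s'\<bar>"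
proof -
  have "compact (c ` S)" by (rule compact_continuous_image[OF geodesic_loop_continuous[OF c] S])
  then obtain r where r: "inj_radius (c ` S) r" using inj_radius_compact by blast
  have r0: "r > 0" using r by (simp add: inj_radius_def)
  obtain e1 where e1: "e1 > 0" "\<And>s s'. \<bar>s - t\<bar> < e1 \<Longrightarrow> \<bar>s' - t\<bar> < e1 \<Longrightarrow> dist (c s) (c s') = v * \<bar>s - s'\<bar>"
    using v[of t] by blast
  have "continuous_on S (\<lambda>s. hyp_dist (z t) (z s))"
    using is_liftD[OF z] t by (intro continuous_on_hyp_dist) auto
  then obtain e2 where e2: "e2 > 0" "\<And>s. s \<in> S \<Longrightarrow> dist s t < e2 \<Longrightarrow> dist (hyp_dist (z t) (z s)) (hyp_dist (z t) (z t)) < r / 4"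
    using t r0 unfolding continuous_on_iff by (metis divide_pos_pos zero_less_numeral)
  have near: "hyp_dist (z t) (z s) < r / 4" if "s \<in> S" "\<bar>s - t\<bar> < e2" for s
    using e2(2)[of s] that is_liftD(2)[OF z] t by (simp add: dist_real_def)
  show ?thesis
  proof (intro exI[of _ "min e1 e2"] conjI ballI impI)
    fix s s' assume s: "s \<in> S" "s' \<in> S" "\<bar>s - t\<bar> < min e1 e2" "\<bar>s' - t\<bar> < min e1 e2"
    have u: "z s \<in> uhp" "z s' \<in> uhp" "z t \<in> uhp" using s t is_liftD(2)[OF z] by auto
    have "hyp_dist (z s) (z s') \<le> hyp_dist (z s) (z t) + hyp_dist (z t) (z s')"
      using u by (intro hyp_dist_triangle)
    then have "hyp_dist (z s) (z s') < r / 2"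
      using near[of s] near[of s'] s by (simp add: hyp_dist_commute[of "z s" "z t"])
    then have "dist (pants_proj (z s)) (pants_proj (z s')) = hyp_dist (z s) (z s')"
      using is_liftD(3)[OF z] s u by (intro hyp_dist_eq_dist[OF r]) auto
    then show "hyp_dist (z s) (z s') = v * \<bar>s - s'\<bar>" using e1(2) s is_liftD(3)[OF z] by simp
  qed (use e1 e2 in simp)
qed

text \<open>The exponential form of the lift on (0, 2) turns z (t + 1) = g z (t) into the statement
  that P and N are eigenvectors of g.\<close>

theorem geodesic_loop_axis:
  assumes c: "geodesic_loop c" and g: "monodromy c g"
  shows "\<exists>v P N. axis_of g v P N \<and> (\<forall>t. c t = pants_proj (line P N (v * t)))"
proof -
  obtain v where v: "v > 0" "\<And>t. c (t + 1) = c t"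
    "\<And>t. \<exists>e>0. \<forall>s s'. \<bar>s - t\<bar> < e \<longrightarrow> \<bar>s' - t\<bar> < e \<longrightarrow> dist (c s) (c s') = v * \<bar>s - s'\<bar>"
    using c unfolding geodesic_loop_def by metis
  obtain z0 where z0: "is_lift {0..1} c z0" "z0 1 = act g (z0 0)" "psl_Gamma2 g" using g by (auto simp: monodromy_def)
  define z where "z t = (if t \<le> 1 then z0 t else act g (z0 (t - 1)))" for t
  have z: "is_lift {0..2} c z" unfolding z_def by (rule lift_extend[OF z0 v(2)])
  have zu: "z t \<in> uhp" if "t \<in> {0<..<2}" for t using is_liftD(2)[OF z] that by simp
  have "\<exists>e>0. \<forall>s\<in>{0<..<2}. \<forall>s'\<in>{0<..<2}. \<bar>s - t\<bar> < e \<longrightarrow> \<bar>s' - t\<bar> < e \<longrightarrow>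
      hyp_dist (z s) (z s') = v * \<bar>s - s'\<bar>" if t: "t \<in> {0<..<2}" for t
  proof -
    have "t \<in> {0..2}" using t by simp
    then obtain e where "e > 0" "\<forall>s\<in>{0..2}. \<forall>s'\<in>{0..2}. \<bar>s - t\<bar> < e \<longrightarrow> \<bar>s' - t\<bar> < e \<longrightarrow>
      hyp_dist (z s) (z s') = v * \<bar>s - s'\<bar>" using lift_local_isometry[OF c z compact_Icc v(3)] by blast
    then show ?thesis by (intro exI[of _ e]) auto
  qed
  then obtain P N where V: "\<And>t. t \<in> {0<..<2} \<Longrightarrow> coords (z t) = exp (v * t) *\<^sub>R P + exp (- (v * t)) *\<^sub>R N"
    using geodesic_exp_form[of z v] zu v(1) by blast
  have G: "geoline P N" by (rule geoline_of_exp_form[OF v(1) zu V])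
  have zl: "z t = line P N (v * t)" if t: "t \<in> {0<..<2}" for t
    using lpoint_coords[OF zu[OF t]] V[OF t] by (simp add: line_def line_vec_def)
  have "exp (v * t) *\<^sub>R lact g P + exp (- (v * t)) *\<^sub>R lact g N
      = exp (v * t) *\<^sub>R (exp v *\<^sub>R P) + exp (- (v * t)) *\<^sub>R (exp (- v) *\<^sub>R N)" if t: "t \<in> {0<..<1}" for t
  proof -
    have "z (t + 1) = act g (z t)" using t by (simp add: z_def)
    then have "coords (z (t + 1)) = lact g (coords (z t))" using zu[of t] t by (simp add: coords_act)
    then have "exp (v * (t + 1)) *\<^sub>R P + exp (- (v * (t + 1))) *\<^sub>R N
       = exp (v * t) *\<^sub>R lact g P + exp (- (v * t)) *\<^sub>R lact g N"
      using V[of t] V[of "t + 1"] t by (simp add: lact_linear)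
    then show ?thesis by (simp add: mult_exp_exp distrib_left)
  qed
  \<comment> \<open>Two distinct parameters in (0, 1) determine the coefficients.\<close>
  from exp_coeffs_unique[OF v(1) _ this[of "1/3"] this[of "2/3"]]
  have "lact g P = exp v *\<^sub>R P" "lact g N = exp (- v) *\<^sub>R N" by simp_all
  then have ax: "axis_of g v P N" using v(1) G by (simp add: axis_of_def)
  define F where "F t = pants_proj (line P N (v * t))" for t
  have F1: "F (t + 1) = F t" for t
  proof -
    have "line P N (v * (t + 1)) = act g (line P N (v * t))" unfolding axis_act[OF ax] by (simp add: algebra_simps)
    then show ?thesis using z0(3) line_props(1)[OF G] by (simp add: F_def)
  qed
  have "c t = F t" for t
  proof -
    \<comment> \<open>With this integer, s lies in [1/2, 3/2), well inside (0, 2).\<close>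
    define k where "k = \<lfloor>t - 1/2\<rfloor>"
    define s where "s = t - of_int k"
    have s: "s \<in> {0<..<2}" unfolding s_def k_def by (simp, linarith)
    have "c t = c s" using periodic_int[of c s k, OF v(2)] by (simp add: s_def)
    also have "\<dots> = F s" using is_liftD(3)[OF z, of s] s zl[OF s] by (simp add: F_def)
    also have "\<dots> = F t" using periodic_int[of F s k, OF F1] by (simp add: s_def)
    finally show ?thesis .
  qed
  with ax show ?thesis unfolding F_def by blast
qed

lemma continuous_on_line:
  assumes "geoline P N"
  shows "continuous_on S (line P N)"
proof (rule continuous_on_of_hyp_dist)
  fix t assume "t \<in> S"
  have "((\<lambda>s. \<bar>t - s\<bar>) \<longlongrightarrow> \<bar>t - t\<bar>) (at t within S)" by (intro tendsto_intros)
  then show "((\<lambda>s. hyp_dist (line P N t) (line P N s)) \<longlongrightarrow> 0) (at t within S)"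
    by (simp add: hyp_dist_line[OF assms])
qed (rule line_props(1)[OF assms])

text \<open>The parameter change is included so that all curves in a reparametrisation class are
  covered, which need not have constant speed.\<close>

lemma monodromy_of_axis:
  assumes ax: "axis_of g v P N" and g: "psl_Gamma2 g"
    and phi: "continuous_on UNIV \<phi>" "\<phi> 1 = \<phi> 0 + 1"
  shows "monodromy (\<lambda>t. pants_proj (line P N (v * \<phi> t))) g"
proof -
  have G: "geoline P N" using ax by (simp add: axis_of_def)
  have "continuous_on {0..1} (\<lambda>t. line P N (v * \<phi> t))"
    by (rule continuous_on_compose2[OF continuous_on_line[OF G, of UNIV]])
      (use phi in \<open>auto intro!: continuous_intros intro: continuous_on_subset\<close>)
  then have "is_lift {0..1} (\<lambda>t. pants_proj (line P N (v * \<phi> t))) (\<lambda>t. line P N (v * \<phi> t))"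
    by (simp add: is_lift_def line_props(1)[OF G])
  moreover have "line P N (v * \<phi> 1) = act g (line P N (v * \<phi> 0))"
    unfolding axis_act[OF ax] phi(2) by (simp add: algebra_simps)
  ultimately show ?thesis using g by (auto simp: monodromy_def)
qed

theorem geodesic_loop_of_axis:
  assumes ax: "axis_of g v P N" and g: "psl_Gamma2 g"
  shows "geodesic_loop (\<lambda>t. pants_proj (line P N (v * t)))"
proof -
  have G: "geoline P N" and v: "v > 0" using ax by (simp_all add: axis_of_def)
  let ?c = "\<lambda>t. pants_proj (line P N (v * t))"
  have per: "?c (t + 1) = ?c t" for t
  proof -
    have "line P N (v * (t + 1)) = act g (line P N (v * t))" unfolding axis_act[OF ax] by (simp add: algebra_simps)
    then show ?thesis using g line_props(1)[OF G] by simp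
  qed
  have "\<exists>e>0. \<forall>s s'. \<bar>s - t\<bar> < e \<longrightarrow> \<bar>s' - t\<bar> < e \<longrightarrow> dist (?c s) (?c s') = v * \<bar>s - s'\<bar>" for t
  proof -
  obtain r where r: "r > 0" "inj_radius (ball (?c t) r) r" using inj_radius_ball by blast
  have hd: "hyp_dist (line P N (v * s)) (line P N (v * s')) = v * \<bar>s - s'\<bar>" for s s'
    using v by (simp add: hyp_dist_line[OF G] abs_mult flip: right_diff_distrib)
  \<comment> \<open>Speed v keeps these points within r/4 of the value at t, so any two of them are
    closer than r/2, as \<open>hyp_dist_eq_dist\<close> requires.\<close>
  show ?thesis
  proof (intro exI[of _ "r / (4 * v)"] conjI allI impI)
    fix s s' assume s: "\<bar>s - t\<bar> < r / (4 * v)" "\<bar>s' - t\<bar> < r / (4 * v)"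
    have b: "?c x \<in> ball (?c t) r" if "\<bar>x - t\<bar> < r / (4 * v)" for x
    proof -
      have "dist (?c t) (?c x) \<le> v * \<bar>t - x\<bar>"
        using dist_pants_proj_le[OF line_props(1)[OF G] line_props(1)[OF G], of "v * t" "v * x"] hd by simp
      also have "\<dots> < r" using that v r(1) by (simp add: field_simps abs_minus_commute)
      finally show ?thesis by simp
    qed
    have "\<bar>s - s'\<bar> < 2 * (r / (4 * v))" using s by linarith
    then have "hyp_dist (line P N (v * s)) (line P N (v * s')) < r / 2" unfolding hd using v by (simp add: field_simps)
    then have "dist (?c s) (?c s') = hyp_dist (line P N (v * s)) (line P N (v * s'))"
      by (intro hyp_dist_eq_dist[OF r(2)] b s line_props(1)[OF G])
    then show "dist (?c s) (?c s') = v * \<bar>s - s'\<bar>" by (simp add: hd)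
  qed (use r v in simp)
  qed
  with per v show ?thesis unfolding geodesic_loop_def by blast
qed

lemma geodesic_loops_same_monodromy:
  assumes "geodesic_loop c" "geodesic_loop c'" "monodromy c g" "monodromy c' g"
  shows "\<exists>d. \<forall>t. c' t = c (t + d)"
proof -
  obtain v P N where 1: "axis_of g v P N" "\<And>t. c t = pants_proj (line P N (v * t))"
    using geodesic_loop_axis assms by blast
  obtain v' P' N' where 2: "axis_of g v' P' N'" "\<And>t. c' t = pants_proj (line P' N' (v' * t))"
    using geodesic_loop_axis assms by blast
  obtain d where d: "v' = v" "\<And>t. line P' N' t = line P N (t + d)" using axis_unique[OF 1(1) 2(1)] by blast
  have "v > 0" using 1(1) by (simp add: axis_of_def)
  then have "c' t = c (t + d / v)" for t unfolding 1(2) 2(2) d by (simp add: distrib_left)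
  then show ?thesis by blast
qed

lemma geodesic_loop_monodromy_exists: "geodesic_loop c \<Longrightarrow> \<exists>g. monodromy c g"
proof -
  assume c: "geodesic_loop c"
  have "c (0 + 1) = c 0" using c unfolding geodesic_loop_def by blast
  then show ?thesis using geodesic_loop_continuous[OF c]
    by (intro monodromy_exists) (simp_all add: path_def pathfinish_def pathstart_def)
qed

lemma geodesic_loop_hyperbolic: "geodesic_loop c \<Longrightarrow> monodromy c g \<Longrightarrow> psl_hyperbolic g"
  using geodesic_loop_axis axis_hyperbolic by blast

lemma geodesic_loop_shift:
  assumes "geodesic_loop c"
  shows "geodesic_loop (\<lambda>t. c (t + a))"
  unfolding geodesic_loop_def
proof
  obtain v where v: "v > 0" "\<And>t. c (t + 1) = c t"
    "\<And>t. \<exists>e>0. \<forall>s s'. \<bar>s - t\<bar> < e \<longrightarrow> \<bar>s' - t\<bar> < e \<longrightarrow> dist (c s) (c s') = v * \<bar>s - s'\<bar>"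
    using assms unfolding geodesic_loop_def by metis
  show "\<forall>t. c (t + 1 + a) = c (t + a)" using v(2) by (metis add.assoc add.commute)
  have "\<exists>e>0. \<forall>s s'. \<bar>s - t\<bar> < e \<longrightarrow> \<bar>s' - t\<bar> < e \<longrightarrow> dist (c (s + a)) (c (s' + a)) = v * \<bar>s - s'\<bar>" for t
  proof -
    obtain e where e: "e > 0" "\<And>s s'. \<bar>s - (t + a)\<bar> < e \<Longrightarrow> \<bar>s' - (t + a)\<bar> < e \<Longrightarrow> dist (c s) (c s') = v * \<bar>s - s'\<bar>"
      using v(3)[of "t + a"] by blast
    then show ?thesis using e(2)[of "_ + a" "_ + a"] by (intro exI[of _ e]) simp
  qed
  then show "\<exists>v>0. \<forall>t. \<exists>e>0. \<forall>s s'. \<bar>s - t\<bar> < e \<longrightarrow> \<bar>s' - t\<bar> < e \<longrightarrow> dist (c (s + a)) (c (s' + a)) = v * \<bar>s - s'\<bar>"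
    using v(1) by blast
qed

text \<open>h and h^N have the same axis, so the geodesic with monodromy h^N runs N times along the
  one with monodromy h, and c differs from it by a shift of the parameter.\<close>

lemma power_not_primitive:
  assumes c: "geodesic_loop c" "monodromy c (h ^ N)" and h: "psl_Gamma2 h" "psl_hyperbolic h" and N: "N \<ge> 2"
  shows "\<not> primitive_geodesic_loop c"
proof -
  obtain v P Q where ax: "axis_of h v P Q" using hyperbolic_axis[OF h(2)] by blast
  define d where "d t = pants_proj (line P Q (v * t))" for t
  have d: "geodesic_loop d" unfolding d_def by (rule geodesic_loop_of_axis[OF ax h(1)])
  have axN: "axis_of (h ^ N) (real N * v) P Q" by (rule axis_power[OF ax]) (use N in simp)
  have GN: "psl_Gamma2 (h ^ N)" by (rule psl_Gamma2_power[OF h(1)])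
  have e: "(\<lambda>t. pants_proj (line P Q (real N * v * t))) = (\<lambda>t. d (real N * t))"
    by (simp add: d_def mult_ac)
  have "geodesic_loop (\<lambda>t. d (real N * t))" using geodesic_loop_of_axis[OF axN GN] by (simp only: e)
  moreover have "monodromy (\<lambda>t. d (real N * t)) (h ^ N)"
    using monodromy_of_axis[OF axN GN, of "\<lambda>t. t"] by (simp add: e)
  ultimately obtain a where a: "\<And>t. c t = d (real N * (t + a))" using geodesic_loops_same_monodromy c by blast
  have "c = (\<lambda>t. (\<lambda>s. d (s + real N * a)) (real N * t))" by (simp add: fun_eq_iff a distrib_left)
  then show ?thesis using geodesic_loop_shift[OF d, of "real N * a"] N
    unfolding primitive_geodesic_loop_def by blast
qed

lemma multiple_geodesic_monodromy:
  assumes d: "geodesic_loop d" and N: "N > 0"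
  shows "\<exists>h. psl_Gamma2 h \<and> psl_hyperbolic h \<and> monodromy (\<lambda>t. d (real N * t)) (h ^ N)"
proof -
  obtain h where h: "monodromy d h" using geodesic_loop_monodromy_exists[OF d] by blast
  then have hG: "psl_Gamma2 h" by (simp add: monodromy_def)
  obtain v P Q where ax: "axis_of h v P Q" "\<And>t. d t = pants_proj (line P Q (v * t))"
    using geodesic_loop_axis[OF d h] by blast
  have axN: "axis_of (h ^ N) (real N * v) P Q" by (rule axis_power[OF ax(1) N])
  have "monodromy (\<lambda>t. d (real N * t)) (h ^ N)"
    using monodromy_of_axis[OF axN psl_Gamma2_power[OF hG], of "\<lambda>t. t"] by (simp add: ax(2) mult_ac)
  then show ?thesis using hG axis_hyperbolic[OF ax(1)] by blast
qed

section \<open>Reparametrisation classes\<close>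

lemma reparam_rel_refl: "(c, c) \<in> reparam_rel"
  unfolding reparam_rel_def by (auto intro!: exI[of _ "\<lambda>t. t"] strict_monoI)

lemma reparam_rel_trans:
  assumes "(c, c') \<in> reparam_rel" "(c', c'') \<in> reparam_rel"
  shows "(c, c'') \<in> reparam_rel"
proof -
  obtain f where f: "continuous_on UNIV f" "strict_mono f" "\<And>t. f (t + 1) = f t + 1" "c' = c \<circ> f"
    using assms(1) by (auto simp: reparam_rel_def)
  obtain g where g: "continuous_on UNIV g" "strict_mono g" "\<And>t. g (t + 1) = g t + 1" "c'' = c' \<circ> g"
    using assms(2) by (auto simp: reparam_rel_def)
  have "continuous_on UNIV (f \<circ> g)" using f g by (intro continuous_on_compose) (auto intro: continuous_on_subset)
  moreover have "strict_mono (f \<circ> g)" using f g by (simp add: strict_mono_def)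
  ultimately show ?thesis using f g unfolding reparam_rel_def by (auto intro!: exI[of _ "f \<circ> g"])
qed

lemma reparam_rel_shift: "(c, \<lambda>t. c (t + a)) \<in> reparam_rel"
  unfolding reparam_rel_def
  by (auto intro!: exI[of _ "\<lambda>t. t + a"] continuous_intros strict_monoI simp: comp_def)

text \<open>The shifts by a and by -a are both reparametrisations, so transitivity gives the two
  inclusions.\<close>

lemma reparam_class_shift: "reparam_rel `` {\<lambda>t. c (t + a)} = reparam_rel `` {c}"
proof -
  have "(\<lambda>t. c (t + a), c) \<in> reparam_rel" using reparam_rel_shift[of "\<lambda>t. c (t + a)" "- a"] by simp
  then show ?thesis using reparam_rel_shift[of c a] reparam_rel_trans by blast
qed

text \<open>Monodromy determines the free homotopy class and does not change under
  reparametrisation, so a statement about the whole class reduces to one about the geodesic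
  c.\<close>

lemma class_in_homotopy_class_iff:
  assumes c: "geodesic_loop c" and w: "3 dvd length w"
  shows "reparam_rel `` {c} \<subseteq> homotopy_class w \<longleftrightarrow> monodromy c (word_elt w)"
proof
  assume "reparam_rel `` {c} \<subseteq> homotopy_class w"
  then have "homotopic_loops UNIV (word_loop w) c" using reparam_rel_refl by (auto simp: homotopy_class_def)
  then show "monodromy c (word_elt w)" by (rule monodromy_homotopic[OF monodromy_word_loop[OF w]])
next
  assume g: "monodromy c (word_elt w)"
  obtain v P N where ax: "axis_of (word_elt w) v P N" "\<And>t. c t = pants_proj (line P N (v * t))"
    using geodesic_loop_axis[OF c g] by blast
  show "reparam_rel `` {c} \<subseteq> homotopy_class w"
  proof
    fix c' assume "c' \<in> reparam_rel `` {c}"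
    then obtain f where f: "continuous_on UNIV f" "\<And>t. f (t + 1) = f t + 1" "c' = c \<circ> f"
      by (auto simp: reparam_rel_def)
    have "f 1 = f 0 + 1" using f(2)[of 0] by simp
    then have "monodromy c' (word_elt w)"
      using monodromy_of_axis[OF ax(1) _ f(1)] g by (simp add: f(3) comp_def ax(2) monodromy_def)
    then show "c' \<in> homotopy_class w"
      using homotopic_of_monodromy[OF monodromy_word_loop[OF w]] by (simp add: homotopy_class_def)
  qed
qed

section \<open>The correspondence\<close>

lemma shift_rel_sym: "(w, w') \<in> shift_rel \<Longrightarrow> (w', w) \<in> shift_rel"
proof -
  assume "(w, w') \<in> shift_rel"
  then obtain k where k: "w' = rotate (3 * k) w" by (auto simp: shift_rel_def)
  have "w = rotate (3 * k * length w - 3 * k) w'" unfolding k by (rule rotate_inverse[symmetric])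
  also have "3 * k * length w - 3 * k = 3 * (k * length w - k)" by (simp add: diff_mult_distrib2 mult.assoc)
  finally show ?thesis unfolding shift_rel_def by blast
qed

lemma shift_rel_trans: "(w, w') \<in> shift_rel \<Longrightarrow> (w', w'') \<in> shift_rel \<Longrightarrow> (w, w'') \<in> shift_rel"
proof -
  assume "(w, w') \<in> shift_rel" "(w', w'') \<in> shift_rel"
  then obtain j k where "w' = rotate (3 * j) w" "w'' = rotate (3 * k) w'" by (auto simp: shift_rel_def)
  then have "w'' = rotate (3 * (k + j)) w" by (simp add: rotate_rotate distrib_left)
  then show ?thesis unfolding shift_rel_def by blast
qed

lemma shift_rel_refl: "(w, w) \<in> shift_rel"
  unfolding shift_rel_def by (auto intro!: exI[of _ 0])

lemma rotate_concat_replicate_eq: "rotate k (concat (replicate n v)) = concat (replicate n (rotate k v))"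
proof (induction k)
  case (Suc k)
  have "rotate1 (concat (replicate n v)) = concat (replicate n (rotate1 v))" for v :: "'a list"
  proof (cases v)
    case Nil
    then show ?thesis by (induction n) auto
  next
    case (Cons x xs)
    have *: "concat (replicate n (x # xs)) @ [x] = x # concat (replicate n (xs @ [x]))" for n
      by (induction n) auto
    show ?thesis
    proof (cases n)
      case (Suc m)
      then show ?thesis using *[of m] by (simp add: Cons)
    qed simp
  qed
  then show ?case by (simp add: Suc)
qed simp

lemma periodic_word_shift: "(w, w') \<in> shift_rel \<Longrightarrow> periodic_word w \<Longrightarrow> periodic_word w'"
proof -
  assume "(w, w') \<in> shift_rel" "periodic_word w"
  then obtain k v N where *: "w' = rotate (3 * k) w" "loop_word v" "N \<ge> 2" "w = concat (replicate N v)"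
    by (auto simp: shift_rel_def periodic_word_def)
  then have "w' = concat (replicate N (rotate (3 * k) v))" by (simp add: rotate_concat_replicate_eq)
  moreover have "loop_word (rotate (3 * k) v)" using *(2) by (simp add: loop_word_def)
  ultimately show ?thesis using *(3) unfolding periodic_word_def by blast
qed

lemma nonperiodic_normal_shift:
  assumes "(w, w') \<in> shift_rel" "w \<in> nonperiodic_normal_words"
  shows "w' \<in> nonperiodic_normal_words"
proof -
  have "normal_word w'" using assms by (auto simp: shift_rel_def nonperiodic_normal_words_def normal_word_iff)
  moreover have "\<not> periodic_word w'"
    using periodic_word_shift[OF shift_rel_sym[OF assms(1)]] assms(2) by (auto simp: nonperiodic_normal_words_def)
  ultimately show ?thesis by (simp add: nonperiodic_normal_words_def)
qed

text \<open>The prefix moved by a shift has length divisible by 3, so its element is a conjugator in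
  Gamma(2).\<close>

lemma shift_rel_conj:
  assumes "(w, w') \<in> shift_rel" "3 dvd length w" "w \<noteq> []"
  shows "\<exists>k. psl_Gamma2 k \<and> word_elt w' = k * word_elt w * inverse k"
proof -
  obtain j where j: "w' = rotate (3 * j) w" using assms(1) by (auto simp: shift_rel_def)
  define m where "m = (3 * j) mod length w"
  have m: "3 dvd m" using assms(2) by (simp add: m_def dvd_mod)
  have le: "m \<le> length w"
    unfolding m_def using assms(3) by (intro less_imp_le mod_less_divisor) simp
  define c where "c = word_elt (take m w)"
  have "word_elt w = c * word_elt (drop m w)" unfolding c_def by (metis append_take_drop_id word_elt_simps(3))
  moreover have "word_elt w' = word_elt (drop m w) * c" by (simp add: j rotate_drop_take c_def m_def)
  ultimately have "word_elt w' = inverse c * word_elt w * inverse (inverse c)" by (simp add: mult.assoc)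
  moreover have "psl_Gamma2 (inverse c)" using m le by (simp add: c_def psl_Gamma2_word_iff)
  ultimately show ?thesis by blast
qed

lemma monodromy_conj_iff:
  assumes "psl_Gamma2 k"
  shows "monodromy c (k * g * inverse k) \<longleftrightarrow> monodromy c g"
proof
  assume "monodromy c (k * g * inverse k)"
  then have "monodromy c (inverse k * (k * g * inverse k) * inverse (inverse k))"
    by (rule monodromy_conj) (simp add: assms)
  then show "monodromy c g" by (simp add: mult.assoc)
qed (rule monodromy_conj[OF _ assms])

lemma closed_geodesicsE:
  assumes "G \<in> closed_geodesics"
  obtains c where "primitive_geodesic_loop c" "geodesic_loop c" "G = reparam_rel `` {c}"
  using assms unfolding closed_geodesics_def primitive_geodesic_loop_def by (auto elim!: quotientE)

lemma nonperiodic_normalD: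
  assumes "w \<in> nonperiodic_normal_words"
  shows "normal_word w" "cyc_normal w" "3 dvd length w" "\<not> periodic_word w"
  using assms by (auto simp: nonperiodic_normal_words_def normal_word_iff)

text \<open>If the geodesic on the axis of the word were a multiple, its monodromy would be a power
  of some h in Gamma(2). Repeating a normal word of h gives a normal word conjugate to w, and by
  uniqueness w would be a shift of this periodic word.\<close>

lemma closed_geodesic_exists:
  assumes w: "w \<in> nonperiodic_normal_words"
  shows "\<exists>G\<in>closed_geodesics. G \<subseteq> homotopy_class w"
proof -
  note wD = nonperiodic_normalD[OF w]
  have G: "psl_Gamma2 (word_elt w)" using wD by (simp add: psl_Gamma2_word_iff)
  obtain v P N where ax: "axis_of (word_elt w) v P N"
    using hyperbolic_axis[OF cyc_normal_hyperbolic[OF wD(2)]] by blast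
  define c where "c t = pants_proj (line P N (v * t))" for t
  have c: "geodesic_loop c" unfolding c_def by (rule geodesic_loop_of_axis[OF ax G])
  have mono: "monodromy c (word_elt w)"
    using monodromy_of_axis[OF ax G, of "\<lambda>t. t"] by (simp add: c_def[abs_def])
  have "primitive_geodesic_loop c"
  proof (rule ccontr)
    assume "\<not> primitive_geodesic_loop c"
    then obtain M d where d: "M \<ge> 2" "geodesic_loop d" "c = (\<lambda>t. d (real M * t))"
      using c by (auto simp: primitive_geodesic_loop_def)
    have M: "M > 0" using d(1) by simp
    obtain h where h: "psl_Gamma2 h" "psl_hyperbolic h" "monodromy c (h ^ M)"
      using multiple_geodesic_monodromy[OF d(2) M] d(3) by blast
    obtain u k where u: "normal_word u" "psl_Gamma2 k" "h = k * word_elt u * inverse k"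
      using Gamma2_normal_word_exists[OF h(2,1)] by blast
    define u' where "u' = concat (replicate M u)"
    have u': "normal_word u'" using u(1) M
      by (simp add: normal_word_iff u'_def cyc_normal_concat_replicate length_concat_replicate)
    have "h ^ M = k * word_elt u' * inverse k"
      by (simp add: u(3) psl_conj_power u'_def word_elt_concat_replicate)
    then have "monodromy c (word_elt u')" using h(3) monodromy_conj_iff[OF u(2)] by simp
    then obtain l where "psl_Gamma2 l" "word_elt w = l * word_elt u' * inverse l"
      using monodromy_unique[OF _ mono] by blast
    then have "(u', w) \<in> shift_rel" using Gamma2_normal_word_unique u' wD(1) by blast
    moreover have "periodic_word u'"
      unfolding periodic_word_def u'_def using u(1) d(1) by (auto simp: normal_word_def)
    ultimately show False using periodic_word_shift wD(4) by blast
  qed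
  then have "reparam_rel `` {c} \<in> closed_geodesics" unfolding closed_geodesics_def by (auto intro: quotientI)
  then show ?thesis using class_in_homotopy_class_iff[OF c wD(3)] mono by blast
qed

lemma closed_geodesic_unique:
  assumes w: "w \<in> nonperiodic_normal_words"
    and G: "G \<in> closed_geodesics" "G \<subseteq> homotopy_class w" and G': "G' \<in> closed_geodesics" "G' \<subseteq> homotopy_class w"
  shows "G = G'"
proof -
  note wD = nonperiodic_normalD[OF w]
  obtain c where c: "geodesic_loop c" "G = reparam_rel `` {c}" using G(1) by (elim closed_geodesicsE)
  obtain c' where c': "geodesic_loop c'" "G' = reparam_rel `` {c'}" using G'(1) by (elim closed_geodesicsE)
  have "monodromy c (word_elt w)" "monodromy c' (word_elt w)"
    using class_in_homotopy_class_iff wD(3) c c' G(2) G'(2) by blast+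
  then obtain a where "\<And>t. c' t = c (t + a)" using geodesic_loops_same_monodromy c(1) c'(1) by blast
  then have "c' = (\<lambda>t. c (t + a))" by blast
  then show ?thesis using c(2) c'(2) reparam_class_shift by simp
qed

text \<open>If the normal word were periodic, the repeated word v would be normal as well, hence
  hyperbolic in Gamma(2), and the geodesic would be a multiple of the one belonging to v.\<close>

lemma closed_geodesic_word:
  assumes "G \<in> closed_geodesics"
  shows "\<exists>w\<in>nonperiodic_normal_words. G \<subseteq> homotopy_class w"
proof -
  obtain c where c: "primitive_geodesic_loop c" "geodesic_loop c" "G = reparam_rel `` {c}"
    using assms by (elim closed_geodesicsE)
  obtain g where g: "monodromy c g" using geodesic_loop_monodromy_exists[OF c(2)] by blast
  have gG: "psl_Gamma2 g" using g by (simp add: monodromy_def)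
  obtain w k where w: "normal_word w" "psl_Gamma2 k" "g = k * word_elt w * inverse k"
    using Gamma2_normal_word_exists[OF geodesic_loop_hyperbolic[OF c(2) g] gG] by blast
  have mono: "monodromy c (word_elt w)" using g monodromy_conj_iff[OF w(2)] by (simp add: w(3))
  have cw: "cyc_normal w" "3 dvd length w" using w(1) by (simp_all add: normal_word_iff)
  have "\<not> periodic_word w"
  proof
    assume "periodic_word w"
    then obtain v N where v: "loop_word v" "N \<ge> 2" "w = concat (replicate N v)" by (auto simp: periodic_word_def)
    have "cyc_normal v" using cw(1) v(2,3) cyc_normal_concat_replicate[of N v] by simp
    then have "psl_hyperbolic (word_elt v)" by (rule cyc_normal_hyperbolic)
    moreover have "psl_Gamma2 (word_elt v)" using v(1) by (simp add: psl_Gamma2_word_iff loop_word_def)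
    moreover have "monodromy c (word_elt v ^ N)" using mono v(3) by (simp add: word_elt_concat_replicate)
    ultimately show False using power_not_primitive[OF c(2)] v(2) c(1) by blast
  qed
  then have "w \<in> nonperiodic_normal_words" using w(1) by (simp add: nonperiodic_normal_words_def)
  then show ?thesis using class_in_homotopy_class_iff[OF c(2) cw(2)] mono c(3) by blast
qed

lemma closed_geodesic_same_words:
  assumes G: "G \<in> closed_geodesics" and w: "w \<in> nonperiodic_normal_words" "w' \<in> nonperiodic_normal_words"
    and sub: "G \<subseteq> homotopy_class w" 
  shows "G \<subseteq> homotopy_class w' \<longleftrightarrow> (w, w') \<in> shift_rel"
proof -
  obtain c where c: "geodesic_loop c" "G = reparam_rel `` {c}" using G by (elim closed_geodesicsE)
  note wD = nonperiodic_normalD[OF w(1)] and wD' = nonperiodic_normalD[OF w(2)]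
  have m: "monodromy c (word_elt w)" using class_in_homotopy_class_iff[OF c(1) wD(3)] sub c(2) by simp
  have "monodromy c (word_elt w') \<longleftrightarrow> (w, w') \<in> shift_rel"
  proof
    assume "monodromy c (word_elt w')"
    then obtain k where "psl_Gamma2 k" "word_elt w' = k * word_elt w * inverse k" using monodromy_unique[OF m] by blast
    then show "(w, w') \<in> shift_rel" using Gamma2_normal_word_unique wD(1) wD'(1) by blast
  next
    assume "(w, w') \<in> shift_rel"
    moreover have "w \<noteq> []" using wD(2) by (simp add: cyc_normal_def)
    ultimately obtain k where "psl_Gamma2 k" "word_elt w' = k * word_elt w * inverse k"
      using shift_rel_conj wD(3) by blast
    then show "monodromy c (word_elt w')" using m monodromy_conj by simp
  qed
  then show ?thesis using class_in_homotopy_class_iff[OF c(1) wD'(3)] c(2) by simp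
qed

text \<open>The second conjunct pins down \<open>\<Phi>\<close> by free homotopy classes, so it also
  says that each class of a nonperiodic normal word contains exactly one closed geodesic.\<close>

theorem corollary1p8:
  shows "\<exists>\<Phi>. bij_betw \<Phi> (nonperiodic_normal_words // shift_rel) closed_geodesics \<and>
    (\<forall>w\<in>nonperiodic_normal_words. \<forall>G\<in>closed_geodesics.
       G \<subseteq> homotopy_class w \<longleftrightarrow> G = \<Phi> (shift_rel `` {w}))"
proof -
  have "\<forall>w\<in>nonperiodic_normal_words. \<exists>G. G \<in> closed_geodesics \<and> G \<subseteq> homotopy_class w"
    using closed_geodesic_exists by blast
  then obtain \<Psi> where Psi: "\<And>w. w \<in> nonperiodic_normal_words \<Longrightarrow> \<Psi> w \<in> closed_geodesics"
      "\<And>w. w \<in> nonperiodic_normal_words \<Longrightarrow> \<Psi> w \<subseteq> homotopy_class w" by metis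
  have iff: "G \<subseteq> homotopy_class w \<longleftrightarrow> G = \<Psi> w" if "w \<in> nonperiodic_normal_words" "G \<in> closed_geodesics" for w G
    using closed_geodesic_unique that Psi by blast
  have eq: "\<Psi> w = \<Psi> w' \<longleftrightarrow> (w, w') \<in> shift_rel"
    if w: "w \<in> nonperiodic_normal_words" "w' \<in> nonperiodic_normal_words" for w w'
    using closed_geodesic_same_words[OF Psi(1)[OF w(1)] w Psi(2)[OF w(1)]] iff[OF w(2) Psi(1)[OF w(1)]] by simp
  \<comment> \<open>The choice of a representative is harmless by \<open>eq\<close>, as a shift of a
    nonperiodic normal word is again one.\<close>
  define \<Phi> where "\<Phi> S = \<Psi> (SOME w. w \<in> S)" for S
  have Phi: "\<Phi> (shift_rel `` {w}) = \<Psi> w" if w: "w \<in> nonperiodic_normal_words" for w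
  proof -
    have "(SOME u. u \<in> shift_rel `` {w}) \<in> shift_rel `` {w}"
      by (rule someI[of _ w]) (simp add: shift_rel_refl)
    then have "(w, SOME u. u \<in> shift_rel `` {w}) \<in> shift_rel" by simp
    then show ?thesis unfolding \<Phi>_def using eq w nonperiodic_normal_shift by metis
  qed
  have "bij_betw \<Phi> (nonperiodic_normal_words // shift_rel) closed_geodesics"
    unfolding bij_betw_def
  proof
    show "inj_on \<Phi> (nonperiodic_normal_words // shift_rel)"
    proof (rule inj_onI)
      fix S S' assume "S \<in> nonperiodic_normal_words // shift_rel" "S' \<in> nonperiodic_normal_words // shift_rel"
        and e: "\<Phi> S = \<Phi> S'"
      then obtain w w' where w: "w \<in> nonperiodic_normal_words" "S = shift_rel `` {w}"
        "w' \<in> nonperiodic_normal_words" "S' = shift_rel `` {w'}" by (auto elim!: quotientE)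
      then have "(w, w') \<in> shift_rel" using e Phi eq by simp
      then show "S = S'" unfolding w using shift_rel_sym shift_rel_trans by blast
    qed
    show "\<Phi> ` (nonperiodic_normal_words // shift_rel) = closed_geodesics"
    proof
      show "\<Phi> ` (nonperiodic_normal_words // shift_rel) \<subseteq> closed_geodesics"
        using Phi Psi(1) by (auto elim!: quotientE)
      show "closed_geodesics \<subseteq> \<Phi> ` (nonperiodic_normal_words // shift_rel)"
      proof
        fix G assume G: "G \<in> closed_geodesics"
        then obtain w where w: "w \<in> nonperiodic_normal_words" "G \<subseteq> homotopy_class w" using closed_geodesic_word by blast
        then have "G = \<Phi> (shift_rel `` {w})" using iff G Phi by simp
        then show "G \<in> \<Phi> ` (nonperiodic_normal_words // shift_rel)" using quotientI[OF w(1)] by blast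
      qed
    qed
  qed
  moreover have "\<forall>w\<in>nonperiodic_normal_words. \<forall>G\<in>closed_geodesics. G \<subseteq> homotopy_class w \<longleftrightarrow> G = \<Phi> (shift_rel `` {w})"
    using iff Phi by simp
  ultimately show ?thesis by blast
qed

end
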